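(* Let $OH(I)$ denote the operator Hilbert space structure on $\ell^2(I)$ for an index set $I$, regarded as an algebra (and left module over itself) under pointwise multiplication. Then $$(OH(I))^h=OH(I)^*.$$
   Context: $OH(I)$ is Pisier's operator Hilbert space structure on $\ell^2(I)$: for finitely supported families $(x_i)$ in $\mathcal{K}(\ell^2)$, $\|\sum_i x_i\otimes\delta_i\|=\|\sum_i x_i\otimes\bar{x}_i\|_{\min}^{1/2}$. It is known that $OH(I)$ is an operator algebra under pointwise multiplication. For a completely contractive Banach algebra $A$ and a left operator $A$-module $X$, $A\otimes^h_A X:=(A\otimes^h X)/N_X$, where $\otimes^h$ is the Haagerup tensor product and $N_X$ is the closed linear span in $A\otimes^h X$ of $\{ab\otimes x-a\otimes b\cdot x:a,b\in A,\ x\in X\}$; the Haagerup dual is $X^h:=(A\otimes^h_A X)^*$ with the dual operator space structure. Here $A=X=OH(I)$ with the pointwise product. An equality of operator spaces means completely isometric isomorphism. *)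

theory Defs
  imports
    "HOL-Analysis.Infinite_Sum"
    "HOL-Algebra.AbelCoset"
    "HOL-Algebra.Module"
    "Jordan_Normal_Form.Matrix"
begin

section \<open>Matrices\<close>

definition vec_l2norm :: "complex vec \<Rightarrow> real" where
  "vec_l2norm v = sqrt (\<Sum>i<dim_vec v. (cmod (vec_index v i))\<^sup>2)"

definition mat_opnorm :: "complex mat \<Rightarrow> real" where
  "mat_opnorm A =
     Sup {vec_l2norm (A *\<^sub>v v) | v. v \<in> carrier_vec (dim_col A) \<and> vec_l2norm v \<le> 1}"

text \<open>The matrix of all \<open>b (X\<^sub>i\<^sub>j) (Y\<^sub>k\<^sub>l)\<close>, with row index \<open>(i,k)\<close> and column index \<open>(j,l)\<close>
  in lexicographic order. When \<open>b\<close> is multiplication this is the Kronecker product.\<close>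

definition mat_pairing :: "('a \<Rightarrow> 'b \<Rightarrow> 'c) \<Rightarrow> 'a mat \<Rightarrow> 'b mat \<Rightarrow> 'c mat" where
  "mat_pairing b X Y =
     mat (dim_row X * dim_row Y) (dim_col X * dim_col Y)
       (\<lambda>(r, s). b (X $$ (r div dim_row Y, s div dim_col Y))
                   (Y $$ (r mod dim_row Y, s mod dim_col Y)))"

abbreviation kronecker :: "complex mat \<Rightarrow> complex mat \<Rightarrow> complex mat" where
  "kronecker \<equiv> mat_pairing (*)"


section \<open>Spaces with matrix norms\<close>

text \<open>A complex vector space with a norm on square matrices of every size over it.
  The fields \<open>mult\<close> and \<open>one\<close> inherited from the module record are meaningful only
  for algebras, and \<open>one\<close> only for unital ones.\<close>

record 'a opspace = "(complex, 'a) module" +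
  mnorm :: "'a mat \<Rightarrow> real"

definition matrices :: "('a, 'm) opspace_scheme \<Rightarrow> nat \<Rightarrow> nat \<Rightarrow> 'a mat set" where
  "matrices V m n = {x \<in> carrier_mat m n. elements_mat x \<subseteq> carrier V}"

definition vnorm :: "('a, 'm) opspace_scheme \<Rightarrow> 'a \<Rightarrow> real" where
  "vnorm V v = mnorm V (mat 1 1 (\<lambda>_. v))"

text \<open>The norm of a rectangular matrix is that of the square matrix obtained by adding
  zero rows or zero columns.\<close>

definition square_pad :: "('a, 'm) opspace_scheme \<Rightarrow> 'a mat \<Rightarrow> 'a mat" where
  "square_pad V x =
     (let k = max (dim_row x) (dim_col x) in
      mat k k (\<lambda>(i, j). if i < dim_row x \<and> j < dim_col x then x $$ (i, j) else \<zero>\<^bsub>V\<^esub>))"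

definition rect_mnorm :: "('a, 'm) opspace_scheme \<Rightarrow> 'a mat \<Rightarrow> real" where
  "rect_mnorm V x = mnorm V (square_pad V x)"

definition linear_functional :: "('a, 'm) opspace_scheme \<Rightarrow> ('a \<Rightarrow> complex) \<Rightarrow> bool" where
  "linear_functional V f \<longleftrightarrow>
     (\<forall>x\<in>carrier V. \<forall>y\<in>carrier V. f (x \<oplus>\<^bsub>V\<^esub> y) = f x + f y) \<and>
     (\<forall>c. \<forall>x\<in>carrier V. f (c \<odot>\<^bsub>V\<^esub> x) = c * f x)"

definition linear_map_on ::
  "('a, 'm) opspace_scheme \<Rightarrow> ('b, 'n) opspace_scheme \<Rightarrow> ('a \<Rightarrow> 'b) \<Rightarrow> bool" where
  "linear_map_on V W T \<longleftrightarrow>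
     T \<in> carrier V \<rightarrow> carrier W \<and>
     (\<forall>x\<in>carrier V. \<forall>y\<in>carrier V. T (x \<oplus>\<^bsub>V\<^esub> y) = T x \<oplus>\<^bsub>W\<^esub> T y) \<and>
     (\<forall>c. \<forall>x\<in>carrier V. T (c \<odot>\<^bsub>V\<^esub> x) = c \<odot>\<^bsub>W\<^esub> T x)"

definition completely_isometric_iso ::
  "('a, 'm) opspace_scheme \<Rightarrow> ('b, 'n) opspace_scheme \<Rightarrow> ('a \<Rightarrow> 'b) \<Rightarrow> bool" where
  "completely_isometric_iso V W T \<longleftrightarrow>
     linear_map_on V W T \<and> bij_betw T (carrier V) (carrier W) \<and>
     (\<forall>n. \<forall>x\<in>matrices V n n. mnorm W (map_mat T x) = mnorm V x)"

definition completely_isometrically_isomorphic ::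
  "('a, 'm) opspace_scheme \<Rightarrow> ('b, 'n) opspace_scheme \<Rightarrow> bool" where
  "completely_isometrically_isomorphic V W \<longleftrightarrow> (\<exists>T. completely_isometric_iso V W T)"

definition lin_span :: "('a, 'm) opspace_scheme \<Rightarrow> 'a set \<Rightarrow> 'a set" where
  "lin_span V S =
     {finsum V (\<lambda>k. c k \<odot>\<^bsub>V\<^esub> s k) {..<n} | (n::nat) c s. s \<in> {..<n} \<rightarrow> S}"

definition norm_closure :: "('a, 'm) opspace_scheme \<Rightarrow> 'a set \<Rightarrow> 'a set" where
  "norm_closure V S = {v \<in> carrier V. \<forall>e>0. \<exists>s\<in>S. vnorm V (v \<ominus>\<^bsub>V\<^esub> s) < e}"


section \<open>Quotient, completion, dual\<close>

definition op_quotient :: "('a, 'm) opspace_scheme \<Rightarrow> 'a set \<Rightarrow> 'a set opspace" where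
  "op_quotient V N =
     \<lparr>carrier = a_rcosets\<^bsub>V\<^esub> N, mult = undefined, one = undefined,
      zero = N,
      add = (\<lambda>C D. C <+>\<^bsub>V\<^esub> D),
      smult = (\<lambda>c C. \<Union>x\<in>C. N +>\<^bsub>V\<^esub> (c \<odot>\<^bsub>V\<^esub> x)),
      mnorm = (\<lambda>X. Inf {mnorm V x | x.
         x \<in> matrices V (dim_row X) (dim_col X) \<and> X = map_mat (\<lambda>v. N +>\<^bsub>V\<^esub> v) x})\<rparr>"

text \<open>The completion consists of the Cauchy sequences modulo the null sequences. The
  matrix norms of \<open>cauchy_space\<close> are only seminorms; the quotient makes them norms.\<close>

definition cauchy_space :: "('a, 'm) opspace_scheme \<Rightarrow> (nat \<Rightarrow> 'a) opspace" where
  "cauchy_space V =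
     \<lparr>carrier = {s. range s \<subseteq> carrier V \<and>
        (\<forall>e>0. \<exists>K. \<forall>m\<ge>K. \<forall>n\<ge>K. vnorm V (s m \<ominus>\<^bsub>V\<^esub> s n) < e)},
      mult = undefined, one = undefined,
      zero = (\<lambda>_. \<zero>\<^bsub>V\<^esub>),
      add = (\<lambda>s t k. s k \<oplus>\<^bsub>V\<^esub> t k),
      smult = (\<lambda>c s k. c \<odot>\<^bsub>V\<^esub> s k),
      mnorm = (\<lambda>S. lim (\<lambda>k. mnorm V (map_mat (\<lambda>s. s k) S)))\<rparr>"

definition null_sequences :: "('a, 'm) opspace_scheme \<Rightarrow> (nat \<Rightarrow> 'a) set" where
  "null_sequences V = {s. range s \<subseteq> carrier V \<and> (\<lambda>k. vnorm V (s k)) \<longlonglongrightarrow> 0}"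

definition op_completion :: "('a, 'm) opspace_scheme \<Rightarrow> (nat \<Rightarrow> 'a) set opspace" where
  "op_completion V = op_quotient (cauchy_space V) (null_sequences V)"

definition to_completion :: "('a, 'm) opspace_scheme \<Rightarrow> 'a \<Rightarrow> (nat \<Rightarrow> 'a) set" where
  "to_completion V v = null_sequences V +>\<^bsub>cauchy_space V\<^esub> (\<lambda>_. v)"

text \<open>The dual operator space structure: a matrix \<open>F\<close> of functionals is normed as
  the completely bounded map \<open>x \<mapsto> (F\<^sub>i\<^sub>j(x))\<close> into the scalar matrices. Functionals are made
  unique as HOL functions by the value 0 off the carrier.\<close>

definition op_dual :: "('a, 'm) opspace_scheme \<Rightarrow> ('a \<Rightarrow> complex) opspace" where
  "op_dual V =
     \<lparr>carrier = {f. linear_functional V f \<and>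
        (\<exists>C. \<forall>x\<in>carrier V. cmod (f x) \<le> C * vnorm V x) \<and> (\<forall>x. x \<notin> carrier V \<longrightarrow> f x = 0)},
      mult = undefined, one = undefined,
      zero = (\<lambda>_. 0),
      add = (\<lambda>f g x. f x + g x),
      smult = (\<lambda>c f x. c * f x),
      mnorm = (\<lambda>F. Sup {mat_opnorm (mat_pairing (\<lambda>f v. f v) F x) | x k.
         x \<in> matrices V k k \<and> mnorm V x \<le> 1})\<rparr>"


section \<open>Haagerup tensor products\<close>

text \<open>The algebraic tensor product is realised inside the algebraic dual of the space of
  bilinear forms: \<open>x \<otimes> y\<close> is evaluation at \<open>(x, y)\<close>. Sums of elementary tensors
  are closed under scalars, which can be absorbed in one factor.\<close>

definition bilinear_forms ::
  "('a, 'm) opspace_scheme \<Rightarrow> ('b, 'n) opspace_scheme \<Rightarrow> ('a \<Rightarrow> 'b \<Rightarrow> complex) set" where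
  "bilinear_forms V W =
     {B. (\<forall>y\<in>carrier W. linear_functional V (\<lambda>x. B x y)) \<and>
         (\<forall>x\<in>carrier V. linear_functional W (\<lambda>y. B x y))}"

definition elem_tensor ::
  "('a, 'm) opspace_scheme \<Rightarrow> ('b, 'n) opspace_scheme \<Rightarrow> 'a \<Rightarrow> 'b \<Rightarrow> ('a \<Rightarrow> 'b \<Rightarrow> complex) \<Rightarrow> complex"
  where "elem_tensor V W x y = (\<lambda>B. if B \<in> bilinear_forms V W then B x y else 0)"

text \<open>The matrix product \<open>a \<odot> b\<close> with entries \<open>\<Sum>\<^sub>l a\<^sub>i\<^sub>l \<otimes> b\<^sub>l\<^sub>j\<close>.\<close>

definition tensor_matprod ::
  "('a, 'm) opspace_scheme \<Rightarrow> ('b, 'n) opspace_scheme \<Rightarrow> 'a mat \<Rightarrow> 'b mat \<Rightarrow>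
   (('a \<Rightarrow> 'b \<Rightarrow> complex) \<Rightarrow> complex) mat" where
  "tensor_matprod V W a b =
     mat (dim_row a) (dim_col b)
       (\<lambda>(i, j) B. \<Sum>l<dim_col a. elem_tensor V W (a $$ (i, l)) (b $$ (l, j)) B)"

definition alg_haagerup ::
  "('a, 'm) opspace_scheme \<Rightarrow> ('b, 'n) opspace_scheme \<Rightarrow>
   (('a \<Rightarrow> 'b \<Rightarrow> complex) \<Rightarrow> complex) opspace" where
  "alg_haagerup V W =
     \<lparr>carrier = {(\<lambda>B. \<Sum>k<n. elem_tensor V W (x k) (y k) B) | (n::nat) x y.
        x \<in> {..<n} \<rightarrow> carrier V \<and> y \<in> {..<n} \<rightarrow> carrier W},
      mult = undefined, one = undefined,
      zero = (\<lambda>_. 0),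
      add = (\<lambda>u v B. u B + v B),
      smult = (\<lambda>c u B. c * u B),
      mnorm = (\<lambda>u. Inf {rect_mnorm V a * rect_mnorm W b | a b k.
         a \<in> matrices V (dim_row u) k \<and> b \<in> matrices W k (dim_col u) \<and>
         u = tensor_matprod V W a b})\<rparr>"

type_synonym ('a, 'b) haagerup = "(nat \<Rightarrow> ('a \<Rightarrow> 'b \<Rightarrow> complex) \<Rightarrow> complex) set"

definition haagerup_tensor ::
  "('a, 'm) opspace_scheme \<Rightarrow> ('b, 'n) opspace_scheme \<Rightarrow> ('a, 'b) haagerup opspace" where
  "haagerup_tensor V W = op_completion (alg_haagerup V W)"

definition haagerup_elem ::
  "('a, 'm) opspace_scheme \<Rightarrow> ('b, 'n) opspace_scheme \<Rightarrow> 'a \<Rightarrow> 'b \<Rightarrow> ('a, 'b) haagerup" where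
  "haagerup_elem V W x y = to_completion (alg_haagerup V W) (elem_tensor V W x y)"

text \<open>Below, \<open>act\<close> is the left action of the algebra \<open>A\<close> on \<open>X\<close>.\<close>

definition balanced_kernel ::
  "('a, 'm) opspace_scheme \<Rightarrow> ('x, 'n) opspace_scheme \<Rightarrow> ('a \<Rightarrow> 'x \<Rightarrow> 'x) \<Rightarrow>
   ('a, 'x) haagerup set" where
  "balanced_kernel A X act =
     norm_closure (haagerup_tensor A X) (lin_span (haagerup_tensor A X)
       {haagerup_elem A X (a \<otimes>\<^bsub>A\<^esub> b) x \<ominus>\<^bsub>haagerup_tensor A X\<^esub> haagerup_elem A X a (act b x)
         | a b x. a \<in> carrier A \<and> b \<in> carrier A \<and> x \<in> carrier X})"

definition haagerup_module_tensor ::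
  "('a, 'm) opspace_scheme \<Rightarrow> ('x, 'n) opspace_scheme \<Rightarrow> ('a \<Rightarrow> 'x \<Rightarrow> 'x) \<Rightarrow>
   ('a, 'x) haagerup set opspace" where
  "haagerup_module_tensor A X act =
     op_quotient (haagerup_tensor A X) (balanced_kernel A X act)"

definition haagerup_dual ::
  "('a, 'm) opspace_scheme \<Rightarrow> ('x, 'n) opspace_scheme \<Rightarrow> ('a \<Rightarrow> 'x \<Rightarrow> 'x) \<Rightarrow>
   (('a, 'x) haagerup set \<Rightarrow> complex) opspace" where
  "haagerup_dual A X act = op_dual (haagerup_module_tensor A X act)"


section \<open>Operator Hilbert space\<close>

text \<open>For \<open>x = \<Sum>\<^sub>i x\<^sub>i \<otimes> \<delta>\<^sub>i\<close> with scalar matrices \<open>x\<^sub>i\<close>, the paired matrix in the norm is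
  \<open>\<Sum>\<^sub>i x\<^sub>i \<otimes> conj x\<^sub>i\<close>, whose entries converge absolutely for square summable families;
  see \<open>OH_mnorm_finite\<close> for the finitely supported case. Elements of \<open>\<ell>\<^sup>2(I)\<close> are
  extended by 0 off \<open>I\<close>.\<close>

definition OH :: "'i set \<Rightarrow> ('i \<Rightarrow> complex) opspace" where
  "OH I =
     \<lparr>carrier = {f. (\<lambda>i. (cmod (f i))\<^sup>2) summable_on I \<and> (\<forall>i. i \<notin> I \<longrightarrow> f i = 0)},
      mult = (\<lambda>f g i. f i * g i), one = undefined,
      zero = (\<lambda>_. 0),
      add = (\<lambda>f g i. f i + g i),
      smult = (\<lambda>c f i. c * f i),
      mnorm = (\<lambda>x. sqrt (mat_opnorm (mat_pairing (\<lambda>f g. \<Sum>\<^sub>\<infinity>i\<in>I. f i * cnj (g i)) x x)))\<rparr>"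

lemma OH_mnorm_finite:
  assumes F: "finite F" "F \<subseteq> I"
    and x: "x \<in> matrices (OH I) n n" "\<And>f i. f \<in> elements_mat x \<Longrightarrow> i \<notin> F \<Longrightarrow> f i = 0"
  shows "mnorm (OH I) x =
    sqrt (mat_opnorm (mat (n * n) (n * n) (\<lambda>rs. \<Sum>i\<in>F.
      kronecker (map_mat (\<lambda>f. f i) x) (map_mat (\<lambda>f. cnj (f i)) x) $$ rs)))"
proof -
  have dim: "dim_row x = n" "dim_col x = n"
    using x(1) by (auto simp: matrices_def)
  have "mat_pairing (\<lambda>f g. \<Sum>\<^sub>\<infinity>i\<in>I. f i * cnj (g i)) x x =
    mat (n * n) (n * n) (\<lambda>rs. \<Sum>i\<in>F.
      kronecker (map_mat (\<lambda>f. f i) x) (map_mat (\<lambda>f. cnj (f i)) x) $$ rs)"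
  proof (rule eq_matI)
    fix r s
    assume "r < dim_row (mat (n * n) (n * n) (\<lambda>rs. \<Sum>i\<in>F.
      kronecker (map_mat (\<lambda>f. f i) x) (map_mat (\<lambda>f. cnj (f i)) x) $$ rs))"
      "s < dim_col (mat (n * n) (n * n) (\<lambda>rs. \<Sum>i\<in>F.
      kronecker (map_mat (\<lambda>f. f i) x) (map_mat (\<lambda>f. cnj (f i)) x) $$ rs))"
    then have rs: "r < n * n" "s < n * n" by auto
    then have "n > 0" by (cases n) auto
    then have lt: "r div n < n" "r mod n < n" "s div n < n" "s mod n < n"
      using rs by (auto simp: less_mult_imp_div_less)
    define f where "f = x $$ (r div n, s div n)"
    define g where "g = x $$ (r mod n, s mod n)"
    have "f \<in> elements_mat x"
      using lt dim unfolding f_def by (auto simp: elements_matI[where A=x and nr=n and nc=n])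
    then have "(\<Sum>\<^sub>\<infinity>i\<in>I. f i * cnj (g i)) = (\<Sum>\<^sub>\<infinity>i\<in>F. f i * cnj (g i))"
      using x(2) F(2) by (intro infsum_cong_neutral) auto
    also have "\<dots> = (\<Sum>i\<in>F. f i * cnj (g i))"
      using F(1) by simp
    finally show "mat_pairing (\<lambda>f g. \<Sum>\<^sub>\<infinity>i\<in>I. f i * cnj (g i)) x x $$ (r, s) =
      mat (n * n) (n * n) (\<lambda>rs. \<Sum>i\<in>F.
      kronecker (map_mat (\<lambda>f. f i) x) (map_mat (\<lambda>f. cnj (f i)) x) $$ rs) $$ (r, s)"
      using rs lt dim by (simp add: mat_pairing_def f_def g_def)
  qed (auto simp: mat_pairing_def dim)
  then show ?thesis by (simp add: OH_def)
qed

end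

theory Submission
  imports Defs
    "HOL-Analysis.Convex"
    "Jordan_Normal_Form.Spectral_Radius"
begin

text \<open>
  Modulo the balanced kernel, \<open>OH \<otimes>\<^sup>h OH\<close> is a copy of \<open>OH\<close>: the tensors
  \<open>\<delta>\<^sub>i \<otimes> \<delta>\<^sub>j\<close> with \<open>i \<noteq> j\<close> are in the kernel, and the multiplication
  map carries \<open>\<delta>\<^sub>i \<otimes> \<delta>\<^sub>i\<close> to \<open>\<delta>\<^sub>i\<close>. Multiplication is completely contractive because
  \<open>\<Sum>\<^sub>i a\<^sub>i b\<^sub>i \<otimes> conj (a\<^sub>i b\<^sub>i)\<close> is a part of \<open>(\<Sum>\<^sub>i a\<^sub>i \<otimes> conj a\<^sub>i) (\<Sum>\<^sub>j b\<^sub>j \<otimes> conj b\<^sub>j)\<close> and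
  dropping terms from \<open>\<Sum>\<^sub>s c\<^sub>s \<otimes> conj c\<^sub>s\<close> does not increase its norm.

  It is a complete quotient map because a finite family of matrices with
  \<open>\<parallel>\<Sum>\<^sub>i x\<^sub>i \<otimes> conj x\<^sub>i\<parallel> < \<mu>\<close> can be factored as \<open>x\<^sub>i = \<alpha>\<^sub>i \<beta>\<^sub>i\<close> where the families \<open>\<alpha>\<^sub>i \<alpha>\<^sub>i\<^sup>*\<close> and
  \<open>\<beta>\<^sub>i\<^sup>* \<beta>\<^sub>i\<close> satisfy the bound \<open>\<mu>\<close> as well. To obtain it, take strictly positive \<open>X\<close>, \<open>Y\<close> with
  \<open>\<Sum>\<^sub>i x\<^sub>i Y x\<^sub>i\<^sup>* \<le> \<mu> X\<close> and \<open>\<Sum>\<^sub>i x\<^sub>i\<^sup>* X x\<^sub>i \<le> \<mu> Y\<close>, conjugate \<open>x\<^sub>i\<close> to \<open>X\<^sup>\<onehalf> x\<^sub>i Y\<^sup>\<onehalf>\<close>, and split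
  along the polar decomposition: then \<open>P\<^sub>i = \<alpha>\<^sub>i \<alpha>\<^sub>i\<^sup>*\<close> satisfies \<open>\<Sum>\<^sub>i P\<^sub>i X P\<^sub>i \<le> \<mu> X\<close>, and a positive
  supersolution bounds the norm of the self-adjoint map \<open>Z \<mapsto> \<Sum>\<^sub>i P\<^sub>i Z P\<^sub>i\<close>.
\<close>

subsection \<open>Finite matrices of arbitrary size\<close>

text \<open>Only duals are compared, so multiplication never has to be inverted on the completed
  tensor product. It is enough that finitely supported matrices over \<open>OH I\<close> lift to
  tensors of barely larger norm; truncation and limits then transfer the bounds on functionals. The
  norm of \<open>OH\<close> is read as that of the map
  \<open>Z \<mapsto> \<Sum>\<^sub>s x\<^sub>s Z x\<^sub>s\<^sup>*\<close> on Hilbert-Schmidt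
  matrices. Positive arguments suffice to bound it, and there the form is a sum of squares, hence
  monotone in the family; this is why terms may be dropped. The obstacle is that a Haagerup
  factorization sees rows and columns, not coordinates. Giving each coordinate its own block of
  inner indices lets the matrices \<open>\<alpha>\<^sub>s \<alpha>\<^sub>s\<^sup>*\<close> control
  the row norm, and this dictates the form of the factorization. The strict inequality it starts
  from is spent on the Neumann series and on regularizing singular polar decompositions. Bounds on
  squared norms of rows and columns over \<open>OH\<close> add, which makes the infimum over
  factorizations subadditive.\<close>

text \<open>Matrices of all sizes live in one type as finitely supported infinite matrices, a
  \<open>*\<close>-algebra without unit. Padding with zeros is then the identity. The norm is the
  Hilbert-Schmidt norm.\<close>

typedef fmat = "{f :: nat \<Rightarrow> nat \<Rightarrow> complex. \<exists>N. \<forall>i j. N \<le> i \<or> N \<le> j \<longrightarrow> f i j = 0}"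
  morphisms entry Abs_fmat by (rule exI[of _ "\<lambda>_ _. 0"]) simp

setup_lifting type_definition_fmat

lemma fmat_eqI: "(\<And>i j. entry A i j = entry B i j) \<Longrightarrow> A = B"
  by (metis entry_inverse ext)

definition in_size :: "nat \<Rightarrow> fmat \<Rightarrow> bool" where
  "in_size n A \<longleftrightarrow> (\<forall>i j. n \<le> i \<or> n \<le> j \<longrightarrow> entry A i j = 0)"

lemma in_size_D: "in_size n A \<Longrightarrow> n \<le> i \<Longrightarrow> entry A i j = 0" "in_size n A \<Longrightarrow> n \<le> j \<Longrightarrow> entry A i j = 0"
  by (auto simp: in_size_def)

lemma in_size_mono: "in_size n A \<Longrightarrow> n \<le> m \<Longrightarrow> in_size m A"
  by (auto simp: in_size_def)

lemma in_size_ex: "\<exists>n. in_size n A"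
  using entry[of A] by (auto simp: in_size_def)

lemma in_size_all:
  assumes "finite S" shows "\<exists>n\<ge>m. \<forall>A\<in>S. in_size n A"
  using assms
proof induction
  case (insert A S)
  then obtain n where n: "n \<ge> m" "\<forall>A\<in>S. in_size n A" by blast
  obtain k where "in_size k A" using in_size_ex by blast
  then show ?case using n
    by (intro exI[of _ "max n k"]) (auto intro: in_size_mono)
qed auto

lemma in_size_ex2: "\<exists>n\<ge>m. in_size n A \<and> in_size n B"
  using in_size_all[of "{A, B}" m] by auto

instantiation fmat :: ab_group_add
begin
lift_definition zero_fmat :: fmat is "\<lambda>_ _. 0" by simp
lift_definition plus_fmat :: "fmat \<Rightarrow> fmat \<Rightarrow> fmat" is "\<lambda>f g i j. f i j + g i j"
proof -
  fix f g :: "nat \<Rightarrow> nat \<Rightarrow> complex"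
  assume "\<exists>N. \<forall>i j. N \<le> i \<or> N \<le> j \<longrightarrow> f i j = 0" "\<exists>N. \<forall>i j. N \<le> i \<or> N \<le> j \<longrightarrow> g i j = 0"
  then obtain N M where "\<forall>i j. N \<le> i \<or> N \<le> j \<longrightarrow> f i j = 0" "\<forall>i j. M \<le> i \<or> M \<le> j \<longrightarrow> g i j = 0"
    by blast
  then show "\<exists>N. \<forall>i j. N \<le> i \<or> N \<le> j \<longrightarrow> f i j + g i j = 0"
    by (intro exI[of _ "max N M"]) auto
qed
lift_definition uminus_fmat :: "fmat \<Rightarrow> fmat" is "\<lambda>f i j. - f i j" by simp
definition "A - B = A + - (B :: fmat)"
instance
proof
  fix A B C :: fmat
  show "A + B + C = A + (B + C)" "A + B = B + A" "0 + A = A" "- A + A = 0"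
    by (rule fmat_eqI; simp add: plus_fmat.rep_eq zero_fmat.rep_eq uminus_fmat.rep_eq)+
  show "A - B = A + - B" by (rule minus_fmat_def)
qed
end

lemma entry_zero [simp]: "entry 0 i j = 0" by transfer simp
lemma entry_plus [simp]: "entry (A + B) i j = entry A i j + entry B i j" by transfer simp
lemma entry_uminus [simp]: "entry (- A) i j = - entry A i j" by transfer simp
lemma entry_minus [simp]: "entry (A - B) i j = entry A i j - entry B i j"
  unfolding minus_fmat_def by (simp only: entry_plus entry_uminus) simp
lemma entry_sum [simp]: "entry (sum f S) i j = (\<Sum>s\<in>S. entry (f s) i j)"
  by (induction S rule: infinite_finite_induct) auto

text \<open>The summation set is the support of a row, which is finite, so the product is defined
  without mentioning a common size; \<open>entry_times\<close> recovers the usual bounded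
  sum.\<close>

lift_definition times_aux :: "fmat \<Rightarrow> fmat \<Rightarrow> fmat" is "\<lambda>f g i j. \<Sum>k | f i k \<noteq> 0. f i k * g k j"
proof -
  fix f g :: "nat \<Rightarrow> nat \<Rightarrow> complex"
  assume "\<exists>N. \<forall>i j. N \<le> i \<or> N \<le> j \<longrightarrow> f i j = 0" "\<exists>N. \<forall>i j. N \<le> i \<or> N \<le> j \<longrightarrow> g i j = 0"
  then obtain N M where "\<forall>i j. N \<le> i \<or> N \<le> j \<longrightarrow> f i j = 0" "\<forall>i j. M \<le> i \<or> M \<le> j \<longrightarrow> g i j = 0"
    by blast
  then show "\<exists>N. \<forall>i j. N \<le> i \<or> N \<le> j \<longrightarrow> (\<Sum>k | f i k \<noteq> 0. f i k * g k j) = 0"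
    by (intro exI[of _ "max N M"]) auto
qed

lemma entry_times_aux:
  assumes "in_size n A \<or> in_size n B"
  shows "entry (times_aux A B) i j = (\<Sum>k<n. entry A i k * entry B k j)"
proof -
  obtain m where m: "m \<ge> n" "in_size m A" "in_size m B" using in_size_ex2 by blast
  have "entry (times_aux A B) i j = (\<Sum>k | entry A i k \<noteq> 0. entry A i k * entry B k j)"
    by transfer simp
  also have "\<dots> = (\<Sum>k<m. entry A i k * entry B k j)"
    using m by (intro sum.mono_neutral_left) (auto simp: in_size_def not_le[symmetric])
  also have "\<dots> = (\<Sum>k<n. entry A i k * entry B k j)"
    using m assms by (intro sum.mono_neutral_right) (auto simp: in_size_def)
  finally show ?thesis .
qed

instantiation fmat :: ring
begin
definition "A * B = times_aux A (B :: fmat)"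
instance
proof
  fix A B C :: fmat
  obtain n where n: "in_size n A" "in_size n B" "in_size n C"
    using in_size_all[of "{A, B, C}" 0] by auto
  note e = entry_times_aux[of n, OF disjI1[OF n(1)]]
  show "A * B * C = A * (B * C)"
  proof (rule fmat_eqI)
    fix i j
    have "entry (A * B * C) i j = (\<Sum>k<n. (\<Sum>l<n. entry A i l * entry B l k) * entry C k j)"
      using n by (simp add: times_fmat_def entry_times_aux[of n])
    also have "\<dots> = (\<Sum>l<n. \<Sum>k<n. entry A i l * (entry B l k * entry C k j))"
      by (subst sum.swap) (simp add: sum_distrib_right mult.assoc)
    also have "\<dots> = entry (A * (B * C)) i j"
      using n by (simp add: times_fmat_def entry_times_aux[of n] sum_distrib_left)
    finally show "entry (A * B * C) i j = entry (A * (B * C)) i j" .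
  qed
  show "(A + B) * C = A * C + B * C" "A * (B + C) = A * B + A * C"
    using n by (auto intro!: fmat_eqI simp: times_fmat_def entry_times_aux[of n] algebra_simps sum.distrib)
qed
end

text \<open>One factor in the corner suffices, since every term with \<open>k \<ge> n\<close> then
  contains a zero entry. Products of large matrices with columns, shifts or \<open>funit\<close>
  rely on this.\<close>

lemma entry_times:
  assumes "in_size n A \<or> in_size n B"
  shows "entry (A * B) i j = (\<Sum>k<n. entry A i k * entry B k j)"
  using entry_times_aux[OF assms] by (simp add: times_fmat_def)

section \<open>Adjoints, scalar multiples and the unit of a corner\<close>

lift_definition adj :: "fmat \<Rightarrow> fmat" is "\<lambda>f i j. cnj (f j i)" by auto
lift_definition cscale :: "complex \<Rightarrow> fmat \<Rightarrow> fmat" is "\<lambda>c f i j. c * f i j" by auto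
lift_definition fmat_of :: "nat \<Rightarrow> (nat \<Rightarrow> nat \<Rightarrow> complex) \<Rightarrow> fmat" is
  "\<lambda>n f i j. if i < n \<and> j < n then f i j else 0"
  by (metis leD)
text \<open>The projection onto the first \<open>n\<close> coordinates. The algebra has no unit, and
  this element takes its place among the matrices satisfying \<open>in_size n\<close>.\<close>

definition funit :: "nat \<Rightarrow> fmat" where "funit n = fmat_of n (\<lambda>i j. if i = j then 1 else 0)"

lemma entry_adj [simp]: "entry (adj A) i j = cnj (entry A j i)" by transfer simp
lemma entry_cscale [simp]: "entry (cscale c A) i j = c * entry A i j" by transfer simp
lemma entry_fmat_of [simp]: "entry (fmat_of n f) i j = (if i < n \<and> j < n then f i j else 0)" by transfer simp
lemma entry_funit: "entry (funit n) i j = (if i < n \<and> j = i then 1 else 0)" by (auto simp: funit_def)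

lemma in_size_intros [simp]:
  "in_size n 0" "in_size n (fmat_of n f)"
  "in_size n A \<Longrightarrow> in_size n (adj A)" "in_size n A \<Longrightarrow> in_size n (cscale c A)" "in_size n A \<Longrightarrow> in_size n (- A)"
  "in_size n A \<Longrightarrow> in_size n B \<Longrightarrow> in_size n (A + B)" "in_size n A \<Longrightarrow> in_size n B \<Longrightarrow> in_size n (A - B)"
  "(\<And>s. s \<in> S \<Longrightarrow> in_size n (F s)) \<Longrightarrow> in_size n (sum F S)"
  by (auto simp: in_size_def)

lemma in_size_funit [simp]: "n \<le> m \<Longrightarrow> in_size m (funit n)"
  by (auto simp: in_size_def entry_funit)

lemma in_size_times [simp]: "in_size n A \<Longrightarrow> in_size n B \<Longrightarrow> in_size n (A * B)"
  by (auto simp: in_size_def[of n "A * B"] entry_times[of n] in_size_D)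

lemma sum_funit:
  "(\<Sum>k<n. entry (funit m) i k * f k) = (if i < m \<and> i < n then f i else 0)"
  "(\<Sum>k<n. f k * entry (funit m) k i) = (if i < m \<and> i < n then f i else (0::complex))"
proof -
  have "(\<Sum>k<n. entry (funit m) i k * f k) = (\<Sum>k<n. if i = k then (if i < m then f i else 0) else 0)"
    "(\<Sum>k<n. f k * entry (funit m) k i) = (\<Sum>k<n. if i = k then (if i < m then f i else 0) else 0)"
    by (rule sum.cong; auto simp: entry_funit)+
  then show "(\<Sum>k<n. entry (funit m) i k * f k) = (if i < m \<and> i < n then f i else 0)"
    "(\<Sum>k<n. f k * entry (funit m) k i) = (if i < m \<and> i < n then f i else 0)"
    by auto
qed

lemma funit_left [simp]: "in_size n A \<Longrightarrow> funit n * A = A"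
  by (rule fmat_eqI) (auto simp: entry_times[of n] sum_funit in_size_D not_less)

lemma funit_right [simp]: "in_size n A \<Longrightarrow> A * funit n = A"
  by (rule fmat_eqI) (auto simp: entry_times[of n] sum_funit in_size_D not_less)

lemma in_size_iff_funit: "in_size n A \<longleftrightarrow> funit n * A = A \<and> A * funit n = A"
proof
  assume *: "funit n * A = A \<and> A * funit n = A"
  have "entry A i j = 0" if "n \<le> i" for i j
  proof -
    have "entry (funit n * A) i j = 0" using that by (simp add: entry_times[of n] entry_funit)
    with * show ?thesis by simp
  qed
  moreover have "entry A i j = 0" if "n \<le> j" for i j
  proof -
    have "entry (A * funit n) i j = 0" using that by (simp add: entry_times[of n] entry_funit)
    with * show ?thesis by simp
  qed
  ultimately show "in_size n A" by (auto simp: in_size_def)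
qed simp

lemma adj_adj [simp]: "adj (adj A) = A" by (rule fmat_eqI) simp
lemma adj_plus [simp]: "adj (A + B) = adj A + adj B" by (rule fmat_eqI) simp
lemma adj_minus [simp]: "adj (A - B) = adj A - adj B" by (rule fmat_eqI) simp
lemma adj_zero [simp]: "adj 0 = 0" by (rule fmat_eqI) simp
lemma adj_sum [simp]: "adj (sum F S) = (\<Sum>s\<in>S. adj (F s))" by (rule fmat_eqI) simp
lemma adj_cscale [simp]: "adj (cscale c A) = cscale (cnj c) (adj A)" by (rule fmat_eqI) simp
lemma adj_funit [simp]: "adj (funit n) = funit n" by (rule fmat_eqI) (auto simp: entry_funit)
lemma adj_times [simp]: "adj (A * B) = adj B * adj A"
proof -
  obtain n where n: "in_size n A" "in_size n B" using in_size_ex2 by blast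
  show ?thesis
    by (rule fmat_eqI) (simp add: entry_times[of n] n mult.commute)
qed

lemma cscale_simps [simp]:
  "cscale c (A + B) = cscale c A + cscale c B" "cscale c (A - B) = cscale c A - cscale c B"
  "cscale c 0 = 0" "cscale 0 A = 0" "cscale 1 A = A" "cscale c (cscale d A) = cscale (c * d) A"
  "cscale c (- A) = - cscale c A"
  by (rule fmat_eqI; simp add: algebra_simps)+

lemma cscale_times [simp]: "cscale c A * B = cscale c (A * B)" "A * cscale c B = cscale c (A * B)"
proof -
  obtain n where n: "in_size n A" "in_size n B" using in_size_ex2 by blast
  show "cscale c A * B = cscale c (A * B)" "A * cscale c B = cscale c (A * B)"
    using n by (auto intro!: fmat_eqI simp: entry_times[of n] sum_distrib_left mult_ac)
qed

section \<open>The trace and the Hilbert-Schmidt norm\<close>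

definition tr :: "fmat \<Rightarrow> complex" where "tr A = (\<Sum>i | entry A i i \<noteq> 0. entry A i i)"

lemma tr_eq: assumes "in_size n A" shows "tr A = (\<Sum>i<n. entry A i i)"
  unfolding tr_def by (rule sum.mono_neutral_left) (use assms in \<open>auto simp: in_size_def not_le[symmetric]\<close>)

lemma tr_plus [simp]: "tr (A + B) = tr A + tr B"
proof -
  obtain n where n: "in_size n A" "in_size n B" using in_size_ex2 by blast
  then show ?thesis by (simp add: tr_eq[of n] sum.distrib)
qed
lemma tr_cscale [simp]: "tr (cscale c A) = c * tr A"
proof -
  obtain n where n: "in_size n A" using in_size_ex by blast
  then show ?thesis by (simp add: tr_eq[of n] sum_distrib_left)
qed
lemma tr_zero [simp]: "tr 0 = 0" by (simp add: tr_def)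
lemma tr_uminus [simp]: "tr (- A) = - tr A"
  using tr_plus[of A "- A"] by (simp add: eq_neg_iff_add_eq_0 add.commute del: tr_plus)
lemma tr_minus [simp]: "tr (A - B) = tr A - tr B"
  using tr_plus[of A "- B"] by (simp del: tr_plus)
lemma tr_sum [simp]: "tr (sum F S) = (\<Sum>s\<in>S. tr (F s))"
  by (induction S rule: infinite_finite_induct) auto
lemma tr_adj [simp]: "tr (adj A) = cnj (tr A)"
proof -
  obtain n where n: "in_size n A" using in_size_ex by blast
  then show ?thesis by (simp add: tr_eq[of n])
qed
lemma tr_times_eq: "in_size n A \<Longrightarrow> in_size n B \<Longrightarrow> tr (A * B) = (\<Sum>i<n. \<Sum>k<n. entry A i k * entry B k i)"
  by (simp add: tr_eq[of n] entry_times[of n])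
lemma tr_commute: "tr (A * B) = tr (B * A)"
proof -
  obtain n where n: "in_size n A" "in_size n B" using in_size_ex2 by blast
  show ?thesis unfolding tr_times_eq[OF n] tr_times_eq[OF n(2,1)]
    by (subst sum.swap) (simp add: mult.commute)
qed

lemma tr_gram_eq: "in_size n A \<Longrightarrow> tr (A * adj A) = of_real (\<Sum>i<n. \<Sum>k<n. (cmod (entry A i k))\<^sup>2)"
  by (simp add: tr_times_eq complex_mult_cnj cmod_power2)

text \<open>The class is one of real inner product spaces, hence the real part of the trace form; it
  induces the same norm as the complex form.\<close>

instantiation fmat :: real_inner
begin
definition "scaleR r A = cscale (of_real r) A"
definition "inner A B = Re (tr (A * adj B))"
definition "norm A = sqrt (inner A (A :: fmat))"
definition "dist A B = norm (A - B :: fmat)"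
definition "sgn A = scaleR (inverse (norm A)) (A :: fmat)"
definition uniformity_fmat :: "(fmat \<times> fmat) filter" where
  "uniformity_fmat = (INF e\<in>{0<..}. principal {(x, y). dist x y < e})"
definition open_fmat :: "fmat set \<Rightarrow> bool" where
  "open_fmat U = (\<forall>x\<in>U. eventually (\<lambda>(x', y). x' = x \<longrightarrow> y \<in> U) uniformity)"
instance
proof
  fix A B C :: fmat and a b r :: real
  show "dist A B = norm (A - B)" by (rule dist_fmat_def)
  show "a *\<^sub>R (A + B) = a *\<^sub>R A + a *\<^sub>R B" "(a + b) *\<^sub>R A = a *\<^sub>R A + b *\<^sub>R A"
    "a *\<^sub>R b *\<^sub>R A = (a * b) *\<^sub>R A" "1 *\<^sub>R A = A"
    by (auto intro!: fmat_eqI simp: scaleR_fmat_def algebra_simps)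
  show "sgn A = inverse (norm A) *\<^sub>R A" by (rule sgn_fmat_def)
  show "uniformity = (INF e\<in>{0<..}. principal {(x, y :: fmat). dist x y < e})" by (rule uniformity_fmat_def)
  show "open U = (\<forall>x\<in>U. \<forall>\<^sub>F (x', y) in uniformity. x' = x \<longrightarrow> y \<in> U)" for U :: "fmat set"
    by (rule open_fmat_def)
  have "tr (B * adj A) = cnj (tr (A * adj B))" by (simp flip: tr_adj)
  then show "inner A B = inner B A" by (simp add: inner_fmat_def)
  show "inner (A + B) C = inner A C + inner B C" by (simp add: inner_fmat_def distrib_right)
  show "inner (r *\<^sub>R A) B = r * inner A B" by (simp add: inner_fmat_def scaleR_fmat_def)
  obtain n where n: "in_size n A" using in_size_ex by blast
  have i: "inner A A = (\<Sum>i<n. \<Sum>k<n. (cmod (entry A i k))\<^sup>2)"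
    by (simp add: inner_fmat_def tr_gram_eq[OF n])
  show "0 \<le> inner A A" unfolding i by (intro sum_nonneg) auto
  show "(inner A A = 0) = (A = 0)"
  proof
    assume "inner A A = 0"
    then have "\<forall>i<n. \<forall>k<n. entry A i k = 0"
      unfolding i by (subst (asm) sum_nonneg_eq_0_iff) (auto intro: sum_nonneg simp: sum_nonneg_eq_0_iff)
    then show "A = 0" using n by (intro fmat_eqI) (metis entry_zero in_size_D not_le)
  qed (simp add: inner_fmat_def)
  show "norm A = sqrt (inner A A)" by (rule norm_fmat_def)
qed
end

lemma norm_sq_eq: "in_size n A \<Longrightarrow> (norm A)\<^sup>2 = (\<Sum>i<n. \<Sum>k<n. (cmod (entry A i k))\<^sup>2)"
  by (simp add: power2_norm_eq_inner inner_fmat_def tr_gram_eq)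

lemma tr_gram: "tr (A * adj A) = of_real ((norm A)\<^sup>2)"
proof -
  obtain n where n: "in_size n A" using in_size_ex by blast
  show ?thesis by (simp only: tr_gram_eq[OF n] norm_sq_eq[OF n])
qed

lemma norm_cscale [simp]: "norm (cscale c A) = cmod c * norm A"
proof -
  obtain n where n: "in_size n A" using in_size_ex by blast
  have "(norm (cscale c A))\<^sup>2 = (cmod c * norm A)\<^sup>2"
    using n by (simp add: norm_sq_eq[of n] norm_mult power_mult_distrib sum_distrib_left)
  then show ?thesis by (simp add: power2_eq_iff_nonneg)
qed

lemma norm_adj [simp]: "norm (adj A) = norm A"
proof -
  obtain n where n: "in_size n A" using in_size_ex by blast
  have "(norm (adj A))\<^sup>2 = (norm A)\<^sup>2"
    using n by (simp add: norm_sq_eq[of n]) (rule sum.swap)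
  then show ?thesis by (simp add: power2_eq_iff_nonneg)
qed

text \<open>The real inner product only sees the real part; rotating the phase recovers the modulus.\<close>

lemma tr_cauchy_schwarz: "cmod (tr (A * B)) \<le> norm A * norm B"
proof -
  obtain u where u: "cmod u = 1" "u * tr (A * B) = of_real (cmod (tr (A * B)))"
  proof (cases "tr (A * B) = 0")
    case False
    show ?thesis
      using False complex_norm_square[of "tr (A * B)"]
      by (intro that[of "cnj (tr (A * B)) / of_real (cmod (tr (A * B)))"])
        (simp_all add: norm_divide field_simps power2_eq_square)
  qed (auto intro: that[of 1])
  have "cmod (tr (A * B)) = Re (tr (cscale u A * adj (adj B)))"
    using u by simp
  also have "\<dots> = inner (cscale u A) (adj B)" by (simp only: inner_fmat_def)
  also have "\<dots> \<le> norm (cscale u A) * norm (adj B)" by (rule norm_cauchy_schwarz)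
  finally show ?thesis using u by simp
qed

text \<open>The Hilbert-Schmidt norm is submultiplicative: Cauchy-Schwarz bounds each entry of a
  product by a row norm times a column norm, and the sum over all entries factors.\<close>

instance fmat :: real_normed_algebra
proof
  fix A B :: fmat and a :: real
  show "a *\<^sub>R A * B = a *\<^sub>R (A * B)" "A * a *\<^sub>R B = a *\<^sub>R (A * B)"
    by (simp_all add: scaleR_fmat_def)
  obtain n where n: "in_size n A" "in_size n B" using in_size_ex2 by blast
  have "(norm (A * B))\<^sup>2 = (\<Sum>i<n. \<Sum>j<n. (cmod (\<Sum>k<n. entry A i k * entry B k j))\<^sup>2)"
    using n by (simp add: norm_sq_eq[of n] entry_times[of n])
  also have "\<dots> \<le> (\<Sum>i<n. \<Sum>j<n. (\<Sum>k<n. (cmod (entry A i k))\<^sup>2) * (\<Sum>k<n. (cmod (entry B k j))\<^sup>2))"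
  proof (intro sum_mono)
    fix i j
    have "(cmod (\<Sum>k<n. entry A i k * entry B k j))\<^sup>2 \<le> (\<Sum>k<n. cmod (entry A i k) * cmod (entry B k j))\<^sup>2"
      by (intro power_mono) (auto intro: sum_norm_le simp: norm_mult)
    also have "\<dots> \<le> (\<Sum>k<n. (cmod (entry A i k))\<^sup>2) * (\<Sum>k<n. (cmod (entry B k j))\<^sup>2)"
      by (rule Cauchy_Schwarz_ineq_sum)
    finally show "(cmod (\<Sum>k<n. entry A i k * entry B k j))\<^sup>2 \<le> \<dots>" .
  qed
  also have "\<dots> = (\<Sum>i<n. \<Sum>k<n. (cmod (entry A i k))\<^sup>2) * (\<Sum>j<n. \<Sum>k<n. (cmod (entry B k j))\<^sup>2)"
    by (simp add: sum_product)
  also have "\<dots> = (norm A * norm B)\<^sup>2"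
    using n sum.swap[of "\<lambda>j k. (cmod (entry B k j))\<^sup>2" "{..<n}" "{..<n}"]
    by (simp add: norm_sq_eq[of n] power_mult_distrib)
  finally show "norm (A * B) \<le> norm A * norm B"
    by (rule power2_le_imp_le) simp
qed

lemma norm_compress: "norm (funit n * A * funit n) \<le> norm A"
proof -
  obtain m where m: "m \<ge> n" "in_size m A" using in_size_ex2[of n A A] by blast
  have e: "entry (funit n * A) i j = (if i < n then entry A i j else 0)" for i j
    by (auto simp: entry_times[of n] sum_funit)
  have e2: "entry (funit n * A * funit n) i j = (if i < n \<and> j < n then entry A i j else 0)" for i j
    by (subst entry_times[of n]) (auto simp: e sum_funit)
  have "in_size m (funit n * A * funit n)" using m by simp
  then have "(norm (funit n * A * funit n))\<^sup>2 \<le> (norm A)\<^sup>2"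
    unfolding norm_sq_eq[OF m(2)] by (subst norm_sq_eq[of m]) (auto intro!: sum_mono simp: e2)
  then show ?thesis by (rule power2_le_imp_le) simp
qed

subsection \<open>Positive semidefinite matrices\<close>

text \<open>Positivity is tested against Gram matrices: the trace against \<open>V * adj V\<close>
  adds up the quadratic form over the columns of \<open>V\<close>, so this is equivalent to the test
  on vectors.\<close>

definition psd :: "fmat \<Rightarrow> bool" where
  "psd A \<longleftrightarrow> adj A = A \<and> (\<forall>V. 0 \<le> Re (tr (A * (V * adj V))))"

lemma psd_tr: "psd A \<Longrightarrow> 0 \<le> Re (tr (A * (V * adj V)))" by (simp add: psd_def)
lemma psd_zero [simp]: "psd 0" by (simp add: psd_def)
lemma psd_plus: "psd A \<Longrightarrow> psd B \<Longrightarrow> psd (A + B)" by (simp add: psd_def distrib_right)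
lemma psd_sum: "(\<And>s. s \<in> S \<Longrightarrow> psd (F s)) \<Longrightarrow> psd (sum F S)"
  by (induction S rule: infinite_finite_induct) (auto intro: psd_plus)
lemma psd_scale: "0 \<le> r \<Longrightarrow> psd A \<Longrightarrow> psd (r *\<^sub>R A)"
  by (simp add: psd_def scaleR_fmat_def)

lemma psd_conj: assumes "psd A" shows "psd (C * A * adj C)"
proof -
  have "tr (C * A * adj C * (V * adj V)) = tr (A * (adj C * V * adj (adj C * V)))" for V
    using tr_commute[of C "A * adj C * (V * adj V)"] by (simp add: mult.assoc)
  then have "0 \<le> Re (tr (C * A * adj C * (V * adj V)))" for V
    by (metis psd_tr[OF assms])
  then show ?thesis using assms unfolding psd_def by (simp add: mult.assoc)
qed

lemma psd_gram: "psd (A * adj A)"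
proof -
  have "tr (A * adj A * (V * adj V)) = tr (adj V * A * adj (adj V * A))" for V
    using tr_commute[of "A * adj A * V" "adj V"] by (simp add: mult.assoc)
  then have "0 \<le> Re (tr (A * adj A * (V * adj V)))" for V
    by (simp only: tr_gram) simp
  then show ?thesis by (simp add: psd_def)
qed

text \<open>The Hilbert-Schmidt norm dominates the operator norm. Cutting \<open>V\<close> to the
  corner before applying Cauchy-Schwarz is what produces \<open>funit n\<close> as the upper
  bound.\<close>

lemma psd_norm_bound:
  assumes "in_size n A" "adj A = A"
  shows "psd (norm A *\<^sub>R funit n - A)"
proof -
  have "0 \<le> Re (tr ((norm A *\<^sub>R funit n - A) * (V * adj V)))" for V
  proof -
    have "Re (tr (A * (V * adj V))) = Re (tr (A * (funit n * V * adj (funit n * V))))"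
    proof -
      have "tr (A * (funit n * V * adj (funit n * V))) = tr (funit n * A * funit n * (V * adj V))"
        using tr_commute[of "funit n" "A * funit n * V * adj V"] by (simp add: mult.assoc)
      then show ?thesis using assms by simp
    qed
    also have "\<dots> \<le> norm A * norm (funit n * V * adj (funit n * V))"
      using tr_cauchy_schwarz complex_Re_le_cmod order_trans by blast
    also have "\<dots> \<le> norm A * (norm (funit n * V))\<^sup>2"
      using norm_mult_ineq[of "funit n * V" "adj (funit n * V)"]
      by (intro mult_left_mono) (auto simp: power2_eq_square simp del: adj_times adj_funit)
    also have "(norm (funit n * V))\<^sup>2 = Re (tr (funit n * (V * adj V)))"
    proof -
      have "tr (funit n * V * adj (funit n * V)) = tr (funit n * funit n * (V * adj V))"
        using tr_commute[of "funit n * V * adj V" "funit n"] by (simp add: mult.assoc[symmetric])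
      also have "funit n * funit n = funit n" by simp
      finally show ?thesis unfolding tr_gram by (metis Re_complex_of_real)
    qed
    finally show ?thesis
      by (simp add: left_diff_distrib scaleR_fmat_def)
  qed
  then show ?thesis using assms by (simp add: psd_def scaleR_fmat_def)
qed

subsection \<open>Spectral theorem and fourth roots\<close>

text \<open>A vector is stored as column 0 of a matrix, so that inner products appear as multiples
  of \<open>funit 1\<close> and rank one operators as
  \<open>fcol n f * adj (fcol n f)\<close>.\<close>

definition fcol :: "nat \<Rightarrow> (nat \<Rightarrow> complex) \<Rightarrow> fmat" where
  "fcol n f = fmat_of n (\<lambda>i j. if j = 0 then f i else 0)"

definition fdiag :: "nat \<Rightarrow> (nat \<Rightarrow> complex) \<Rightarrow> fmat" where
  "fdiag n d = fmat_of n (\<lambda>i j. if i = j then d i else 0)"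

lemma in_size_fcol [simp]: "in_size n (fcol n f)" by (simp add: fcol_def)
lemma in_size_fdiag [simp]: "in_size n (fdiag n d)" by (simp add: fdiag_def)
lemma entry_fcol: "entry (fcol n f) i j = (if i < n \<and> j = 0 then f i else 0)"
  by (auto simp: fcol_def)
lemma entry_fdiag: "entry (fdiag n f) i j = (if i < n \<and> j = i then f i else 0)"
  by (auto simp: fdiag_def)

lemma fdiag_times: "fdiag n d * fdiag n e = fdiag n (\<lambda>i. d i * e i)"
proof (rule fmat_eqI)
  fix i j
  have "entry (fdiag n d * fdiag n e) i j = (\<Sum>k<n. if k = i then (if j = i then d i * e i else 0) else 0)"
    unfolding entry_times[OF disjI1[OF in_size_fdiag]] by (rule sum.cong) (auto simp: entry_fdiag)
  then show "entry (fdiag n d * fdiag n e) i j = entry (fdiag n (\<lambda>i. d i * e i)) i j"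
    by (auto simp: entry_fdiag)
qed

lemma fdiag_one: "fdiag n (\<lambda>_. 1) = funit n"
  by (rule fmat_eqI) (simp add: entry_fdiag entry_funit)

lemma adj_fdiag: "adj (fdiag n d) = fdiag n (\<lambda>i. cnj (d i))"
  by (rule fmat_eqI) (auto simp: entry_fdiag)

lemma fcol_gram: "adj (fcol n f) * fcol n g = cscale (\<Sum>k<n. cnj (f k) * g k) (funit 1)"
  by (rule fmat_eqI)
    (auto simp: entry_times[OF disjI2[OF in_size_fcol]] entry_fcol entry_funit intro!: sum.neutral)

lemma fcol_funit: "fcol n f * funit 1 = fcol n f"
proof (rule fmat_eqI)
  fix i j
  have "entry (fcol n f * funit 1) i j = (\<Sum>k<1. entry (fcol n f) i k * entry (funit 1) k j)"
    by (rule entry_times) simp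
  then show "entry (fcol n f * funit 1) i j = entry (fcol n f) i j"
    by (simp add: entry_fcol entry_funit)
qed

lemma funit_times_funit: "funit m * funit n = funit (min m n)"
  by (cases "m \<le> n") (auto simp: min_def)

lemma mult_cnj_cmod: "z * cnj z = (of_real (cmod z))\<^sup>2" "cnj z * z = (of_real (cmod z))\<^sup>2"
  by (metis complex_norm_square of_real_power mult.commute)+

text \<open>A point of the nonempty spectrum of the corner supplies the vector. Its phase is rotated
  until the last coordinate is real, which the reflection in \<open>householder\<close> requires;
  the second disjunct lets the statement cover matrices outside the corner as well.\<close>

lemma eigenvector_exists:
  assumes "0 < n"
  obtains f l where "(\<Sum>k<n. cnj (f k) * f k) = 1" "f (n - 1) \<in> \<real>" "A * fcol n f = cscale l (fcol n f) \<or> \<not> in_size n A"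
proof (cases "in_size n A")
  case True
  define B where "B = mat n n (\<lambda>(i, j). entry A i j)"
  have B: "B \<in> carrier_mat n n" by (simp add: B_def)
  obtain l v where v: "v \<in> carrier_vec n" "v \<noteq> 0\<^sub>v n" "B *\<^sub>v v = l \<cdot>\<^sub>v v"
    using spectrum_non_empty[OF B assms] B by (auto simp: spectrum_def eigenvalue_def eigenvector_def)
  have coord: "(\<Sum>k<n. entry A i k * vec_index v k) = l * vec_index v i" if "i < n" for i
  proof -
    have "vec_index (B *\<^sub>v v) i = (\<Sum>k<n. entry A i k * vec_index v k)"
      using that v(1) by (simp add: B_def scalar_prod_def atLeast0LessThan)
    then show ?thesis using that v by simp
  qed
  define N where "N = sqrt (\<Sum>k<n. (cmod (vec_index v k))\<^sup>2)"
  obtain k where "k < n" "vec_index v k \<noteq> 0" using v by (metis index_zero_vec carrier_vecD eq_vecI)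
  then have "0 < (\<Sum>k<n. (cmod (vec_index v k))\<^sup>2)" by (intro sum_pos2[of _ k]) auto
  then have N: "N > 0" "N\<^sup>2 = (\<Sum>k<n. (cmod (vec_index v k))\<^sup>2)" by (auto simp: N_def)
  obtain u where u: "cmod u = 1" "u * vec_index v (n - 1) \<in> \<real>"
  proof (cases "vec_index v (n - 1) = 0")
    case False
    then show ?thesis
      by (intro that[of "cnj (vec_index v (n - 1)) / of_real (cmod (vec_index v (n - 1)))"])
        (simp_all add: norm_divide mult_cnj_cmod flip: of_real_power of_real_divide)
  qed (auto intro: that[of 1])
  define f where "f k = u * vec_index v k / of_real N" for k
  have "cnj (f k) * f k = of_real ((cmod (vec_index v k))\<^sup>2 / N\<^sup>2)" for k
  proof -
    have "cnj (f k) * f k = of_real ((cmod (f k))\<^sup>2)"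
      by (simp add: mult_cnj_cmod)
    also have "(cmod (f k))\<^sup>2 = (cmod (vec_index v k))\<^sup>2 / N\<^sup>2"
      using N u by (simp add: f_def norm_mult norm_divide power_divide)
    finally show ?thesis .
  qed
  then have "(\<Sum>k<n. cnj (f k) * f k) = of_real ((\<Sum>k<n. (cmod (vec_index v k))\<^sup>2) / N\<^sup>2)"
    by (simp add: sum_divide_distrib)
  also have "\<dots> = 1" using N by (simp flip: N(2))
  finally have 1: "(\<Sum>k<n. cnj (f k) * f k) = 1" .
  have 2: "f (n - 1) \<in> \<real>" using u unfolding f_def by (metis Reals_divide Reals_of_real)
  have 3: "A * fcol n f = cscale l (fcol n f)"
  proof (rule fmat_eqI)
    fix i j
    show "entry (A * fcol n f) i j = entry (cscale l (fcol n f)) i j"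
    proof (cases "i < n \<and> j = 0")
      case i: True
      have "entry (A * fcol n f) i j = (\<Sum>k<n. entry A i k * f k)"
        using i by (simp add: entry_times[OF disjI2[OF in_size_fcol]] entry_fcol)
      also have "\<dots> = u / of_real N * (\<Sum>k<n. entry A i k * vec_index v k)"
        by (simp add: sum_distrib_left f_def mult_ac)
      also have "\<dots> = entry (cscale l (fcol n f)) i j"
        using i by (simp add: coord entry_fcol f_def)
      finally show ?thesis .
    next
      case False
      have "in_size n (A * fcol n f)" using True by simp
      then show ?thesis using False True
        by (auto simp: entry_fcol in_size_D not_less entry_times[OF disjI2[OF in_size_fcol]])
    qed
  qed
  show ?thesis using that[OF 1 2 disjI1[OF 3]] .
next
  case False
  have "(\<Sum>k<n. cnj (if k = n - 1 then 1 else 0) * (if k = n - 1 then 1 else 0)) = (1::complex)"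
    using assms by (simp add: if_distrib[of cnj] if_distrib[of "\<lambda>x. x * _"] cong: if_cong)
  then show ?thesis using that[of "\<lambda>k. if k = n - 1 then 1 else 0"] False by auto
qed

text \<open>The reflection along \<open>W = V - D\<close> exchanges two unit vectors whose inner
  product is real. Being self-adjoint it is its own inverse, so a single matrix performs the
  conjugation in the spectral theorem.\<close>

lemma householder:
  assumes f: "(\<Sum>k<Suc n. cnj (f k) * f k) = 1" "f n \<in> \<real>"
  obtains U where "in_size (Suc n) U" "adj U = U" "U * U = funit (Suc n)"
    "U * fcol (Suc n) f = fcol (Suc n) (\<lambda>i. if i = n then 1 else 0)"
proof -
  define V where "V = fcol (Suc n) f"
  define D where "D = fcol (Suc n) (\<lambda>i. if i = n then 1 else 0)"
  have in_size: "in_size (Suc n) V" "in_size (Suc n) D" by (auto simp: V_def D_def)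
  obtain t where t: "f n = of_real t" using f by (auto simp: Reals_def)
  have VV: "adj V * V = funit 1" unfolding V_def fcol_gram f by simp
  have DD: "adj D * D = funit 1" unfolding D_def fcol_gram
    by (simp add: if_distrib[of cnj] if_distrib[of "\<lambda>x. x * _"] cong: if_cong)
  have DV: "adj D * V = cscale (of_real t) (funit 1)" unfolding D_def V_def fcol_gram
    by (simp add: t if_distrib[of cnj] if_distrib[of "\<lambda>x. x * _"] cong: if_cong)
  have VD: "adj V * D = cscale (of_real t) (funit 1)" using arg_cong[OF DV, of adj] by simp
  define W where "W = V - D"
  have W1: "W * funit 1 = W" unfolding W_def V_def D_def by (simp add: left_diff_distrib fcol_funit del: One_nat_def)
  have WV: "adj W * V = cscale (of_real (1 - t)) (funit 1)"
    by (rule fmat_eqI) (simp add: W_def left_diff_distrib VV DV algebra_simps)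
  have WW: "adj W * W = cscale (of_real (2 - 2 * t)) (funit 1)"
    by (rule fmat_eqI) (simp add: W_def left_diff_distrib right_diff_distrib VV DV VD DD algebra_simps)
  \<comment> \<open>The squared length of \<open>W\<close> is \<open>2 - 2 * t\<close>, so the usual
    factor of a reflection, 2 over the squared length, becomes \<open>1 / (1 - t)\<close>. For
    \<open>t = 1\<close> the two vectors coincide and \<open>U\<close> is the unit of the
    corner.\<close>
  define c where "c = (if t = 1 then 0 else 1 / (1 - t))"
  define U where "U = funit (Suc n) - cscale (of_real c) (W * adj W)"
  have inW: "in_size (Suc n) W" using in_size by (simp add: W_def)
  have 1: "in_size (Suc n) U" "adj U = U" using inW by (auto simp: U_def)
  have a: "W * adj W * W = cscale (of_real (2 - 2 * t)) W"
    using W1 by (simp add: mult.assoc WW)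
  have "W * adj W * (W * adj W) = cscale (of_real (2 - 2 * t)) (W * adj W)"
    using arg_cong[OF a, of "\<lambda>x. x * adj W"] by (simp add: mult.assoc)
  then have "U * U = funit (Suc n) + cscale (of_real (c * c * (2 - 2 * t) - 2 * c)) (W * adj W)"
    using inW by (intro fmat_eqI) (simp add: U_def left_diff_distrib right_diff_distrib algebra_simps)
  also have "c * c * (2 - 2 * t) - 2 * c = 0"
    by (simp add: c_def divide_simps)
  finally have 2: "U * U = funit (Suc n)" by simp
  have "W * adj W * V = cscale (of_real (1 - t)) W" using W1 by (simp add: mult.assoc WV)
  then have "U * V = V - cscale (of_real (c * (1 - t))) W"
    using in_size by (simp add: U_def left_diff_distrib)
  also have "\<dots> = D"
  proof (cases "t = 1")
    case True
    then have "adj W * adj (adj W) = 0" using WW by simp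
    then have "W = 0" using tr_gram[of "adj W"] by simp
    then show ?thesis by (simp add: W_def)
  qed (simp add: c_def W_def)
  finally show ?thesis using that 1 2 by (simp add: V_def D_def)
qed

text \<open>Induction on the size: a reflection moves a unit eigenvector to the last basis vector,
  whose projection \<open>P\<close> splits the conjugated matrix into a multiple of \<open>P\<close>
  and a self-adjoint matrix in the smaller corner.\<close>

theorem spectral_theorem:
  assumes "in_size n A" "adj A = A"
  shows "\<exists>U d. in_size n U \<and> U * adj U = funit n \<and> adj U * U = funit n \<and>
           A = U * fdiag n (\<lambda>i. of_real (d i)) * adj U"
  using assms
proof (induction n arbitrary: A)
  case 0
  then have "A = 0" by (intro fmat_eqI) (simp add: in_size_D)
  moreover have "funit 0 = 0" by (rule fmat_eqI) (simp add: entry_funit)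
  ultimately show ?case by (intro exI[of _ 0]) auto
next
  case (Suc n)
  obtain f l where f: "(\<Sum>k<Suc n. cnj (f k) * f k) = 1" "f n \<in> \<real>"
    and l: "A * fcol (Suc n) f = cscale l (fcol (Suc n) f)"
    using eigenvector_exists[of "Suc n" A] Suc.prems by auto
  obtain H where H: "in_size (Suc n) H" "adj H = H" "H * H = funit (Suc n)"
    and Hf: "H * fcol (Suc n) f = fcol (Suc n) (\<lambda>i. if i = n then 1 else 0)"
    using householder[OF f] by blast
  define D where "D = fcol (Suc n) (\<lambda>i. if i = n then 1 else 0)"
  define P where "P = funit (Suc n) - funit n"
  define B where "B = H * A * H"
  have D: "D * adj D = P"
    by (rule fmat_eqI) (auto simp: D_def P_def entry_times[OF disjI1[OF in_size_fcol]] entry_fcol entry_funit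
      sum.lessThan_Suc_shift simp del: sum.lessThan_Suc dest: less_antisym intro: sum.neutral)
  have inB: "in_size (Suc n) B" "adj B = B" using H Suc.prems by (auto simp: B_def mult.assoc)
  have HD: "H * D = fcol (Suc n) f"
    using arg_cong[OF Hf, of "\<lambda>x. H * x"] H by (simp add: D_def flip: mult.assoc)
  have "B * D = H * (A * (H * D))" by (simp add: B_def mult.assoc)
  also have "\<dots> = cscale l D" unfolding HD l by (simp add: Hf D_def)
  finally have BP: "B * P = cscale l P" unfolding D[symmetric] by (simp flip: mult.assoc)
  have PB: "P * B = cscale (cnj l) P" using arg_cong[OF BP, of adj] inB by (simp add: P_def)
  have PP: "P * P = P" "P * funit n = 0" "funit n * P = 0"
    by (auto simp: P_def left_diff_distrib right_diff_distrib)
  \<comment> \<open>Evaluating \<open>P * B * P\<close> from the left and from the right produces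
    the eigenvalue and its conjugate, so the eigenvalue is real.\<close>
  have "cscale (cnj l) P = P * B * P" by (simp add: PB PP)
  also have "\<dots> = cscale l P" by (simp add: BP PP mult.assoc)
  finally have "cscale (cnj l) P = cscale l P" .
  then have "entry (cscale (cnj l) P) n n = entry (cscale l P) n n" by simp
  then have "cnj l = l" by (simp add: P_def entry_funit)
  then obtain r where r: "l = of_real r" by (metis Reals_cases Reals_cnj_iff)
  define C where "C = funit n * B * funit n"
  have eP: "funit (Suc n) = funit n + P" by (simp add: P_def)
  have B_eq: "B = C + cscale l P"
  proof -
    have "B = (funit n + P) * B * (funit n + P)" using inB by (simp flip: eP)
    also have "\<dots> = C + cscale l P"
      by (simp add: distrib_left distrib_right C_def PB PP mult.assoc BP r)
    finally show ?thesis .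
  qed
  have "in_size n C"
    unfolding in_size_iff_funit C_def by (simp add: mult.assoc) (simp flip: mult.assoc)
  moreover have "adj C = C" using inB by (simp add: C_def mult.assoc)
  ultimately obtain U d where U: "in_size n U" "U * adj U = funit n" "adj U * U = funit n"
    and C: "C = U * fdiag n (\<lambda>i. of_real (d i)) * adj U" using Suc.IH by blast
  define d' where "d' i = (if i = n then r else d i)" for i
  define G where "G = fdiag n (\<lambda>i. complex_of_real (d i))"
  have dg: "fdiag (Suc n) (\<lambda>i. of_real (d' i)) = G + cscale l P"
    by (rule fmat_eqI) (auto simp: entry_fdiag P_def entry_funit d'_def r G_def)
  have UP: "U * P = 0"
  proof -
    have "U * P = U * funit n * P" using U by simp
    also have "\<dots> = 0" by (simp add: mult.assoc PP)
    finally show ?thesis .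
  qed
  have PU: "P * U = 0"
  proof -
    have "P * U = P * (funit n * U)" using U by simp
    also have "\<dots> = 0" by (simp add: PP flip: mult.assoc)
    finally show ?thesis .
  qed
  have adjP: "adj P = P" by (simp add: P_def)
  have UP': "P * adj U = 0" "adj U * P = 0"
    using arg_cong[OF UP, of adj] arg_cong[OF PU, of adj] by (auto simp: adjP)
  have "P * G = P * (funit n * G)" "G * P = G * funit n * P" by (simp_all add: G_def)
  then have GP: "P * G = 0" "G * P = 0" by (simp_all add: PP mult.assoc, simp add: PP flip: mult.assoc)
  \<comment> \<open>The unitary of the smaller corner is completed by the identity on the last
    coordinate.\<close>
  define U2 where "U2 = U + P"
  have U2: "U2 * adj U2 = funit (Suc n)" "adj U2 * U2 = funit (Suc n)"
    by (simp_all add: U2_def distrib_left distrib_right U UP PU UP' PP adjP eP)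
  have "U2 * (G + cscale l P) * adj U2 = C + cscale l P"
    by (simp add: U2_def distrib_left distrib_right UP PU UP' PP adjP GP C mult.assoc)
      (simp add: UP UP' PP GP G_def flip: mult.assoc)
  then have B2: "B = U2 * fdiag (Suc n) (\<lambda>i. of_real (d' i)) * adj U2" using B_eq dg by simp
  have inU2: "in_size (Suc n) U2" using in_size_mono[OF U(1), of "Suc n"] by (simp add: U2_def P_def)
  have "A = H * H * A * (H * H)" using Suc.prems by (simp add: H)
  also have "\<dots> = H * B * H" by (simp add: B_def mult.assoc)
  also have "\<dots> = (H * U2) * fdiag (Suc n) (\<lambda>i. of_real (d' i)) * adj (H * U2)"
    by (simp add: B2 H mult.assoc)
  finally have A: "A = (H * U2) * fdiag (Suc n) (\<lambda>i. of_real (d' i)) * adj (H * U2)" .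
  have "(H * U2) * adj (H * U2) = H * (U2 * adj U2) * H"
    "adj (H * U2) * (H * U2) = adj U2 * (H * H) * U2" by (simp_all add: H(2) mult.assoc)
  then have "(H * U2) * adj (H * U2) = funit (Suc n)" "adj (H * U2) * (H * U2) = funit (Suc n)"
    using U2 H inU2 by (simp_all del: adj_times)
  then show ?case using A H inU2
    by (intro exI[of _ "H * U2"] exI[of _ d']) auto
qed

text \<open>Fourth roots are needed because the polar splitting of \<open>Z\<close> uses the square
  root of the modulus of \<open>adj Z\<close>, which is the fourth root of \<open>Z * adj Z\<close>.
  The lower bound \<open>e\<close> keeps the eigenvalues away from 0, so that the root is invertible
  within the corner.\<close>

theorem fourth_root:
  assumes "in_size n A" "adj A = A" "0 < e" "psd (A - e *\<^sub>R funit n)"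
  shows "\<exists>R S. in_size n R \<and> in_size n S \<and> adj R = R \<and> adj S = S \<and>
    R * R * (R * R) = A \<and> R * S = funit n \<and> S * R = funit n"
proof -
  obtain U d where U: "in_size n U" "U * adj U = funit n" "adj U * U = funit n"
    and A: "A = U * fdiag n (\<lambda>i. of_real (d i)) * adj U"
    using spectral_theorem[OF assms(1,2)] by blast
  \<comment> \<open>After conjugation by \<open>adj U\<close>, testing positivity against the
    \<open>i\<close>-th basis projection reads off the \<open>i\<close>-th eigenvalue.\<close>
  have d: "d i \<ge> e" if i: "i < n" for i
  proof -
    define V where "V = fcol n (\<lambda>k. if k = i then 1 else 0)"
    have "adj U * (A - e *\<^sub>R funit n) * adj (adj U) = fdiag n (\<lambda>i. of_real (d i)) - e *\<^sub>R funit n"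
    proof -
      have "adj U * A * U = (adj U * U) * fdiag n (\<lambda>i. of_real (d i)) * (adj U * U)"
        by (simp add: A mult.assoc)
      then have "adj U * A * U = fdiag n (\<lambda>i. of_real (d i))" by (simp add: U)
      then show ?thesis using U by (simp add: left_diff_distrib right_diff_distrib)
    qed
    then have "psd (fdiag n (\<lambda>i. of_real (d i)) - e *\<^sub>R funit n)"
      using psd_conj[OF assms(4), of "adj U"] by simp
    then have "0 \<le> Re (tr ((fdiag n (\<lambda>i. of_real (d i)) - e *\<^sub>R funit n) * (V * adj V)))"
      by (rule psd_tr)
    also have "V * adj V = fdiag n (\<lambda>k. if k = i then 1 else 0)"
      by (rule fmat_eqI) (use i in \<open>auto simp: V_def entry_times[OF disjI1[OF in_size_fcol]] entry_fcol entry_fdiag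
        if_distrib[of "\<lambda>x. x * _"] if_distrib[of "\<lambda>x. _ * x"] cong: if_cong\<close>)
    also have "fdiag n (\<lambda>i. of_real (d i)) - e *\<^sub>R funit n = fdiag n (\<lambda>i. of_real (d i - e))"
      by (rule fmat_eqI) (simp add: entry_fdiag entry_funit scaleR_fmat_def)
    also have "Re (tr (fdiag n (\<lambda>i. of_real (d i - e)) * fdiag n (\<lambda>k. if k = i then 1 else 0))) = d i - e"
      using i by (simp add: fdiag_times tr_eq[OF in_size_fdiag] entry_fdiag if_distrib[of "\<lambda>x. _ * x"] cong: if_cong)
    finally show ?thesis by simp
  qed
  define r where "r i = root 4 (d i)" for i
  define R where "R = U * fdiag n (\<lambda>i. of_real (r i)) * adj U"
  define S where "S = U * fdiag n (\<lambda>i. of_real (1 / r i)) * adj U"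
  have comp: "(U * X * adj U) * (U * Y * adj U) = U * (X * Y) * adj U"
    if "in_size n X" for X Y
  proof -
    have "(U * X * adj U) * (U * Y * adj U) = U * (X * (adj U * U)) * Y * adj U"
      by (simp add: mult.assoc)
    then show ?thesis using that by (simp add: U mult.assoc)
  qed
  have r: "r i ^ 4 = d i" "r i \<noteq> 0" if "i < n" for i
    using d[OF that] assms(3) by (auto simp: r_def)
  have dcong: "fdiag n x = fdiag n y" if "\<And>i. i < n \<Longrightarrow> x i = y i" for x y
    by (rule fmat_eqI) (simp add: entry_fdiag that)
  have "R * R = U * fdiag n (\<lambda>i. of_real (r i * r i)) * adj U"
    unfolding R_def comp[OF in_size_fdiag] by (simp add: fdiag_times)
  then have "R * R * (R * R) = U * fdiag n (\<lambda>i. of_real (r i ^ 4)) * adj U"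
    by (simp only: comp[OF in_size_fdiag] fdiag_times) (simp add: power4_eq_xxxx mult.assoc)
  also have "fdiag n (\<lambda>i. complex_of_real (r i ^ 4)) = fdiag n (\<lambda>i. of_real (d i))"
    by (rule dcong) (simp add: r del: of_real_power)
  finally have 1: "R * R * (R * R) = A" by (simp add: A)
  have "R * S = U * fdiag n (\<lambda>i. of_real (r i * (1 / r i))) * adj U"
    "S * R = U * fdiag n (\<lambda>i. of_real (r i * (1 / r i))) * adj U"
    unfolding R_def S_def comp[OF in_size_fdiag] fdiag_times of_real_mult by (simp_all only: mult.commute)
  moreover have "fdiag n (\<lambda>i. complex_of_real (r i * (1 / r i))) = fdiag n (\<lambda>_. 1)"
    by (rule dcong) (simp add: r)
  ultimately have 2: "R * S = funit n" "S * R = funit n" using U by (simp_all only: fdiag_one funit_right)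
  show ?thesis using 1 2 U
    by (intro exI[of _ R] exI[of _ S]) (auto simp: R_def S_def adj_fdiag mult.assoc)
qed

subsection \<open>Completely bounded norms of families of matrices\<close>

lemma psd_diff_trans: "psd (B - A) \<Longrightarrow> psd (C - B) \<Longrightarrow> psd (C - A)"
  using psd_plus[of "B - A" "C - B"] by simp

lemma psd_funit: "psd (funit n)"
  using psd_gram[of "funit n"] by (simp add: funit_times_funit)

lemma tr_psd_nonneg: "in_size n A \<Longrightarrow> psd A \<Longrightarrow> 0 \<le> Re (tr A)"
  using psd_tr[of A "funit n"] by (simp add: funit_times_funit)

lemma tr_funit: "tr (funit n) = of_nat n"
  by (subst tr_eq[of n]) (auto simp: entry_funit)

lemma square_root:
  assumes "in_size n A" "adj A = A" "0 < e" "psd (A - e *\<^sub>R funit n)"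
  shows "\<exists>G S. in_size n G \<and> in_size n S \<and> adj G = G \<and> adj S = S \<and> G * G = A \<and> G * S = funit n \<and> S * G = funit n"
proof -
  obtain R S where R: "in_size n R" "in_size n S" "adj R = R" "adj S = S" "R * R * (R * R) = A" "R * S = funit n" "S * R = funit n"
    using fourth_root[OF assms] by blast
  have "R * R * (S * S) = R * (R * S) * S" "S * S * (R * R) = S * (S * R) * R" by (simp_all add: mult.assoc)
  then show ?thesis using R by (intro exI[of _ "R * R"] exI[of _ "S * S"]) auto
qed

text \<open>\<open>Z\<close> is split as \<open>R * (S * Z)\<close>, two factors that behave like
  square roots of the moduli of \<open>adj Z\<close> and \<open>Z\<close>. Adding \<open>d\<close>
  makes \<open>Z * adj Z\<close> invertible in the corner. The last conjunct holds because the
  square of the Gram matrix of \<open>S * Z\<close> is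
  \<open>adj Z * (funit n - d *\<^sub>R (S * S * (S * S))) * Z\<close>.\<close>

lemma polar_factorization:
  assumes Z: "in_size n Z" and d: "0 < d"
  shows "\<exists>R S. in_size n R \<and> in_size n S \<and> adj R = R \<and> adj S = S \<and> R * S = funit n \<and> S * R = funit n \<and>
    R * R * (R * R) = Z * adj Z + d *\<^sub>R funit n \<and>
    psd (adj Z * Z - adj (S * Z) * (S * Z) * (adj (S * Z) * (S * Z)))"
proof -
  define A where "A = Z * adj Z + d *\<^sub>R funit n"
  have "psd (A - d *\<^sub>R funit n)" using psd_gram[of Z] by (simp add: A_def)
  moreover have "in_size n A" "adj A = A" using Z by (auto simp: A_def scaleR_fmat_def)
  ultimately obtain R S where R: "in_size n R" "in_size n S" "adj R = R" "adj S = S" "R * R * (R * R) = A"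
    "R * S = funit n" "S * R = funit n"
    using fourth_root[of n A d] d by blast
  have "S * S * (R * R) = S * (S * R) * R" "R * R * (S * S) = R * (R * S) * S" by (simp_all add: mult.assoc)
  then have SR: "S * S * (R * R) = funit n" "R * R * (S * S) = funit n" using R by simp_all
  have "S * S * A * (S * S) = S * S * (R * R) * (R * R * (S * S))"
    by (simp add: mult.assoc flip: R(5))
  also have "\<dots> = funit n" by (simp add: SR funit_times_funit)
  finally have SA: "S * S * A * (S * S) = funit n" .
  have "adj (S * Z) * (S * Z) * (adj (S * Z) * (S * Z)) = adj Z * (S * S * (Z * adj Z) * (S * S)) * Z"
    using R by (simp add: mult.assoc)
  also have "Z * adj Z = A - d *\<^sub>R funit n" by (simp add: A_def)
  also have "S * S * (A - d *\<^sub>R funit n) * (S * S) = funit n - d *\<^sub>R (S * S * (S * S))"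
    using R by (simp add: left_diff_distrib right_diff_distrib SA)
  finally have "adj Z * Z - adj (S * Z) * (S * Z) * (adj (S * Z) * (S * Z))
      = d *\<^sub>R (adj Z * (S * S) * adj (adj Z * (S * S)))"
    using R Z by (simp add: left_diff_distrib right_diff_distrib mult.assoc)
  then have "psd (adj Z * Z - adj (S * Z) * (S * Z) * (adj (S * Z) * (S * Z)))"
    using psd_scale[OF _ psd_gram] d by (metis less_imp_le)
  then show ?thesis using R unfolding A_def by blast
qed

text \<open>The pairing of \<open>W\<close> with the image of \<open>Z\<close> under the sum of the
  maps \<open>Z \<mapsto> a s * Z * adj (b s)\<close>. Two families are allowed because the cross
  terms of a row of two families involve the mixed form.\<close>

definition sform :: "'s set \<Rightarrow> ('s \<Rightarrow> fmat) \<Rightarrow> ('s \<Rightarrow> fmat) \<Rightarrow> fmat \<Rightarrow> fmat \<Rightarrow> complex" where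
  "sform F a b Z W = (\<Sum>s\<in>F. tr (a s * Z * adj (b s) * adj W))"

text \<open>This says \<open>\<parallel>\<Sum>\<^sub>s a\<^sub>s \<otimes> conj a\<^sub>s\<parallel> \<le> L\<close>, the operator norm being taken on
  Hilbert-Schmidt matrices, where \<open>a \<otimes> conj b\<close> is \<open>Z \<mapsto> a Z b\<^sup>*\<close>.\<close>

definition oh_bound :: "'s set \<Rightarrow> ('s \<Rightarrow> fmat) \<Rightarrow> real \<Rightarrow> bool" where
  "oh_bound F a L \<longleftrightarrow> (\<forall>Z W. cmod (sform F a a Z W) \<le> L * norm Z * norm W)"

lemma oh_boundD: "oh_bound F a L \<Longrightarrow> cmod (sform F a a Z W) \<le> L * norm Z * norm W"
  by (simp add: oh_bound_def)

text \<open>At positive arguments every summand is a squared norm. The form is then monotone in the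
  index set, which is what allows terms to be dropped.\<close>

lemma sform_psd:
  "sform F a a (x * adj x) (y * adj y) = of_real (\<Sum>s\<in>F. (norm (adj y * a s * x))\<^sup>2)"
proof -
  have "tr (a s * (x * adj x) * adj (a s) * adj (y * adj y)) = of_real ((norm (adj y * a s * x))\<^sup>2)" for s
    using tr_commute[of "a s * x * adj x * adj (a s) * y" "adj y"]
    unfolding tr_gram[symmetric] by (simp add: mult.assoc)
  then show ?thesis by (simp add: sform_def)
qed

lemma sform_compress:
  assumes "\<And>s. s \<in> F \<Longrightarrow> in_size n (a s)" "\<And>s. s \<in> F \<Longrightarrow> in_size n (b s)"
  shows "sform F a b (funit n * Z * funit n) (funit n * W * funit n) = sform F a b Z W"
  unfolding sform_def
proof (rule sum.cong)
  fix s assume s: "s \<in> F"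
  have "a s * funit n = a s" "funit n * adj (b s) = adj (b s)" "adj (b s) * funit n = adj (b s)" "funit n * a s = a s"
    using assms[OF s] by auto
  then have "a s * (funit n * Z * funit n) * adj (b s) * adj (funit n * W * funit n) = a s * Z * adj (b s) * adj W * funit n"
    by (simp add: mult.assoc) (simp flip: mult.assoc)
  moreover have "tr (a s * Z * adj (b s) * adj W * funit n) = tr (a s * Z * adj (b s) * adj W)"
    using tr_commute[of "a s * Z * adj (b s) * adj W" "funit n"] \<open>funit n * a s = a s\<close>
    by (simp flip: mult.assoc)
  ultimately show "tr (a s * (funit n * Z * funit n) * adj (b s) * adj (funit n * W * funit n)) = tr (a s * Z * adj (b s) * adj W)"
    by simp
qed simp

text \<open>The regularization costs only \<open>d * real n\<close>, \<open>d\<close> times the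
  trace of the corner unit, in the squared norm of the first factor, and nothing in the second.
  Letting \<open>d\<close> tend to 0 removes this error.\<close>

lemma polar_norms:
  assumes "in_size n Z" "adj R = R" "in_size n R" "in_size n S" "R * R * (R * R) = Z * adj Z + d *\<^sub>R funit n"
    "psd (adj Z * Z - adj (S * Z) * (S * Z) * (adj (S * Z) * (S * Z)))"
  shows "(norm (R * adj R))\<^sup>2 = (norm Z)\<^sup>2 + d * real n" "norm (adj (S * Z) * (S * Z)) \<le> norm Z"
proof -
  have "complex_of_real ((norm (R * adj R))\<^sup>2) = of_real ((norm Z)\<^sup>2 + d * real n)"
    unfolding tr_gram[symmetric] of_real_add using assms by (simp add: scaleR_fmat_def tr_funit)
  then show "(norm (R * adj R))\<^sup>2 = (norm Z)\<^sup>2 + d * real n" by (simp only: of_real_eq_iff)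
  define T where "T = adj (S * Z) * (S * Z)"
  have "0 \<le> Re (tr (adj Z * Z - T * T))"
    using assms unfolding T_def by (intro tr_psd_nonneg[of n]) auto
  moreover have "tr (T * T) = of_real ((norm T)\<^sup>2)" "tr (adj Z * Z) = of_real ((norm Z)\<^sup>2)"
    using tr_gram[of T] tr_gram[of "adj Z"] by (simp_all add: T_def)
  ultimately have "(norm T)\<^sup>2 \<le> (norm Z)\<^sup>2" by simp
  then show "norm (adj (S * Z) * (S * Z)) \<le> norm Z"
    unfolding T_def by (rule power2_le_imp_le) simp
qed

text \<open>Splitting both arguments by the polar decomposition reduces a bound on the sesquilinear
  form to positive arguments, where it is a sum of squares.\<close>

lemma sform_bound:
  assumes in_size: "\<And>s. s \<in> F \<Longrightarrow> in_size n (a s)" "\<And>s. s \<in> F \<Longrightarrow> in_size n (b s)"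
    and L: "0 \<le> L" "\<And>x y. in_size n x \<Longrightarrow> in_size n y \<Longrightarrow>
      (\<Sum>s\<in>F. (norm (adj y * a s * x))\<^sup>2) \<le> L * norm (x * adj x) * norm (y * adj y)"
    and M: "0 \<le> M" "\<And>x y. in_size n x \<Longrightarrow> in_size n y \<Longrightarrow>
      (\<Sum>s\<in>F. (norm (adj y * b s * x))\<^sup>2) \<le> M * norm (x * adj x) * norm (y * adj y)"
  shows "cmod (sform F a b Z W) \<le> sqrt (L * M) * norm Z * norm W"
proof -
  have main: "(cmod (sform F a b Z W))\<^sup>2 \<le> L * M * (norm Z)\<^sup>2 * (norm W)\<^sup>2"
    if Z: "in_size n Z" and W: "in_size n W" for Z W
  proof -
    have *: "(cmod (sform F a b Z W))\<^sup>2 \<le>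
        L * (sqrt ((norm Z)\<^sup>2 + d * real n) * sqrt ((norm W)\<^sup>2 + d * real n)) * (M * (norm Z * norm W))"
      if d: "0 < d" for d :: real
    proof -
      obtain R S where R: "in_size n R" "in_size n S" "adj R = R" "adj S = S" "R * S = funit n" "S * R = funit n"
        "R * R * (R * R) = Z * adj Z + d *\<^sub>R funit n"
        "psd (adj Z * Z - adj (S * Z) * (S * Z) * (adj (S * Z) * (S * Z)))"
        using polar_factorization[OF Z d] by blast
      obtain R' S' where R': "in_size n R'" "in_size n S'" "adj R' = R'" "adj S' = S'" "R' * S' = funit n" "S' * R' = funit n"
        "R' * R' * (R' * R') = W * adj W + d *\<^sub>R funit n"
        "psd (adj W * W - adj (S' * W) * (S' * W) * (adj (S' * W) * (S' * W)))"
        using polar_factorization[OF W d] by blast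
      note nR = polar_norms[OF Z R(3,1,2,7,8)] polar_norms[OF W R'(3,1,2,7,8)]
      define Z2 where "Z2 = S * Z"
      define W2 where "W2 = S' * W"
      have ZW: "Z = R * Z2" "W = R' * W2"
        using R R' Z W by (simp_all add: Z2_def W2_def flip: mult.assoc)
      have in2: "in_size n Z2" "in_size n W2" using R R' Z W by (simp_all add: Z2_def W2_def)
      \<comment> \<open>One polar factor of each argument stays with \<open>a\<close>, the other
        moves to \<open>b\<close>; Cauchy-Schwarz then separates the two families.\<close>
      have t: "tr (a s * Z * adj (b s) * adj W) = tr (adj R' * a s * R * adj (W2 * b s * adj Z2))" for s
      proof -
        have "tr (a s * Z * adj (b s) * adj W) = tr ((a s * R * Z2 * adj (b s) * adj W2) * adj R')"
          by (simp add: ZW mult.assoc)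
        also have "\<dots> = tr (adj R' * (a s * R * Z2 * adj (b s) * adj W2))" by (rule tr_commute)
        finally show ?thesis by (simp add: mult.assoc)
      qed
      have "cmod (sform F a b Z W) \<le> (\<Sum>s\<in>F. norm (adj R' * a s * R) * norm (W2 * b s * adj Z2))"
        unfolding sform_def t
        by (rule sum_norm_le) (metis tr_cauchy_schwarz norm_adj)
      then have "(cmod (sform F a b Z W))\<^sup>2 \<le> (\<Sum>s\<in>F. norm (adj R' * a s * R) * norm (W2 * b s * adj Z2))\<^sup>2"
        by (rule power_mono) simp
      also have "\<dots> \<le> (\<Sum>s\<in>F. (norm (adj R' * a s * R))\<^sup>2) * (\<Sum>s\<in>F. (norm (W2 * b s * adj Z2))\<^sup>2)"
        by (rule Cauchy_Schwarz_ineq_sum)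
      also have "\<dots> \<le> (L * norm (R * adj R) * norm (R' * adj R')) * (M * norm (adj Z2 * Z2) * norm (adj W2 * W2))"
        using L(2)[OF R(1) R'(1)] M(2)[of "adj Z2" "adj W2"] in2
        by (intro mult_mono) (auto intro!: sum_nonneg mult_nonneg_nonneg L(1))
      also have "\<dots> \<le> (L * norm (R * adj R) * norm (R' * adj R')) * (M * norm Z * norm W)"
        using nR(2,4) L(1) M(1) unfolding Z2_def W2_def
        by (intro mult_left_mono mult_mono) (auto intro!: mult_nonneg_nonneg)
      also have "norm (R * adj R) = sqrt ((norm Z)\<^sup>2 + d * real n)" by (metis nR(1) norm_ge_zero real_sqrt_unique)
      also have "norm (R' * adj R') = sqrt ((norm W)\<^sup>2 + d * real n)" by (metis nR(3) norm_ge_zero real_sqrt_unique)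
      finally show ?thesis by (simp add: mult.assoc)
    qed
    have "((\<lambda>d. L * (sqrt ((norm Z)\<^sup>2 + d * real n) * sqrt ((norm W)\<^sup>2 + d * real n)) * (M * (norm Z * norm W)))
       \<longlongrightarrow> L * (sqrt ((norm Z)\<^sup>2 + 0 * real n) * sqrt ((norm W)\<^sup>2 + 0 * real n)) * (M * (norm Z * norm W))) (at_right 0)"
      by (intro tendsto_intros)
    then have "(cmod (sform F a b Z W))\<^sup>2 \<le> L * (sqrt ((norm Z)\<^sup>2 + 0 * real n) * sqrt ((norm W)\<^sup>2 + 0 * real n)) * (M * (norm Z * norm W))"
      by (rule tendsto_lowerbound) (auto intro!: eventually_at_rightI[of 0 1] *)
    then show ?thesis by (simp add: power2_eq_square mult_ac)
  qed
  \<comment> \<open>The argument so far concerns the corner. Entries outside it do not affect the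
    form, and cutting them off does not increase the norms.\<close>
  define Z' W' where "Z' = funit n * Z * funit n" and "W' = funit n * W * funit n"
  have in': "in_size n Z'" "in_size n W'"
    unfolding in_size_iff_funit Z'_def W'_def by (simp_all add: mult.assoc funit_times_funit) (simp_all add: funit_times_funit flip: mult.assoc)
  have "sform F a b Z' W' = sform F a b Z W" unfolding Z'_def W'_def by (rule sform_compress) (use in_size in auto)
  then have "(cmod (sform F a b Z W))\<^sup>2 \<le> L * M * (norm Z')\<^sup>2 * (norm W')\<^sup>2"
    using main[OF in'] by simp
  also have "\<dots> \<le> L * M * (norm Z)\<^sup>2 * (norm W)\<^sup>2"
  proof -
    have "(norm Z')\<^sup>2 \<le> (norm Z)\<^sup>2" "(norm W')\<^sup>2 \<le> (norm W)\<^sup>2"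
      unfolding Z'_def W'_def by (rule power_mono[OF norm_compress norm_ge_zero])+
    moreover have "0 \<le> L * M" using L(1) M(1) by simp
    ultimately show ?thesis by (simp add: mult_mono)
  qed
  also have "\<dots> = (sqrt (L * M) * norm Z * norm W)\<^sup>2"
    using L(1) M(1) by (simp add: power_mult_distrib)
  finally show ?thesis by (rule power2_le_imp_le) (simp add: L(1) M(1))
qed

lemma oh_bound_psd:
  assumes "oh_bound F a L"
  shows "(\<Sum>s\<in>F. (norm (adj y * a s * x))\<^sup>2) \<le> L * norm (x * adj x) * norm (y * adj y)"
proof -
  have "cmod (sform F a a (x * adj x) (y * adj y)) = (\<Sum>s\<in>F. (norm (adj y * a s * x))\<^sup>2)"
    unfolding sform_psd norm_of_real by (intro abs_of_nonneg sum_nonneg) auto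
  then show ?thesis using oh_boundD[OF assms, of "x * adj x" "y * adj y"] by simp
qed

lemma in_size_family: "finite F \<Longrightarrow> \<exists>n. \<forall>s\<in>F. in_size n (a s)"
  using in_size_all[of "a ` F" 0] by auto

text \<open>Together with \<open>oh_bound_psd\<close> this makes positive arguments sufficient, so
  that bounds become inequalities between sums of squares.\<close>

lemma oh_boundI_psd:
  assumes "finite F" "0 \<le> L"
    "\<And>x y. (\<Sum>s\<in>F. (norm (adj y * a s * x))\<^sup>2) \<le> L * norm (x * adj x) * norm (y * adj y)"
  shows "oh_bound F a L"
proof -
  obtain n where "\<forall>s\<in>F. in_size n (a s)" using in_size_family[OF assms(1)] by blast
  then show ?thesis
    unfolding oh_bound_def using sform_bound[of F n a a L L] assms(2,3) by auto
qed

lemma oh_bound_cauchy_schwarz: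
  assumes "finite F" "0 \<le> L" "0 \<le> M" "oh_bound F a L" "oh_bound F b M"
  shows "cmod (sform F a b Z W) \<le> sqrt (L * M) * norm Z * norm W"
proof -
  obtain n where n: "\<forall>s\<in>F. in_size n (a s)" using in_size_family[OF assms(1)] by blast
  obtain m where m: "\<forall>s\<in>F. in_size m (b s)" using in_size_family[OF assms(1)] by blast
  have "in_size (max n m) (a s)" "in_size (max n m) (b s)" if "s \<in> F" for s
    using n m that by (auto intro: in_size_mono)
  then show ?thesis
    using sform_bound[of F "max n m" a b L M] assms oh_bound_psd by blast
qed

lemma oh_bound_nonneg_mono: "oh_bound F a L \<Longrightarrow> L \<le> M \<Longrightarrow> oh_bound F a M"
  unfolding oh_bound_def by (meson mult_right_mono norm_ge_zero order_trans)

lemma oh_bound_subset: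
  assumes "finite B" "A \<subseteq> B" "0 \<le> L" "oh_bound B a L" shows "oh_bound A a L"
proof (rule oh_boundI_psd)
  show "finite A" using assms finite_subset by blast
  fix x y
  have "(\<Sum>s\<in>A. (norm (adj y * a s * x))\<^sup>2) \<le> (\<Sum>s\<in>B. (norm (adj y * a s * x))\<^sup>2)"
    using assms by (intro sum_mono2) auto
  then show "(\<Sum>s\<in>A. (norm (adj y * a s * x))\<^sup>2) \<le> L * norm (x * adj x) * norm (y * adj y)"
    using oh_bound_psd[OF assms(4), where x=x and y=y] by linarith
qed fact

text \<open>The bound on the form is tested with \<open>W\<close> equal to the image of
  \<open>Z\<close>; one factor of its norm then cancels.\<close>

lemma oh_bound_map_norm:
  assumes "oh_bound F a L" "0 \<le> L"
  shows "norm (\<Sum>s\<in>F. a s * Z * adj (a s)) \<le> L * norm Z"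
proof -
  define Y where "Y = (\<Sum>s\<in>F. a s * Z * adj (a s))"
  have "tr (Y * adj Y) = sform F a a Z Y"
    unfolding sform_def Y_def[THEN arg_cong, of "\<lambda>y. y * adj Y"] by (simp add: sum_distrib_right)
  then have "cmod (of_real ((norm Y)\<^sup>2)) = cmod (sform F a a Z Y)" by (simp only: tr_gram)
  then have "(norm Y)\<^sup>2 = cmod (sform F a a Z Y)" by (simp only: norm_of_real) simp
  also have "\<dots> \<le> L * norm Z * norm Y" using oh_boundD[OF assms(1)] .
  finally have "norm Y * norm Y \<le> (L * norm Z) * norm Y" by (simp add: power2_eq_square)
  then show ?thesis unfolding Y_def[symmetric] using assms(2)
    by (cases "norm Y = 0") (auto dest: mult_right_le_imp_le)
qed

lemma oh_bound_mult:
  assumes F: "finite F" and L: "0 \<le> L" "oh_bound F a L" and M: "0 \<le> M" "oh_bound F b M"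
  shows "oh_bound F (\<lambda>s. a s * b s) (L * M)"
proof (rule oh_boundI_psd)
  fix x y
  \<comment> \<open>Summing over the inner family first turns the double sum into the form of
    \<open>a\<close> at \<open>Y\<close>, whose norm is controlled by the bound on
    \<open>b\<close>.\<close>
  define Y where "Y = (\<Sum>t\<in>F. b t * (x * adj x) * adj (b t))"
  have "(\<Sum>s\<in>F. (norm (adj y * (a s * b s) * x))\<^sup>2) \<le> (\<Sum>s\<in>F. \<Sum>t\<in>F. (norm (adj y * (a s * b t) * x))\<^sup>2)"
    using F by (intro sum_mono member_le_sum) auto
  also have "\<dots> = Re (sform F a a Y (y * adj y))"
  proof -
    have "sform F a a Y (y * adj y) = (\<Sum>s\<in>F. \<Sum>t\<in>F. tr (a s * (b t * (x * adj x) * adj (b t)) * adj (a s) * adj (y * adj y)))"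
      by (simp add: sform_def Y_def sum_distrib_left sum_distrib_right)
    also have "\<dots> = (\<Sum>s\<in>F. \<Sum>t\<in>F. sform {()} (\<lambda>_. a s * b t) (\<lambda>_. a s * b t) (x * adj x) (y * adj y))"
      by (simp add: sform_def mult.assoc)
    also have "\<dots> = of_real (\<Sum>s\<in>F. \<Sum>t\<in>F. (norm (adj y * (a s * b t) * x))\<^sup>2)"
      unfolding sform_psd by simp
    finally show ?thesis by simp
  qed
  also have "\<dots> \<le> L * norm Y * norm (y * adj y)"
    using oh_boundD[OF L(2), of Y "y * adj y"] complex_Re_le_cmod[of "sform F a a Y (y * adj y)"] by linarith
  also have "\<dots> \<le> L * (M * norm (x * adj x)) * norm (y * adj y)"
    using oh_bound_map_norm[OF M(2,1), of "x * adj x"] L(1) unfolding Y_def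
    by (intro mult_right_mono mult_left_mono) auto
  finally show "(\<Sum>s\<in>F. (norm (adj y * (a s * b s) * x))\<^sup>2) \<le> L * M * norm (x * adj x) * norm (y * adj y)"
    by (simp add: mult.assoc)
qed (use assms in auto)

text \<open>Cyclicity of the trace exchanges the two arguments up to adjoints, and the bound is
  symmetric in them.\<close>

lemma oh_bound_adj: assumes "oh_bound F a L" shows "oh_bound F (\<lambda>s. adj (a s)) L"
proof -
  have "sform F (\<lambda>s. adj (a s)) (\<lambda>s. adj (a s)) Z W = sform F a a (adj W) (adj Z)" for Z W
    unfolding sform_def
  proof (rule sum.cong)
    fix s
    show "tr (adj (a s) * Z * adj (adj (a s)) * adj W) = tr (a s * adj W * adj (a s) * adj (adj Z))"
      using tr_commute[of "adj (a s) * Z" "a s * adj W"] by (simp add: mult.assoc)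
  qed simp
  then show ?thesis using assms unfolding oh_bound_def by (metis norm_adj mult.assoc mult.commute)
qed

lemma oh_bound_cscale: assumes "oh_bound F a L" shows "oh_bound F (\<lambda>s. cscale c (a s)) ((cmod c)\<^sup>2 * L)"
proof -
  have "sform F (\<lambda>s. cscale c (a s)) (\<lambda>s. cscale c (a s)) Z W = of_real ((cmod c)\<^sup>2) * sform F a a Z W" for Z W
    unfolding complex_norm_square by (simp add: sform_def sum_distrib_left mult_ac)
  then show ?thesis using assms unfolding oh_bound_def
    by (simp add: norm_mult mult.assoc mult_left_mono del: of_real_power)
qed

section \<open>Orthogonal blocks, partial isometries and rows of families\<close>

lemma bessel:
  assumes "finite F" "\<And>s t. s \<in> F \<Longrightarrow> t \<in> F \<Longrightarrow> adj (J s) * J s * (adj (J t) * J t) = (if s = t then adj (J s) * J s else 0)"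
  shows "(\<Sum>s\<in>F. (norm (J s * X))\<^sup>2) \<le> (norm X)\<^sup>2"
proof -
  define p where "p = (\<Sum>s\<in>F. adj (J s) * J s)"
  obtain N where N: "in_size N p" "in_size N X" using in_size_ex2 by blast
  have "adj p = p" by (simp add: p_def)
  have "p * p = (\<Sum>s\<in>F. \<Sum>t\<in>F. if s = t then adj (J s) * J s else 0)"
    unfolding p_def sum_product by (intro sum.cong assms) auto
  then have "p * p = p" using assms(1) by (simp add: p_def)
  \<comment> \<open>The Gram matrices of the \<open>J s\<close> are mutually orthogonal projections,
    so the complement of their sum in a large enough corner is again a projection. Pairing it with
    \<open>X * adj X\<close> gives the inequality.\<close>
  define f where "f = funit N - p"
  have "f * adj f = f"
    using N \<open>adj p = p\<close> \<open>p * p = p\<close> by (simp add: f_def left_diff_distrib right_diff_distrib funit_times_funit)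
  then have "psd f" using psd_gram[of f] by simp
  then have "0 \<le> Re (tr (f * (X * adj X)))" by (rule psd_tr)
  also have "f * (X * adj X) = X * adj X - (\<Sum>s\<in>F. adj (J s) * (J s * X * adj X))"
    using N by (simp add: f_def p_def left_diff_distrib sum_distrib_right mult.assoc flip: mult.assoc[of "funit N" X])
  also have "tr \<dots> = of_real ((norm X)\<^sup>2) - (\<Sum>s\<in>F. tr (adj (J s) * (J s * X * adj X)))"
    by (simp only: tr_minus tr_sum tr_gram)
  also have "(\<Sum>s\<in>F. tr (adj (J s) * (J s * X * adj X))) = (\<Sum>s\<in>F. of_real ((norm (J s * X))\<^sup>2))"
  proof (rule sum.cong)
    fix s
    have "tr (adj (J s) * (J s * X * adj X)) = tr (J s * X * adj (J s * X))"
      using tr_commute[of "adj (J s)" "J s * X * adj X"] by (simp add: mult.assoc)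
    then show "tr (adj (J s) * (J s * X * adj X)) = of_real ((norm (J s * X))\<^sup>2)"
      by (simp only: tr_gram)
  qed simp
  finally show ?thesis by simp
qed

lemma contraction:
  assumes "adj J * J * (adj J * J) = adj J * J"
  shows "norm (J * X) \<le> norm X"
proof -
  have "(norm (J * X))\<^sup>2 \<le> (norm X)\<^sup>2" using bessel[of "{()}" "\<lambda>_. J" X] assms by simp
  then show ?thesis by (rule power2_le_imp_le) simp
qed

lemma contraction_right:
  assumes "adj J * J * (adj J * J) = adj J * J"
  shows "norm (X * adj J) \<le> norm X"
  using contraction[OF assms, of "adj X"] by (metis adj_adj adj_times norm_adj)

text \<open>The partial isometry is absorbed into the argument, since
  \<open>Z \<mapsto> J * Z * adj J\<close> does not increase the Hilbert-Schmidt norm.\<close>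

lemma oh_bound_times_right:
  assumes "adj J * J * (adj J * J) = adj J * J" "oh_bound F a L" "0 \<le> L"
  shows "oh_bound F (\<lambda>s. a s * J) L"
proof -
  have "sform F (\<lambda>s. a s * J) (\<lambda>s. a s * J) Z W = sform F a a (J * Z * adj J) W" for Z W
    by (simp add: sform_def mult.assoc)
  moreover have "norm (J * Z * adj J) \<le> norm Z" for Z
    using contraction[OF assms(1)] contraction_right[OF assms(1)] order_trans by blast
  moreover have "cmod (sform F a a (J * Z * adj J) W) \<le> L * norm Z * norm W" if "norm (J * Z * adj J) \<le> norm Z" for Z W
    using oh_boundD[OF assms(2), of "J * Z * adj J" W]
      mult_right_mono[OF mult_left_mono[OF that assms(3)] norm_ge_zero[of W]] by linarith
  ultimately have "cmod (sform F (\<lambda>s. a s * J) (\<lambda>s. a s * J) Z W) \<le> L * norm Z * norm W" for Z W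
    by simp
  then show ?thesis by (simp add: oh_bound_def)
qed

text \<open>Cauchy-Schwarz for the vector \<open>(L, s, s, M)\<close> with
  \<open>s\<^sup>2 = L * M\<close>, whose length is exactly \<open>L + M\<close>; \<open>R\<close>
  is the remainder in the identity of Lagrange.\<close>

lemma four_term_cauchy_schwarz:
  assumes "0 \<le> L" "0 \<le> M" "0 \<le> T" "x1\<^sup>2 + x2\<^sup>2 + x3\<^sup>2 + x4\<^sup>2 \<le> T\<^sup>2"
  shows "L * x1 + sqrt (L * M) * x2 + sqrt (L * M) * x3 + M * x4 \<le> (L + M) * T"
proof -
  define s where "s = sqrt (L * M)"
  have s: "s\<^sup>2 = L * M" using assms by (simp add: s_def)
  define R where "R = (L * x2 - s * x1)\<^sup>2 + (L * x3 - s * x1)\<^sup>2 + (L * x4 - M * x1)\<^sup>2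
      + (s * x3 - s * x2)\<^sup>2 + (s * x4 - M * x2)\<^sup>2 + (s * x4 - M * x3)\<^sup>2"
  have "0 \<le> R" by (simp add: R_def)
  moreover have "(L * x1 + s * x2 + s * x3 + M * x4)\<^sup>2 + R
    = (L\<^sup>2 + s\<^sup>2 + s\<^sup>2 + M\<^sup>2) * (x1\<^sup>2 + x2\<^sup>2 + x3\<^sup>2 + x4\<^sup>2)"
    by (simp add: R_def power2_eq_square algebra_simps)
  ultimately have "(L * x1 + s * x2 + s * x3 + M * x4)\<^sup>2 \<le> (L\<^sup>2 + s\<^sup>2 + s\<^sup>2 + M\<^sup>2) * (x1\<^sup>2 + x2\<^sup>2 + x3\<^sup>2 + x4\<^sup>2)"
    by linarith
  also have "\<dots> \<le> (L\<^sup>2 + s\<^sup>2 + s\<^sup>2 + M\<^sup>2) * T\<^sup>2"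
    using assms by (intro mult_left_mono) auto
  also have "\<dots> = ((L + M) * T)\<^sup>2" by (simp only: s) (simp add: power2_eq_square algebra_simps)
  finally have "L * x1 + s * x2 + s * x3 + M * x4 \<le> (L + M) * T"
    by (rule power2_le_imp_le) (simp add: assms)
  then show ?thesis by (simp add: s_def)
qed

text \<open>\<open>e\<close> and \<open>e'\<close> select disjoint sets of columns and cut
  \<open>Z\<close> into four blocks whose squared norms add up to at most that of \<open>Z\<close>.
  As \<open>L\<close> and \<open>M\<close> bound squares of \<open>OH\<close> norms, this says that
  squared norms are subadditive along rows.\<close>

lemma oh_bound_row:
  assumes F: "finite F" and L: "0 \<le> L" "oh_bound F a L" and M: "0 \<le> M" "oh_bound F b M"
    and e: "adj e = e" "adj e' = e'" "e * e = e" "e' * e' = e'" "e * e' = 0"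
    and ab: "\<And>s. s \<in> F \<Longrightarrow> a s * e = a s" "\<And>s. s \<in> F \<Longrightarrow> b s * e' = b s"
  shows "oh_bound F (\<lambda>s. a s + b s) (L + M)"
  unfolding oh_bound_def
proof (intro allI)
  fix Z W
  have e'e: "e' * e = 0" by (metis e(1,2,5) adj_times adj_zero)
  have split: "(norm (e * X))\<^sup>2 + (norm (e' * X))\<^sup>2 \<le> (norm X)\<^sup>2" for X
  proof -
    have "(\<Sum>i\<in>{True, False}. (norm ((if i then e else e') * X))\<^sup>2) \<le> (norm X)\<^sup>2"
      by (rule bessel) (auto simp: e e'e)
    then show ?thesis by simp
  qed
  have split': "(norm (X * e))\<^sup>2 + (norm (X * e'))\<^sup>2 \<le> (norm X)\<^sup>2" for X
    using split[of "adj X"] e by (metis adj_adj adj_times norm_adj)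
  have red: "adj (a s) = e * adj (a s)" "adj (b s) = e' * adj (b s)" if "s \<in> F" for s
    using arg_cong[OF ab(1)[OF that], of adj] arg_cong[OF ab(2)[OF that], of adj] e by simp_all
  have tri: "cmod (p + q + r + u) \<le> cmod p + cmod q + cmod r + cmod u" for p q r u
    using norm_triangle_ineq[of "p + q + r" u] norm_triangle_ineq[of "p + q" r] norm_triangle_ineq[of p q]
    by linarith
  have "sform F (\<lambda>s. a s + b s) (\<lambda>s. a s + b s) Z W =
      sform F a a (e * Z * e) W + sform F a b (e * Z * e') W + sform F b a (e' * Z * e) W + sform F b b (e' * Z * e') W"
    unfolding sform_def sum.distrib[symmetric]
  proof (rule sum.cong)
    fix s assume s: "s \<in> F"
    have "a s * (e * X) = a s * X" "b s * (e' * X) = b s * X" for X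
      using ab s by (simp_all flip: mult.assoc)
    moreover have "e * (adj (a s) * X) = adj (a s) * X" "e' * (adj (b s) * X) = adj (b s) * X" for X
      using red[OF s] by (metis mult.assoc)+
    ultimately show "tr ((a s + b s) * Z * adj (a s + b s) * adj W) =
         tr (a s * (e * Z * e) * adj (a s) * adj W) + tr (a s * (e * Z * e') * adj (b s) * adj W) +
         tr (b s * (e' * Z * e) * adj (a s) * adj W) + tr (b s * (e' * Z * e') * adj (b s) * adj W)"
      by (simp add: distrib_left distrib_right mult.assoc)
  qed simp
  then have "cmod (sform F (\<lambda>s. a s + b s) (\<lambda>s. a s + b s) Z W) \<le>
      cmod (sform F a a (e * Z * e) W) + cmod (sform F a b (e * Z * e') W) + cmod (sform F b a (e' * Z * e) W)
      + cmod (sform F b b (e' * Z * e') W)"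
    by (simp only: tri)
  also have "\<dots> \<le> L * norm (e * Z * e) * norm W + sqrt (L * M) * norm (e * Z * e') * norm W
      + sqrt (L * M) * norm (e' * Z * e) * norm W + M * norm (e' * Z * e') * norm W"
    using oh_bound_cauchy_schwarz[OF F L(1) M(1) L(2) M(2)] oh_bound_cauchy_schwarz[OF F M(1) L(1) M(2) L(2)]
    by (intro add_mono oh_boundD L M) (simp_all add: mult.commute[of M])
  also have "\<dots> = (L * norm (e * Z * e) + sqrt (L * M) * norm (e * Z * e')
      + sqrt (L * M) * norm (e' * Z * e) + M * norm (e' * Z * e')) * norm W"
    by (simp add: algebra_simps)
  also have "\<dots> \<le> (L + M) * norm Z * norm W"
  proof (intro mult_right_mono four_term_cauchy_schwarz)
    show "(norm (e * Z * e))\<^sup>2 + (norm (e * Z * e'))\<^sup>2 + (norm (e' * Z * e))\<^sup>2 + (norm (e' * Z * e'))\<^sup>2 \<le> (norm Z)\<^sup>2"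
      using split'[of "e * Z"] split'[of "e' * Z"] split[of Z] by linarith
  qed (use L M in auto)
  finally show "cmod (sform F (\<lambda>s. a s + b s) (\<lambda>s. a s + b s) Z W) \<le> (L + M) * norm Z * norm W" .
qed

subsection \<open>Factorization of families\<close>

text \<open>The constant is the same for all exponents and disappears on taking roots, as in the
  spectral radius formula.\<close>

lemma power_dominated:
  fixes x y K :: real
  assumes "0 \<le> x" "0 \<le> y" "\<And>k. x ^ (2 ^ k) \<le> K * y ^ (2 ^ k)"
  shows "x \<le> y"
proof (rule ccontr)
  assume "\<not> x \<le> y"
  then have xy: "y < x" by simp
  show False
  proof (cases "y = 0")
    case True
    then show ?thesis using assms(3)[of 0] xy by simp
  next
    case False
    then have y: "y > 0" using assms by simp
    then have 1: "1 < x / y" using xy by simp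
    then obtain n where n: "K < (x / y) ^ n" using real_arch_pow by blast
    have "(x / y) ^ n \<le> (x / y) ^ (2 ^ n)" using 1 by (intro power_increasing) auto
    also have "\<dots> \<le> K" using assms(3)[of n] y by (simp add: power_divide divide_le_eq)
    finally show False using n by simp
  qed
qed

text \<open>The map \<open>Z \<mapsto> \<Sum>\<^sub>s P\<^sub>s Z P\<^sub>s\<close> is self-adjoint and preserves positivity, so a strictly
  positive supersolution \<open>X\<close> bounds its iterates, and iterating the Cauchy-Schwarz inequality
  turns this into a bound on its norm.\<close>

lemma oh_bound_supersolution:
  assumes F: "finite F" and P: "\<And>s. s \<in> F \<Longrightarrow> in_size n (P s)" "\<And>s. s \<in> F \<Longrightarrow> adj (P s) = P s"
    and mu: "0 \<le> mu" and c: "0 < c"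
    and X: "psd (X - c *\<^sub>R funit n)" "psd (mu *\<^sub>R X - (\<Sum>s\<in>F. P s * X * P s))"
  shows "oh_bound F P mu"
proof -
  define Phi where "Phi Z = (\<Sum>s\<in>F. P s * Z * P s)" for Z
  have Phi_psd: "psd (Phi Z)" if "psd Z" for Z
    unfolding Phi_def by (rule psd_sum) (metis P(2) psd_conj that)
  have Phi_lin: "Phi (A - B) = Phi A - Phi B" "Phi (r *\<^sub>R A) = r *\<^sub>R Phi A" for A B r
    by (simp_all add: Phi_def left_diff_distrib right_diff_distrib sum_subtractf scaleR_sum_right)
  have Phi_self: "inner (Phi A) B = inner A (Phi B)" for A B
  proof -
    have "tr (Phi A * adj B) = tr (A * adj (Phi B))"
      unfolding Phi_def sum_distrib_right adj_sum sum_distrib_left tr_sum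
    proof (rule sum.cong)
      fix s assume "s \<in> F"
      then show "tr (P s * A * P s * adj B) = tr (A * adj (P s * B * P s))"
        using tr_commute[of "P s" "A * P s * adj B"] P by (simp add: mult.assoc)
    qed simp
    then show ?thesis by (simp add: inner_fmat_def)
  qed
  have main: "(\<Sum>s\<in>F. (norm (adj y * P s * x))\<^sup>2) \<le> mu * norm (x * adj x) * norm (y * adj y)"
    if x: "in_size n x" and y: "in_size n y" for x y
  proof -
    define Z where "Z k = (Phi ^^ k) (x * adj x)" for k
    \<comment> \<open>Chosen so that \<open>x * adj x\<close> lies below
      \<open>C *\<^sub>R X\<close>: it is at most its norm times \<open>funit n\<close>, while
      \<open>X\<close> is at least \<open>c *\<^sub>R funit n\<close>.\<close>
    define C where "C = norm (x * adj x) / c"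
    have ZS: "Z (Suc k) = Phi (Z k)" for k by (simp add: Z_def)
    have Z0: "Z 0 = x * adj x" by (simp add: Z_def)
    have bound: "psd ((C * mu ^ k) *\<^sub>R X - Z k)" for k
    proof (induction k)
      case 0
      have "psd (norm (x * adj x) *\<^sub>R funit n - Z 0)"
        unfolding Z0 by (rule psd_norm_bound) (use x in auto)
      moreover have "psd (C *\<^sub>R (X - c *\<^sub>R funit n))"
        using X(1) c by (intro psd_scale) (auto simp: C_def)
      ultimately have "psd (norm (x * adj x) *\<^sub>R funit n - Z 0 + C *\<^sub>R (X - c *\<^sub>R funit n))" by (rule psd_plus)
      then show ?case using c by (simp add: C_def scaleR_diff_right)
    next
      case (Suc k)
      have "0 \<le> C * mu ^ k" using c mu by (simp add: C_def)
      then have "psd ((C * mu ^ k) *\<^sub>R (mu *\<^sub>R X - Phi X))"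
        using X(2) by (intro psd_scale) (simp_all add: Phi_def)
      moreover have "psd (Phi ((C * mu ^ k) *\<^sub>R X - Z k))" using Phi_psd Suc by blast
      ultimately have "psd ((C * mu ^ k) *\<^sub>R (mu *\<^sub>R X - Phi X) + Phi ((C * mu ^ k) *\<^sub>R X - Z k))"
        by (rule psd_plus)
      then show ?case by (simp add: ZS Phi_lin scaleR_diff_right mult_ac)
    qed
    \<comment> \<open>Since the map is self-adjoint, the inner product of two iterates depends only
      on the sum of their indices. Cauchy-Schwarz therefore compares \<open>q k\<close> with
      \<open>q (2 * k)\<close>.\<close>
    define q where "q k = inner (Z k) (Z 0)" for k
    have q_add: "inner (Z i) (Z j) = q (i + j)" for i j
    proof (induction j arbitrary: i)
      case (Suc j)
      show ?case using Suc[of "Suc i"] by (simp add: ZS flip: Phi_self)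
    qed (simp add: q_def)
    define K where "K = C * Re (tr (X * (x * adj x)))"
    have q_bound: "q k \<le> K * mu ^ k" for k
    proof -
      have "0 \<le> Re (tr (((C * mu ^ k) *\<^sub>R X - Z k) * (x * adj x)))" using bound by (rule psd_tr)
      then show ?thesis
        by (simp add: q_def Z0 inner_fmat_def K_def left_diff_distrib scaleR_fmat_def mult_ac)
    qed
    have q_even: "q (2 * k) = (norm (Z k))\<^sup>2" for k
      using q_add[of k k] by (simp add: power2_norm_eq_inner mult_2)
    have q_sq: "(q k)\<^sup>2 \<le> q (2 * k) * q 0" for k
    proof -
      have "\<bar>q k\<bar> \<le> norm (Z k) * norm (Z 0)" unfolding q_def by (rule Cauchy_Schwarz_ineq2)
      then have "\<bar>q k\<bar>\<^sup>2 \<le> (norm (Z k) * norm (Z 0))\<^sup>2" by (rule power_mono) simp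
      then show ?thesis using q_even[of 0] by (simp add: q_even power_mult_distrib)
    qed
    \<comment> \<open>Repeated doubling bounds the power \<open>2 ^ k\<close> of
      \<open>q 2 / q 0\<close> by \<open>q (2 * 2 ^ k) / q 0\<close>, hence by a constant times the
      same power of \<open>mu\<^sup>2\<close>; \<open>power_dominated\<close> removes the
      constant.\<close>
    have "q 2 \<le> mu\<^sup>2 * q 0"
    proof (cases "q 0 = 0")
      case True
      then have "Z 0 = 0" using q_even[of 0] by simp
      then show ?thesis by (simp add: q_def)
    next
      case False
      then have q0: "q 0 > 0" using q_even[of 0] by (metis mult_0_right zero_less_power2 zero_eq_power2)
      have q2: "q 2 \<ge> 0" using q_even[of 1] by simp
      have "(q 2 / q 0) ^ (2 ^ k) \<le> q (2 * 2 ^ k) / q 0" for k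
      proof (induction k)
        case (Suc k)
        have "(q 2 / q 0) ^ (2 ^ Suc k) = ((q 2 / q 0) ^ (2 ^ k))\<^sup>2"
          by (simp add: power_mult[symmetric] mult.commute)
        also have "\<dots> \<le> (q (2 * 2 ^ k) / q 0)\<^sup>2"
          using Suc q0 q2 by (intro power_mono) auto
        also have "\<dots> \<le> q (2 * (2 * 2 ^ k)) * q 0 / (q 0)\<^sup>2"
          unfolding power_divide by (intro divide_right_mono q_sq) simp
        also have "\<dots> = q (2 * 2 ^ Suc k) / q 0" using q0 by (simp add: power2_eq_square)
        finally show ?case .
      qed simp
      moreover have "q (2 * 2 ^ k) / q 0 \<le> (K / q 0) * (mu\<^sup>2) ^ (2 ^ k)" for k
        using divide_right_mono[OF q_bound[of "2 * 2 ^ k"], of "q 0"] q0 by (simp add: power_mult)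
      ultimately have *: "(q 2 / q 0) ^ (2 ^ k) \<le> (K / q 0) * (mu\<^sup>2) ^ (2 ^ k)" for k
        using order_trans by blast
      have "q 2 / q 0 \<le> mu\<^sup>2" by (rule power_dominated[OF _ _ *]) (use q0 q2 in auto)
      then show ?thesis using q0 by (simp add: divide_le_eq)
    qed
    then have "(norm (Z 1))\<^sup>2 \<le> (mu * norm (Z 0))\<^sup>2"
      using q_even[of 1] q_even[of 0] by (simp add: power_mult_distrib)
    then have Z1: "norm (Z 1) \<le> mu * norm (Z 0)" by (rule power2_le_imp_le) (simp add: mu)
    have "(\<Sum>s\<in>F. (norm (adj y * P s * x))\<^sup>2) = Re (sform F P P (x * adj x) (y * adj y))"
      by (simp add: sform_psd)
    also have "sform F P P (x * adj x) (y * adj y) = tr (Z 1 * adj (y * adj y))"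
      by (simp add: sform_def Z_def Phi_def sum_distrib_right P)
    also have "Re \<dots> = inner (Z 1) (y * adj y)" by (simp add: inner_fmat_def)
    also have "\<dots> \<le> norm (Z 1) * norm (y * adj y)" by (rule norm_cauchy_schwarz)
    also have "\<dots> \<le> mu * norm (Z 0) * norm (y * adj y)" by (intro mult_right_mono Z1) simp
    finally show ?thesis by (simp add: Z0)
  qed
  show ?thesis unfolding oh_bound_def using sform_bound[of F n P P mu mu] P mu main by auto
qed

text \<open>A truncated Neumann series provides approximate Perron vectors for
  \<open>Z \<mapsto> \<Sum>\<^sub>s x\<^sub>s Z x\<^sub>s\<^sup>*\<close> and its adjoint.\<close>

lemma approximate_perron_vectors:
  assumes F: "finite F" and inx: "\<And>s. s \<in> F \<Longrightarrow> in_size n (x s)"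
    and L: "oh_bound F x L" "0 \<le> L" "L < mu"
  shows "\<exists>X Y c. in_size n X \<and> in_size n Y \<and> adj X = X \<and> adj Y = Y \<and> psd (X - funit n) \<and> 0 < c \<and>
    psd (Y - c *\<^sub>R funit n) \<and> psd (mu *\<^sub>R X - (\<Sum>s\<in>F. x s * Y * adj (x s))) \<and>
    psd (mu *\<^sub>R Y - (\<Sum>s\<in>F. adj (x s) * X * x s))"
proof -
  define T where "T Z = (\<Sum>s\<in>F. x s * Z * adj (x s))" for Z
  define T' where "T' Z = (\<Sum>s\<in>F. adj (x s) * Z * x s)" for Z
  have mu: "mu > 0" using L by simp
  have nT: "norm (T Z) \<le> L * norm Z" for Z unfolding T_def by (rule oh_bound_map_norm[OF L(1,2)])
  have nT': "norm (T' Z) \<le> L * norm Z" for Z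
    using oh_bound_map_norm[OF oh_bound_adj[OF L(1)] L(2)] by (simp add: T'_def)
  have lin: "T (A - B) = T A - T B" "T' (A - B) = T' A - T' B" "T (A + B) = T A + T B"
    "T (r *\<^sub>R A) = r *\<^sub>R T A" "T' (r *\<^sub>R A) = r *\<^sub>R T' A" for A B r
    by (simp_all add: T_def T'_def left_diff_distrib right_diff_distrib distrib_left distrib_right
        sum_subtractf sum.distrib scaleR_sum_right)
  have Tp: "psd (T Z)" "psd (T' Z)" if "psd Z" for Z
    unfolding T_def T'_def using psd_conj[OF that] by (auto intro!: psd_sum) (metis adj_adj)
  have Tin: "in_size n (T Z)" "in_size n (T' Z)" if "in_size n Z" for Z
    using that inx by (auto simp: T_def T'_def)
  have Tadj: "adj (T Z) = T Z" "adj (T' Z) = T' Z" if "adj Z = Z" for Z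
    using that by (simp_all add: T_def T'_def mult.assoc)
  \<comment> \<open>Partial sums of the Neumann series of
    \<open>Z \<mapsto> (1 / mu\<^sup>2) *\<^sub>R T (T' Z)\<close> at \<open>funit n\<close>. Each
    solves the fixed point equation up to the increment \<open>D k\<close>, which tends to
    0.\<close>
  define X where "X k = ((\<lambda>Z. funit n + (1 / mu\<^sup>2) *\<^sub>R T (T' Z)) ^^ k) (funit n)" for k
  have XS: "X (Suc k) = funit n + (1 / mu\<^sup>2) *\<^sub>R T (T' (X k))" and X0: "X 0 = funit n" for k
    by (simp_all add: X_def)
  have scin: "in_size n (r *\<^sub>R A)" if "in_size n A" for r A using that by (simp add: scaleR_fmat_def)
  have scadj: "adj (r *\<^sub>R A) = r *\<^sub>R adj A" for r A by (simp add: scaleR_fmat_def)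
  have X: "in_size n (X k)" "adj (X k) = X k" "psd (X k - funit n)" "psd (X k)" for k
  proof -
    have "in_size n (X k) \<and> adj (X k) = X k \<and> psd (X k - funit n) \<and> psd (X k)"
    proof (induction k)
      case (Suc k)
      then have "psd ((1 / mu\<^sup>2) *\<^sub>R T (T' (X k)))" by (intro psd_scale Tp) auto
      then show ?case using Suc by (auto simp: XS Tin Tadj scin scadj intro: psd_plus psd_funit)
    qed (auto simp: X0 psd_funit)
    then show "in_size n (X k)" "adj (X k) = X k" "psd (X k - funit n)" "psd (X k)" by auto
  qed
  define D where "D k = X (Suc k) - X k" for k
  define r where "r = (L / mu)\<^sup>2"
  have DS: "D (Suc k) = (1 / mu\<^sup>2) *\<^sub>R T (T' (D k))" for k
    by (simp add: D_def XS lin scaleR_diff_right)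
  have nTT: "norm ((1 / mu\<^sup>2) *\<^sub>R T (T' Z)) \<le> r * norm Z" for Z
  proof -
    have "norm (T (T' Z)) \<le> L * (L * norm Z)"
      using nT[of "T' Z"] nT'[of Z] L(2) mult_left_mono order_trans by blast
    then show ?thesis using mu by (simp add: r_def power_divide power2_eq_square divide_simps)
  qed
  have nD: "norm (D k) \<le> r ^ Suc k * norm (funit n)" for k
  proof (induction k)
    case 0
    show ?case using nTT[of "funit n"] by (simp add: D_def XS X0)
  next
    case (Suc k)
    have "norm (D (Suc k)) \<le> r * norm (D k)" unfolding DS by (rule nTT)
    also have "\<dots> \<le> r * (r ^ Suc k * norm (funit n))" by (intro mult_left_mono Suc) (simp add: r_def)
    finally show ?case by (simp add: mult_ac)
  qed
  have "0 \<le> r" "r < 1" using L mu by (auto simp: r_def power_less_one_iff abs_square_less_1)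
  then have "(\<lambda>k. r ^ Suc k * norm (funit n)) \<longlonglongrightarrow> 0 * norm (funit n)"
    by (intro tendsto_mult_right LIMSEQ_Suc LIMSEQ_power_zero) simp
  then have "\<forall>\<^sub>F k in sequentially. r ^ Suc k * norm (funit n) < 1 / 2"
    by (rule order_tendstoD) simp
  then obtain k where "r ^ Suc k * norm (funit n) < 1 / 2" by (auto simp: eventually_sequentially)
  then have Dk: "norm (D k) \<le> 1 / 2" using nD[of k] by linarith
  have Dle: "psd ((1 / 2) *\<^sub>R funit n - D k)"
  proof -
    have "psd (norm (D k) *\<^sub>R funit n - D k)" by (rule psd_norm_bound) (auto simp: D_def X)
    moreover have "psd ((1 / 2 - norm (D k)) *\<^sub>R funit n)" using Dk by (intro psd_scale psd_funit) simp
    ultimately show ?thesis using psd_plus by (fastforce simp: scaleR_diff_left)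
  qed
  \<comment> \<open>With this \<open>c\<close> the contribution of \<open>T (funit n)\<close> fits
    into half of \<open>mu\<close>, the other half absorbing \<open>D k\<close>. The summand 1 keeps
    \<open>E\<close> positive when \<open>L = 0\<close> or \<open>n = 0\<close>.\<close>
  define E where "E = L * norm (funit n) + 1"
  define c where "c = mu\<^sup>2 / (2 * E)"
  have den: "E > 0" using L(2) by (simp add: E_def add_nonneg_pos)
  have c: "c > 0" using mu den by (simp add: c_def)
  have cT: "psd ((mu / 2) *\<^sub>R funit n - (c / mu) *\<^sub>R T (funit n))"
  proof -
    have "psd (norm (T (funit n)) *\<^sub>R funit n - T (funit n))" by (rule psd_norm_bound) (auto simp: Tin Tadj)
    then have "psd ((c / mu) *\<^sub>R (norm (T (funit n)) *\<^sub>R funit n - T (funit n)))" using c mu by (intro psd_scale) auto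
    moreover have "psd ((mu / 2 - c / mu * norm (T (funit n))) *\<^sub>R funit n)"
    proof (intro psd_scale psd_funit)
      have "c * norm (T (funit n)) \<le> c * E"
        using nT[of "funit n"] c by (intro mult_left_mono) (auto simp: E_def)
      also have "\<dots> = mu * mu / 2" using den by (simp add: c_def power2_eq_square)
      finally show "0 \<le> mu / 2 - c / mu * norm (T (funit n))" using mu by (simp add: field_simps)
    qed
    ultimately show ?thesis
      using psd_plus by (fastforce simp: scaleR_diff_left scaleR_diff_right)
  qed
  \<comment> \<open>\<open>T' (X k)\<close> is merely positive semidefinite; the term with
    \<open>c\<close> makes \<open>Y\<close> strictly positive in the corner, so that it has an
    invertible square root.\<close>
  define Y where "Y = (1 / mu) *\<^sub>R (T' (X k) + c *\<^sub>R funit n)"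
  have Y1: "psd (Y - (c / mu) *\<^sub>R funit n)"
    using psd_scale[OF _ Tp(2)[OF X(4)[of k]], of "1 / mu"] mu by (simp add: Y_def scaleR_add_right)
  have Y2: "psd (mu *\<^sub>R Y - T' (X k))"
    using psd_scale[OF _ psd_funit, of c n] mu c by (simp add: Y_def)
  have "mu\<^sup>2 *\<^sub>R (D k + X k) = mu\<^sup>2 *\<^sub>R (funit n + (1 / mu\<^sup>2) *\<^sub>R T (T' (X k)))" by (simp add: D_def XS)
  then have TT: "T (T' (X k)) = mu\<^sup>2 *\<^sub>R (D k + X k - funit n)"
    using mu by (simp add: scaleR_add_right scaleR_diff_right)
  have "T Y = (1 / mu) *\<^sub>R T (T' (X k)) + (c / mu) *\<^sub>R T (funit n)"
    by (simp add: Y_def lin scaleR_add_right)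
  also have "(1 / mu) *\<^sub>R T (T' (X k)) = mu *\<^sub>R (D k + X k - funit n)"
    unfolding TT using mu by (simp add: power2_eq_square)
  finally have "mu *\<^sub>R X k - T Y = mu *\<^sub>R ((1 / 2) *\<^sub>R funit n - D k) + ((mu / 2) *\<^sub>R funit n - (c / mu) *\<^sub>R T (funit n))"
    using scaleR_add_left[of "mu / 2" "mu / 2" "funit n"]
    by (simp add: scaleR_diff_right scaleR_add_right)
  then have "psd (mu *\<^sub>R X k - T Y)"
    using psd_plus[OF psd_scale[OF _ Dle, of mu] cT] mu by simp
  moreover have "in_size n Y" "adj Y = Y" by (simp_all add: Y_def scin scadj Tin Tadj X)
  moreover have "c / mu > 0" using c mu by simp
  ultimately show ?thesis using X(1-3)[of k] Y1 Y2 unfolding T_def T'_def by blast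
qed

theorem oh_factorization:
  assumes F: "finite F" and inx: "\<And>s. s \<in> F \<Longrightarrow> in_size n (x s)"
    and L: "oh_bound F x L" "0 \<le> L" "L < mu"
  shows "\<exists>a b. (\<forall>s\<in>F. in_size n (a s) \<and> in_size n (b s) \<and> x s = a s * b s) \<and>
    oh_bound F (\<lambda>s. a s * adj (a s)) mu \<and> oh_bound F (\<lambda>s. adj (b s) * b s) mu"
proof -
  \<comment> \<open>Half of the gap between \<open>L\<close> and \<open>mu\<close> is used for the
    Perron vectors, the other half for regularizing the polar decompositions.\<close>
  define m where "m = (L + mu) / 2"
  have m: "L < m" "m < mu" "0 \<le> m" using L by (auto simp: m_def)
  obtain X Y c where XY: "in_size n X" "in_size n Y" "adj X = X" "adj Y = Y" "psd (X - funit n)" "0 < c"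
    "psd (Y - c *\<^sub>R funit n)" "psd (m *\<^sub>R X - (\<Sum>s\<in>F. x s * Y * adj (x s)))"
    "psd (m *\<^sub>R Y - (\<Sum>s\<in>F. adj (x s) * X * x s))"
    using approximate_perron_vectors[of F n x L m] F inx L m by blast
  have psdX: "psd X" using psd_plus[OF XY(5) psd_funit[of n]] by simp
  obtain G Gi where G: "in_size n G" "in_size n Gi" "adj G = G" "adj Gi = Gi" "G * G = X" "G * Gi = funit n" "Gi * G = funit n"
    using square_root[of n X 1] XY by auto
  obtain H Hi where H: "in_size n H" "in_size n Hi" "adj H = H" "adj Hi = Hi" "H * H = Y" "H * Hi = funit n" "Hi * H = funit n"
    using square_root[of n Y c] XY by auto
  \<comment> \<open>The \<open>card F\<close> regularization terms together must stay below
    \<open>mu - m\<close>; the added 1 avoids division by 0 for an empty family.\<close>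
  define d where "d = (mu - m) / (card F + 1)"
  have d: "d > 0" "card F * d \<le> mu - m"
    using m by (auto simp: d_def divide_simps intro: mult_right_mono)
  define z where "z s = G * x s * H" for s
  have z: "in_size n (z s)" if "s \<in> F" for s using inx[OF that] G H by (simp add: z_def)
  define pol where "pol s R S \<longleftrightarrow> in_size n R \<and> in_size n S \<and> adj R = R \<and> adj S = S \<and> R * S = funit n \<and>
    R * R * (R * R) = z s * adj (z s) + d *\<^sub>R funit n \<and>
    psd (adj (z s) * z s - adj (S * z s) * (S * z s) * (adj (S * z s) * (S * z s)))" for s R S
  have "\<exists>R S. pol s R S" if "s \<in> F" for s
    unfolding pol_def using polar_factorization[OF z[OF that] d(1)] by blast
  then obtain R S where "\<And>s. s \<in> F \<Longrightarrow> pol s (R s) (S s)" by metis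
  then have RS: "in_size n (R s)" "in_size n (S s)"
    "adj (R s) = R s" "adj (S s) = S s" "R s * S s = funit n"
    "R s * R s * (R s * R s) = z s * adj (z s) + d *\<^sub>R funit n"
    "psd (adj (z s) * z s - adj (S s * z s) * (S s * z s) * (adj (S s * z s) * (S s * z s)))"
    if "s \<in> F" for s using that unfolding pol_def by blast+
  define a where "a s = Gi * R s" for s
  define b where "b s = S s * z s * Hi" for s
  define P where "P s = a s * adj (a s)" for s
  define Q where "Q s = adj (b s) * b s" for s
  have GX: "Gi * X = G" "X * Gi = G"
    using G by (metis funit_left funit_right mult.assoc)+
  have HY: "Hi * Y = H" "Y * Hi = H"
    using H by (metis funit_left funit_right mult.assoc)+
  have 1: "in_size n (a s) \<and> in_size n (b s) \<and> x s = a s * b s" if s: "s \<in> F" for s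
  proof -
    have "a s * b s = Gi * (R s * S s) * G * x s * (H * Hi)" by (simp add: a_def b_def z_def mult.assoc)
    also have "\<dots> = x s" using RS(5)[OF s] G H inx[OF s] by (simp add: flip: mult.assoc)
    finally show ?thesis using RS[OF s] G H z[OF s] by (auto simp: a_def b_def)
  qed
  \<comment> \<open>\<open>P s\<close> is the square of \<open>R s\<close> conjugated by
    \<open>Gi\<close>, and \<open>Gi * X * Gi\<close> is the corner unit. So the fourth power of
    \<open>R s\<close> appears and brings back \<open>z s * adj (z s)\<close>, with the
    regularization as error term.\<close>
  have PXP: "P s * X * P s = x s * Y * adj (x s) + d *\<^sub>R (Gi * Gi)" if s: "s \<in> F" for s
  proof -
    have "P s * X * P s = Gi * R s * R s * (Gi * X * Gi) * R s * R s * Gi"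
      using G RS(3)[OF s] by (simp add: P_def a_def mult.assoc)
    also have "Gi * X * Gi = funit n" by (simp add: GX G)
    also have "Gi * R s * R s * funit n * R s * R s * Gi = Gi * (R s * R s * (R s * R s)) * Gi"
      using G RS(1)[OF s] by (simp add: mult.assoc)
    also have "R s * R s * (R s * R s) = z s * adj (z s) + d *\<^sub>R funit n" by (rule RS(6)[OF s])
    also have "Gi * (z s * adj (z s) + d *\<^sub>R funit n) * Gi = (Gi * G) * x s * (H * H) * adj (x s) * (G * Gi) + d *\<^sub>R (Gi * Gi)"
      using G(2) by (simp add: z_def G(3) H(3) distrib_left distrib_right mult.assoc)
    also have "(Gi * G) * x s * (H * H) * adj (x s) * (G * Gi) = x s * Y * adj (x s)"
      unfolding G(6,7) H(5) using inx[OF s] XY by simp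
    finally show ?thesis .
  qed
  have adjP: "adj (P s) = P s" "adj (Q s) = Q s" for s by (simp_all add: P_def Q_def)
  have inP: "in_size n (P s)" "in_size n (Q s)" if "s \<in> F" for s using 1[OF that] by (auto simp: P_def Q_def)
  have "psd (mu *\<^sub>R X - (\<Sum>s\<in>F. P s * X * P s))"
  proof -
    \<comment> \<open>Conjugating \<open>funit n \<le> X\<close> by \<open>Gi\<close> gives
      \<open>Gi * Gi \<le> funit n \<le> X\<close>, so the error terms are absorbed into a multiple
      of \<open>X\<close>. The normalization of the Perron vector enters here.\<close>
    have "Gi * (X - funit n) * adj Gi = funit n - Gi * Gi"
      using G by (simp add: left_diff_distrib right_diff_distrib GX)
    then have "psd (funit n - Gi * Gi)" using psd_conj[OF XY(5), of Gi] by simp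
    then have "psd (X - Gi * Gi)" using XY(5) by (rule psd_diff_trans)
    then have p1: "psd ((card F * d) *\<^sub>R (X - Gi * Gi))" using d by (intro psd_scale) auto
    have p2: "psd ((mu - m - card F * d) *\<^sub>R X)" using d psdX by (intro psd_scale) auto
    have "(\<Sum>s\<in>F. P s * X * P s) = (\<Sum>s\<in>F. x s * Y * adj (x s)) + (card F * d) *\<^sub>R (Gi * Gi)"
      by (simp add: PXP sum.distrib sum_constant_scaleR)
    then have "mu *\<^sub>R X - (\<Sum>s\<in>F. P s * X * P s) =
      (m *\<^sub>R X - (\<Sum>s\<in>F. x s * Y * adj (x s))) + (card F * d) *\<^sub>R (X - Gi * Gi) + (mu - m - card F * d) *\<^sub>R X"
      by (simp add: scaleR_diff_right scaleR_diff_left)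
    then show ?thesis using psd_plus[OF psd_plus[OF XY(8) p1] p2] by simp
  qed
  then have 2: "oh_bound F P mu"
    using oh_bound_supersolution[OF F inP(1) adjP(1), where mu = mu and c = 1 and X = X] XY(5) m by simp
  \<comment> \<open>On this side there is no error term, because the inequality for the second polar
    factor is free of \<open>d\<close>.\<close>
  have QYQ: "psd (adj (x s) * X * x s - Q s * Y * Q s)" if s: "s \<in> F" for s
  proof -
    define V where "V = adj (S s * z s) * (S s * z s)"
    have Q: "Q s = Hi * V * Hi" using H by (simp add: Q_def b_def V_def mult.assoc)
    have inV: "in_size n V" using RS(2)[OF s] z[OF s] by (simp add: V_def)
    have "Q s * Y * Q s = Hi * V * (Hi * Y * Hi) * V * Hi" by (simp add: Q mult.assoc)
    also have "\<dots> = Hi * (V * V) * Hi" using inV H by (simp add: HY mult.assoc)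
    finally have e1: "Q s * Y * Q s = Hi * (V * V) * Hi" .
    have "adj (x s) * X * x s = Hi * (adj (z s) * z s) * Hi"
    proof -
      have "Hi * (adj (z s) * z s) * Hi = (Hi * H) * adj (x s) * (G * G) * x s * (H * Hi)"
        by (simp add: z_def G(3) H(3) mult.assoc)
      then show ?thesis unfolding G(5) H(6,7) using inx[OF s] XY by simp
    qed
    then have "adj (x s) * X * x s - Q s * Y * Q s = Hi * (adj (z s) * z s - V * V) * adj Hi"
      using e1 H by (simp add: left_diff_distrib right_diff_distrib)
    then show ?thesis using psd_conj[OF RS(7)[OF s], of Hi] by (simp add: V_def)
  qed
  have "psd (mu *\<^sub>R Y - (\<Sum>s\<in>F. Q s * Y * Q s))"
  proof -
    have "psd ((\<Sum>s\<in>F. adj (x s) * X * x s) - (\<Sum>s\<in>F. Q s * Y * Q s))"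
      unfolding sum_subtractf[symmetric] by (intro psd_sum QYQ)
    then have *: "psd (m *\<^sub>R Y - (\<Sum>s\<in>F. Q s * Y * Q s))" using XY(9) by (rule psd_diff_trans)
    have "psd Y" using psd_plus[OF XY(7) psd_scale[OF _ psd_funit[of n], of c]] XY(6) by simp
    then have "psd ((mu - m) *\<^sub>R Y)" using m by (intro psd_scale) auto
    then show ?thesis using psd_plus[OF *] by (fastforce simp: scaleR_diff_left)
  qed
  then have 3: "oh_bound F Q mu"
    using oh_bound_supersolution[OF F inP(2) adjP(2), where mu = mu and c = c and X = Y] XY(6,7) m by simp
  show ?thesis using 1 2 3 unfolding P_def Q_def by blast
qed

text \<open>Placing the \<open>s\<close>-th matrix in its own block of columns turns the norm of the family
  \<open>a\<^sub>s a\<^sub>s\<^sup>*\<close> into the square of the norm of a single row.\<close>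

lemma oh_bound_block_row:
  assumes F: "finite F" and p: "0 \<le> p" "oh_bound F (\<lambda>s. a s * adj (a s)) p"
    and J: "\<And>s t. s \<in> F \<Longrightarrow> t \<in> F \<Longrightarrow> adj (J s) * J s * (adj (J t) * J t) = (if s = t then adj (J s) * J s else 0)"
  shows "oh_bound F (\<lambda>s. a s * J s) (sqrt p)"
  unfolding oh_bound_def
proof (intro allI)
  fix Z W
  define y where "y s = J s * Z * adj (J s)" for s
  define w where "w s = adj (a s) * adj W * a s" for s
  have Jc: "norm (X * adj (J s)) \<le> norm X" if "s \<in> F" for X s
    using contraction_right[of "J s"] J[OF that that] by simp
  \<comment> \<open>The block inclusions move to \<open>Z\<close> and the matrices
    \<open>a s\<close> to \<open>W\<close>. This leaves compressions of \<open>Z\<close> to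
    orthogonal blocks, controlled by \<open>bessel\<close>, and the \<open>w s\<close>, whose
    squared norms add up to the form of the family \<open>a s * adj (a s)\<close>.\<close>
  have t: "tr (a s * J s * Z * adj (a s * J s) * adj W) = tr (y s * w s)" for s
    using tr_commute[of "a s" "J s * Z * adj (J s) * adj (a s) * adj W"]
    by (simp add: y_def w_def mult.assoc)
  have y: "(\<Sum>s\<in>F. (norm (y s))\<^sup>2) \<le> (norm Z)\<^sup>2"
  proof -
    have "(\<Sum>s\<in>F. (norm (y s))\<^sup>2) \<le> (\<Sum>s\<in>F. (norm (J s * Z))\<^sup>2)"
      unfolding y_def by (intro sum_mono power_mono Jc) auto
    also have "\<dots> \<le> (norm Z)\<^sup>2" by (rule bessel[OF F J])
    finally show ?thesis .
  qed
  have w: "(\<Sum>s\<in>F. (norm (w s))\<^sup>2) \<le> p * (norm W)\<^sup>2"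
  proof -
    have "of_real ((norm (w s))\<^sup>2) = tr (a s * adj (a s) * adj W * adj (a s * adj (a s)) * adj (adj W))" for s
      using tr_commute[of "adj (a s) * adj W * a s * adj (a s) * W" "a s"]
      unfolding tr_gram[symmetric] w_def by (simp add: mult.assoc)
    then have "of_real (\<Sum>s\<in>F. (norm (w s))\<^sup>2) = sform F (\<lambda>s. a s * adj (a s)) (\<lambda>s. a s * adj (a s)) (adj W) (adj W)"
      unfolding sform_def of_real_sum by (intro sum.cong) auto
    then have "cmod (of_real (\<Sum>s\<in>F. (norm (w s))\<^sup>2)) \<le> p * norm W * norm W"
      using oh_boundD[OF p(2), of "adj W" "adj W"] by simp
    then show ?thesis unfolding norm_of_real by (simp add: power2_eq_square mult.assoc)
  qed
  have "cmod (sform F (\<lambda>s. a s * J s) (\<lambda>s. a s * J s) Z W) \<le> (\<Sum>s\<in>F. norm (y s) * norm (w s))"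
    unfolding sform_def t by (intro sum_norm_le tr_cauchy_schwarz)
  then have "(cmod (sform F (\<lambda>s. a s * J s) (\<lambda>s. a s * J s) Z W))\<^sup>2 \<le> (\<Sum>s\<in>F. norm (y s) * norm (w s))\<^sup>2"
    by (rule power_mono) simp
  also have "\<dots> \<le> (\<Sum>s\<in>F. (norm (y s))\<^sup>2) * (\<Sum>s\<in>F. (norm (w s))\<^sup>2)" by (rule Cauchy_Schwarz_ineq_sum)
  also have "\<dots> \<le> (norm Z)\<^sup>2 * (p * (norm W)\<^sup>2)" by (intro mult_mono y w) (auto intro: sum_nonneg)
  also have "\<dots> = (sqrt p * norm Z * norm W)\<^sup>2" using p by (simp add: power_mult_distrib)
  finally show "cmod (sform F (\<lambda>s. a s * J s) (\<lambda>s. a s * J s) Z W) \<le> sqrt p * norm Z * norm W"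
    by (rule power2_le_imp_le) (simp add: p)
qed

subsection \<open>The operator norm of scalar matrices\<close>

lemma oh_boundI_psd_in_size:
  assumes "\<And>s. s \<in> F \<Longrightarrow> in_size n (a s)" "0 \<le> L"
    "\<And>x y. in_size n x \<Longrightarrow> in_size n y \<Longrightarrow> (\<Sum>s\<in>F. (norm (adj y * a s * x))\<^sup>2) \<le> L * norm (x * adj x) * norm (y * adj y)"
  shows "oh_bound F a L"
  unfolding oh_bound_def using sform_bound[of F n a a L L] assms by auto

lemma cmod_sum_mult_le:
  "cmod (\<Sum>i\<in>S. f i * g i) \<le> sqrt (\<Sum>i\<in>S. (cmod (f i))\<^sup>2) * sqrt (\<Sum>i\<in>S. (cmod (g i))\<^sup>2)"
proof -
  have "cmod (\<Sum>i\<in>S. f i * g i) \<le> (\<Sum>i\<in>S. cmod (f i) * cmod (g i))"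
    by (rule sum_norm_le) (simp add: norm_mult)
  moreover have "(\<Sum>i\<in>S. cmod (f i) * cmod (g i))\<^sup>2 \<le> (\<Sum>i\<in>S. (cmod (f i))\<^sup>2) * (\<Sum>i\<in>S. (cmod (g i))\<^sup>2)"
    by (rule Cauchy_Schwarz_ineq_sum)
  then have "(\<Sum>i\<in>S. cmod (f i) * cmod (g i)) \<le> sqrt (\<Sum>i\<in>S. (cmod (f i))\<^sup>2) * sqrt (\<Sum>i\<in>S. (cmod (g i))\<^sup>2)"
    unfolding real_sqrt_mult[symmetric] by (rule real_le_rsqrt)
  ultimately show ?thesis by linarith
qed

lemma vec_l2norm_nonneg [simp]: "0 \<le> vec_l2norm v"
  by (simp add: vec_l2norm_def sum_nonneg)

lemma vec_l2norm_sq: "(vec_l2norm v)\<^sup>2 = (\<Sum>i<dim_vec v. (cmod (vec_index v i))\<^sup>2)"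
  by (simp add: vec_l2norm_def sum_nonneg)

lemma vec_l2norm_smult: "vec_l2norm (c \<cdot>\<^sub>v v) = cmod c * vec_l2norm v"
proof -
  have "(\<Sum>i<dim_vec v. (cmod (c * vec_index v i))\<^sup>2) = (cmod c)\<^sup>2 * (\<Sum>i<dim_vec v. (cmod (vec_index v i))\<^sup>2)"
    by (simp add: norm_mult power_mult_distrib sum_distrib_left)
  then show ?thesis by (simp add: vec_l2norm_def real_sqrt_mult)
qed

lemma mult_mat_vec_index:
  assumes "i < dim_row A" "v \<in> carrier_vec (dim_col A)"
  shows "vec_index (A *\<^sub>v v) i = (\<Sum>j<dim_col A. A $$ (i, j) * vec_index v j)"
  using assms by (simp add: scalar_prod_def atLeast0LessThan)

text \<open>Cauchy-Schwarz gives the Frobenius norm as a constant. This shows that the supremum in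
  \<open>mat_opnorm\<close> is taken over a bounded set.\<close>

lemma mult_mat_vec_l2norm_bounded:
  "\<exists>K. \<forall>v\<in>carrier_vec (dim_col A). vec_l2norm (A *\<^sub>v v) \<le> K * vec_l2norm v"
proof (intro exI ballI)
  fix v :: "complex vec" assume v: "v \<in> carrier_vec (dim_col A)"
  define K where "K = sqrt (\<Sum>i<dim_row A. \<Sum>j<dim_col A. (cmod (A $$ (i, j)))\<^sup>2)"
  have "(vec_l2norm (A *\<^sub>v v))\<^sup>2 = (\<Sum>i<dim_row A. (cmod (\<Sum>j<dim_col A. A $$ (i, j) * vec_index v j))\<^sup>2)"
    using v by (auto simp: vec_l2norm_sq mult_mat_vec_index simp del: index_mult_mat_vec intro!: sum.cong)
  also have "\<dots> \<le> (\<Sum>i<dim_row A. (sqrt (\<Sum>j<dim_col A. (cmod (A $$ (i, j)))\<^sup>2) * sqrt (\<Sum>j<dim_col A. (cmod (vec_index v j))\<^sup>2))\<^sup>2)"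
    by (intro sum_mono power_mono cmod_sum_mult_le) simp
  also have "\<dots> = (K * vec_l2norm v)\<^sup>2"
    using v by (simp add: K_def power_mult_distrib sum_nonneg vec_l2norm_sq sum_distrib_right)
  finally show "vec_l2norm (A *\<^sub>v v) \<le> K * vec_l2norm v"
    by (rule power2_le_imp_le) (simp add: K_def sum_nonneg)
qed

lemma vec_l2norm_zero: "vec_l2norm (0\<^sub>v n) = 0"
  by (simp add: vec_l2norm_def)

lemma mat_opnorm_bdd:
  "bdd_above {vec_l2norm (A *\<^sub>v v) | v. v \<in> carrier_vec (dim_col A) \<and> vec_l2norm v \<le> 1}"
proof -
  obtain K where K: "\<forall>v\<in>carrier_vec (dim_col A). vec_l2norm (A *\<^sub>v v) \<le> K * vec_l2norm v"
    using mult_mat_vec_l2norm_bounded by blast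
  have "vec_l2norm (A *\<^sub>v v) \<le> \<bar>K\<bar>" if "v \<in> carrier_vec (dim_col A)" "vec_l2norm v \<le> 1" for v
  proof -
    have "vec_l2norm (A *\<^sub>v v) \<le> K * vec_l2norm v" using K that by blast
    also have "\<dots> \<le> \<bar>K\<bar> * vec_l2norm v" by (intro mult_right_mono) auto
    also have "\<dots> \<le> \<bar>K\<bar>" using that by (simp add: mult_left_le)
    finally show ?thesis .
  qed
  then show ?thesis by (auto intro!: bdd_aboveI[of _ "\<bar>K\<bar>"])
qed

lemma mat_opnorm_nonneg [simp]: "0 \<le> mat_opnorm A"
proof -
  have "vec_l2norm (A *\<^sub>v 0\<^sub>v (dim_col A)) \<le> mat_opnorm A"
    unfolding mat_opnorm_def
    by (rule cSup_upper[OF _ mat_opnorm_bdd]) (auto intro!: exI[of _ "0\<^sub>v (dim_col A)"] simp: vec_l2norm_zero)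
  then show ?thesis using vec_l2norm_nonneg order_trans by blast
qed

lemma mat_opnorm_bound:
  assumes "v \<in> carrier_vec (dim_col A)"
  shows "vec_l2norm (A *\<^sub>v v) \<le> mat_opnorm A * vec_l2norm v"
proof (cases "vec_l2norm v = 0")
  case True
  obtain K where "\<forall>v\<in>carrier_vec (dim_col A). vec_l2norm (A *\<^sub>v v) \<le> K * vec_l2norm v"
    using mult_mat_vec_l2norm_bounded by blast
  then have "vec_l2norm (A *\<^sub>v v) \<le> K * vec_l2norm v" using assms by blast
  then show ?thesis using True by simp
next
  case False
  then have p: "vec_l2norm v > 0" using vec_l2norm_nonneg[of v] by linarith
  define u where "u = complex_of_real (1 / vec_l2norm v) \<cdot>\<^sub>v v"
  have u: "u \<in> carrier_vec (dim_col A)" "vec_l2norm u = 1"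
    using assms p unfolding u_def vec_l2norm_smult by (simp_all add: norm_divide)
  have "vec_l2norm (A *\<^sub>v u) \<le> mat_opnorm A"
    unfolding mat_opnorm_def
    by (rule cSup_upper[OF _ mat_opnorm_bdd]) (use u in auto)
  moreover have "A *\<^sub>v u = complex_of_real (1 / vec_l2norm v) \<cdot>\<^sub>v (A *\<^sub>v v)"
    unfolding u_def using assms by (intro mult_mat_vec) auto
  then have "vec_l2norm (A *\<^sub>v u) = 1 / vec_l2norm v * vec_l2norm (A *\<^sub>v v)"
    using p by (simp only: vec_l2norm_smult norm_of_real) simp
  ultimately show ?thesis using p by (simp add: divide_le_eq)
qed

lemma mat_opnorm_le:
  assumes "0 \<le> C" "\<And>v. v \<in> carrier_vec (dim_col A) \<Longrightarrow> vec_l2norm (A *\<^sub>v v) \<le> C * vec_l2norm v"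
  shows "mat_opnorm A \<le> C"
  unfolding mat_opnorm_def
proof (rule cSup_least)
  show "{vec_l2norm (A *\<^sub>v v) | v. v \<in> carrier_vec (dim_col A) \<and> vec_l2norm v \<le> 1} \<noteq> {}"
    by (auto intro!: exI[of _ "0\<^sub>v (dim_col A)"] simp: vec_l2norm_zero)
  fix r assume "r \<in> {vec_l2norm (A *\<^sub>v v) | v. v \<in> carrier_vec (dim_col A) \<and> vec_l2norm v \<le> 1}"
  then obtain v where "v \<in> carrier_vec (dim_col A)" "vec_l2norm v \<le> 1" "r = vec_l2norm (A *\<^sub>v v)" by blast
  then show "r \<le> C" using assms(2)[of v] mult_left_le[of "vec_l2norm v" C] assms(1) by linarith
qed

lemma mat_opnorm_scaled:
  assumes "dim_row B = dim_row A" "dim_col B = dim_col A"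
    "\<And>i j. i < dim_row A \<Longrightarrow> j < dim_col A \<Longrightarrow> B $$ (i, j) = c * A $$ (i, j)"
  shows "mat_opnorm B \<le> cmod c * mat_opnorm A"
proof (rule mat_opnorm_le)
  fix v :: "complex vec" assume v: "v \<in> carrier_vec (dim_col B)"
  have "B *\<^sub>v v = c \<cdot>\<^sub>v (A *\<^sub>v v)"
    by (rule eq_vecI) (use assms v in \<open>auto simp: scalar_prod_def sum_distrib_left mult.assoc intro!: sum.cong\<close>)
  then show "vec_l2norm (B *\<^sub>v v) \<le> cmod c * mat_opnorm A * vec_l2norm v"
    using mat_opnorm_bound[of v A] v assms by (simp add: vec_l2norm_smult mult.assoc mult_left_mono)
qed simp

text \<open>The operator norm is lower semicontinuous for entrywise convergence. An arbitrary filter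
  is allowed because the lemma is applied both to Cauchy sequences and to the net of finite subsets
  of \<open>I\<close>.\<close>

lemma mat_opnorm_limit:
  assumes nb: "F \<noteq> bot" and dims: "\<And>a. dim_row (B a) = dim_row A" "\<And>a. dim_col (B a) = dim_col A"
    and lim: "\<And>i j. i < dim_row A \<Longrightarrow> j < dim_col A \<Longrightarrow> ((\<lambda>a. B a $$ (i, j)) \<longlongrightarrow> A $$ (i, j)) F"
    and le: "eventually (\<lambda>a. mat_opnorm (B a) \<le> z) F"
  shows "mat_opnorm A \<le> z"
proof (rule mat_opnorm_le)
  have "eventually (\<lambda>a. 0 \<le> z) F" using le by eventually_elim (meson mat_opnorm_nonneg order_trans)
  then show z: "0 \<le> z" using nb by (simp add: eventually_const_iff)
  fix v :: "complex vec" assume v: "v \<in> carrier_vec (dim_col A)"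
  have n: "vec_l2norm (A *\<^sub>v v) = sqrt (\<Sum>i<dim_row A. (cmod (\<Sum>j<dim_col A. A $$ (i, j) * vec_index v j))\<^sup>2)"
    "vec_l2norm (B a *\<^sub>v v) = sqrt (\<Sum>i<dim_row A. (cmod (\<Sum>j<dim_col A. B a $$ (i, j) * vec_index v j))\<^sup>2)" for a
    using v dims by (auto simp: vec_l2norm_def mult_mat_vec_index simp del: index_mult_mat_vec intro!: sum.cong)
  have "((\<lambda>a. vec_l2norm (B a *\<^sub>v v)) \<longlongrightarrow> vec_l2norm (A *\<^sub>v v)) F"
    unfolding n by (intro tendsto_intros lim) auto
  moreover have "eventually (\<lambda>a. vec_l2norm (B a *\<^sub>v v) \<le> z * vec_l2norm v) F"
    using le
  proof eventually_elim
    case (elim a)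
    have "vec_l2norm (B a *\<^sub>v v) \<le> mat_opnorm (B a) * vec_l2norm v"
      using v dims by (intro mat_opnorm_bound) simp
    also have "\<dots> \<le> z * vec_l2norm v" by (intro mult_right_mono elim) simp
    finally show ?case .
  qed
  ultimately show "vec_l2norm (A *\<^sub>v v) \<le> z * vec_l2norm v" by (rule tendsto_upperbound[OF _ _ nb])
qed

subsection \<open>The norm of \<open>OH\<close> through finite families\<close>

lemma OH_simps:
  "carrier (OH I) = {f. (\<lambda>i. (cmod (f i))\<^sup>2) summable_on I \<and> (\<forall>i. i \<notin> I \<longrightarrow> f i = 0)}"
  "\<zero>\<^bsub>OH I\<^esub> = (\<lambda>_. 0)" "f \<oplus>\<^bsub>OH I\<^esub> g = (\<lambda>i. f i + g i)" "c \<odot>\<^bsub>OH I\<^esub> f = (\<lambda>i. c * f i)"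
  "f \<otimes>\<^bsub>OH I\<^esub> g = (\<lambda>i. f i * g i)"
  "mnorm (OH I) = (\<lambda>x. sqrt (mat_opnorm (mat_pairing (\<lambda>f g. \<Sum>\<^sub>\<infinity>i\<in>I. f i * cnj (g i)) x x)))"
  by (simp_all add: OH_def)

text \<open>The coefficient of the \<open>s\<close>-th basis vector in a matrix over
  \<open>OH\<close>. Rectangular matrices need no separate treatment, since padding with zeros is
  invisible in \<open>fmat\<close>.\<close>

definition coord :: "('i \<Rightarrow> complex) mat \<Rightarrow> 'i \<Rightarrow> fmat" where
  "coord x s = fmat_of (max (dim_row x) (dim_col x)) (\<lambda>i j. if i < dim_row x \<and> j < dim_col x then (x $$ (i, j)) s else 0)"

lemma entry_coord [simp]:
  "entry (coord x s) i j = (if i < dim_row x \<and> j < dim_col x then (x $$ (i, j)) s else 0)"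
  by (auto simp: coord_def)

lemma matrices_D:
  assumes "x \<in> matrices V m n"
  shows "dim_row x = m" "dim_col x = n" "i < m \<Longrightarrow> j < n \<Longrightarrow> x $$ (i, j) \<in> carrier V"
  using assms by (auto simp: matrices_def intro: elements_matI)

lemma matrices_I:
  assumes "dim_row x = m" "dim_col x = n" "\<And>i j. i < m \<Longrightarrow> j < n \<Longrightarrow> x $$ (i, j) \<in> carrier V"
  shows "x \<in> matrices V m n"
  using assms by (auto simp: matrices_def elements_mat_def)

lemma in_size_coord [simp]: "x \<in> matrices V n n \<Longrightarrow> in_size n (coord x s)"
  by (auto simp: in_size_def matrices_D)

lemma ell2_mult_summable:
  fixes f g :: "'i \<Rightarrow> complex"
  assumes "(\<lambda>i. (cmod (f i))\<^sup>2) summable_on I" "(\<lambda>i. (cmod (g i))\<^sup>2) summable_on I"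
  shows "(\<lambda>i. f i * g i) abs_summable_on I"
proof (rule abs_summable_on_comparison_test')
  show "(\<lambda>i. (cmod (f i))\<^sup>2 + (cmod (g i))\<^sup>2) summable_on I" using assms by (rule summable_on_add)
  fix i
  have "0 \<le> (cmod (f i) - cmod (g i))\<^sup>2" by simp
  moreover have "0 \<le> cmod (f i) * cmod (g i)" by simp
  ultimately show "norm (f i * g i) \<le> (cmod (f i))\<^sup>2 + (cmod (g i))\<^sup>2"
    unfolding power2_diff norm_mult by linarith
qed

lemma sum_div_mod:
  fixes f :: "nat \<Rightarrow> nat \<Rightarrow> 'a :: comm_monoid_add"
  shows "(\<Sum>r<m * n. f (r div n) (r mod n)) = (\<Sum>i<m. \<Sum>k<n. f i k)"
proof -
  have "(\<Sum>i<m. \<Sum>k<n. f i k) = (\<Sum>(i, k)\<in>{..<m} \<times> {..<n}. f i k)"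
    by (rule sum.cartesian_product)
  also have "\<dots> = (\<Sum>r<m * n. f (r div n) (r mod n))"
  proof (rule sum.reindex_bij_witness[where i = "\<lambda>r. (r div n, r mod n)" and j = "\<lambda>(i, k). i * n + k"])
    fix p assume "p \<in> {..<m} \<times> {..<n}"
    then obtain i k where p: "p = (i, k)" "i < m" "k < n" by auto
    then have "i * n + k < Suc i * n" by simp
    also have "Suc i * n \<le> m * n" using p by (intro mult_right_mono) auto
    finally show "(case p of (i, k) \<Rightarrow> i * n + k) \<in> {..<m * n}" using p by simp
  next
    fix r assume "r \<in> {..<m * n}"
    then have r: "r < m * n" by simp
    then have "n > 0" by (cases n) auto
    with r show "(r div n, r mod n) \<in> {..<m} \<times> {..<n}" by (simp add: less_mult_imp_div_less)
  qed auto
  finally show ?thesis by simp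
qed

text \<open>The sesquilinear form of the matrix inside the definition of the \<open>OH\<close> norm,
  with vectors of length \<open>n * n\<close> arranged as \<open>n\<close> by \<open>n\<close>
  matrices.\<close>

definition OHform :: "'i set \<Rightarrow> nat \<Rightarrow> ('i \<Rightarrow> complex) mat \<Rightarrow> fmat \<Rightarrow> fmat \<Rightarrow> complex" where
  "OHform I n x Z W = (\<Sum>i<n. \<Sum>k<n. \<Sum>j<n. \<Sum>l<n.
     cnj (entry W i k) * ((\<Sum>\<^sub>\<infinity>s\<in>I. (x $$ (i, j)) s * cnj ((x $$ (k, l)) s)) * entry Z j l))"

text \<open>Over a finite index set the inner sums are finite and can be taken outside, which leaves
  the trace form of the coordinate matrices.\<close>

lemma sform_eq_OHform:
  assumes x: "x \<in> matrices V n n" and ZW: "in_size n Z" "in_size n W" and A: "finite A"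
  shows "sform A (coord x) (coord x) Z W = OHform A n x Z W"
proof -
  have "tr (coord x s * Z * adj (coord x s) * adj W) = (\<Sum>i<n. \<Sum>k<n. \<Sum>j<n. \<Sum>l<n.
     cnj (entry W i k) * ((x $$ (i, j)) s * cnj ((x $$ (k, l)) s) * entry Z j l))" for s
  proof -
    have i: "in_size n (coord x s)" using x by simp
    have "tr (coord x s * Z * adj (coord x s) * adj W) = (\<Sum>i<n. \<Sum>k<n. entry (coord x s * Z * adj (coord x s)) i k * cnj (entry W i k))"
      using ZW i by (subst tr_times_eq[of n]) auto
    also have "\<dots> = (\<Sum>i<n. \<Sum>k<n. \<Sum>j<n. \<Sum>l<n.
     cnj (entry W i k) * ((x $$ (i, j)) s * cnj ((x $$ (k, l)) s) * entry Z j l))"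
    proof (intro sum.cong refl)
      fix i' k assume ik: "i' \<in> {..<n}" "k \<in> {..<n}"
      have "entry (coord x s * Z * adj (coord x s)) i' k = (\<Sum>l<n. (\<Sum>j<n. entry (coord x s) i' j * entry Z j l) * cnj (entry (coord x s) k l))"
        using ZW i by (simp add: entry_times[of n] del: entry_coord)
      also have "\<dots> = (\<Sum>l<n. \<Sum>j<n. (x $$ (i', j)) s * cnj ((x $$ (k, l)) s) * entry Z j l)"
        using ik matrices_D(1,2)[OF x] by (simp add: sum_distrib_right sum_distrib_left mult_ac)
      also have "\<dots> = (\<Sum>j<n. \<Sum>l<n. (x $$ (i', j)) s * cnj ((x $$ (k, l)) s) * entry Z j l)"
        by (rule sum.swap)
      finally show "entry (coord x s * Z * adj (coord x s)) i' k * cnj (entry W i' k) = (\<Sum>j<n. \<Sum>l<n.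
          cnj (entry W i' k) * ((x $$ (i', j)) s * cnj ((x $$ (k, l)) s) * entry Z j l))"
        by (simp add: sum_distrib_right sum_distrib_left mult_ac)
    qed
    finally show ?thesis .
  qed
  then have "sform A (coord x) (coord x) Z W = (\<Sum>s\<in>A. \<Sum>i<n. \<Sum>k<n. \<Sum>j<n. \<Sum>l<n.
     cnj (entry W i k) * ((x $$ (i, j)) s * cnj ((x $$ (k, l)) s) * entry Z j l))"
    by (simp add: sform_def)
  also have "\<dots> = OHform A n x Z W"
    unfolding OHform_def using A
    by (simp add: sum_distrib_left sum_distrib_right sum.swap[of _ "{..<n}" A])
  finally show ?thesis .
qed

lemma OHform_tendsto:
  assumes x: "x \<in> matrices (OH I) n n"
  shows "((\<lambda>A. OHform A n x Z W) \<longlongrightarrow> OHform I n x Z W) (finite_subsets_at_top I)"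
  unfolding OHform_def
proof (intro tendsto_sum tendsto_mult tendsto_const)
  fix i k j l assume *: "i \<in> {..<n}" "k \<in> {..<n}" "j \<in> {..<n}" "l \<in> {..<n}"
  have "(\<lambda>s. (x $$ (i, j)) s * cnj ((x $$ (k, l)) s)) summable_on I"
    by (rule abs_summable_summable, rule ell2_mult_summable)
      (use matrices_D(3)[OF x] * in \<open>auto simp: OH_simps\<close>)
  then have "((\<lambda>A. \<Sum>s\<in>A. (x $$ (i, j)) s * cnj ((x $$ (k, l)) s)) \<longlongrightarrow>
      (\<Sum>\<^sub>\<infinity>s\<in>I. (x $$ (i, j)) s * cnj ((x $$ (k, l)) s))) (finite_subsets_at_top I)"
    by (rule infsum_tendsto)
  moreover have "eventually (\<lambda>A. (\<Sum>s\<in>A. (x $$ (i, j)) s * cnj ((x $$ (k, l)) s)) =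
      (\<Sum>\<^sub>\<infinity>s\<in>A. (x $$ (i, j)) s * cnj ((x $$ (k, l)) s))) (finite_subsets_at_top I)"
    by (intro eventually_finite_subsets_at_top_weakI) simp
  ultimately show "((\<lambda>A. \<Sum>\<^sub>\<infinity>s\<in>A. (x $$ (i, j)) s * cnj ((x $$ (k, l)) s)) \<longlongrightarrow>
      (\<Sum>\<^sub>\<infinity>s\<in>I. (x $$ (i, j)) s * cnj ((x $$ (k, l)) s))) (finite_subsets_at_top I)"
    by (rule Lim_transform_eventually)
qed

abbreviation OHmat :: "'i set \<Rightarrow> ('i \<Rightarrow> complex) mat \<Rightarrow> complex mat" where
  "OHmat I x \<equiv> mat_pairing (\<lambda>f g. \<Sum>\<^sub>\<infinity>i\<in>I. f i * cnj (g i)) x x"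

definition fmat_of_vec :: "nat \<Rightarrow> complex vec \<Rightarrow> fmat" where
  "fmat_of_vec n v = fmat_of n (\<lambda>i k. vec_index v (i * n + k))"

lemma norm_fmat_of_vec:
  assumes "v \<in> carrier_vec (n * n)" shows "norm (fmat_of_vec n v) = vec_l2norm v"
proof -
  have "(norm (fmat_of_vec n v))\<^sup>2 = (\<Sum>i<n. \<Sum>k<n. (cmod (vec_index v (i * n + k)))\<^sup>2)"
    by (subst norm_sq_eq[of n]) (auto simp: fmat_of_vec_def)
  also have "\<dots> = (\<Sum>r<n * n. (cmod (vec_index v (r div n * n + r mod n)))\<^sup>2)"
    by (rule sum_div_mod[symmetric])
  also have "\<dots> = (vec_l2norm v)\<^sup>2" using assms by (simp add: vec_l2norm_sq)
  finally show ?thesis by (simp add: power2_eq_iff_nonneg)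
qed

lemma OHmat_sform:
  assumes x: "x \<in> matrices (OH I) n n" and v: "v \<in> carrier_vec (n * n)"
  shows "(\<Sum>r<n * n. cnj (vec_index w r) * vec_index (OHmat I x *\<^sub>v v) r) = OHform I n x (fmat_of_vec n v) (fmat_of_vec n w)"
proof -
  note d = matrices_D(1,2)[OF x]
  have e: "vec_index (OHmat I x *\<^sub>v v) r = (\<Sum>j<n. \<Sum>l<n.
     (\<Sum>\<^sub>\<infinity>s\<in>I. (x $$ (r div n, j)) s * cnj ((x $$ (r mod n, l)) s)) * vec_index v (j * n + l))" if "r < n * n" for r
  proof -
    have "vec_index (OHmat I x *\<^sub>v v) r = (\<Sum>s<n * n. OHmat I x $$ (r, s) * vec_index v s)"
      using that v d by (subst mult_mat_vec_index) (auto simp: mat_pairing_def)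
    also have "\<dots> = (\<Sum>s<n * n. (\<Sum>\<^sub>\<infinity>t\<in>I. (x $$ (r div n, s div n)) t * cnj ((x $$ (r mod n, s mod n)) t)) * vec_index v (s div n * n + s mod n))"
      using that d by (intro sum.cong) (auto simp: mat_pairing_def)
    also have "\<dots> = (\<Sum>j<n. \<Sum>l<n. (\<Sum>\<^sub>\<infinity>s\<in>I. (x $$ (r div n, j)) s * cnj ((x $$ (r mod n, l)) s)) * vec_index v (j * n + l))"
      by (rule sum_div_mod)
    finally show ?thesis .
  qed
  have "(\<Sum>r<n * n. cnj (vec_index w r) * vec_index (OHmat I x *\<^sub>v v) r) =
    (\<Sum>r<n * n. cnj (vec_index w (r div n * n + r mod n)) * (\<Sum>j<n. \<Sum>l<n.
     (\<Sum>\<^sub>\<infinity>s\<in>I. (x $$ (r div n, j)) s * cnj ((x $$ (r mod n, l)) s)) * vec_index v (j * n + l)))"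
    by (intro sum.cong) (auto simp: e simp del: index_mult_mat_vec)
  also have "\<dots> = (\<Sum>i<n. \<Sum>k<n. cnj (vec_index w (i * n + k)) * (\<Sum>j<n. \<Sum>l<n.
     (\<Sum>\<^sub>\<infinity>s\<in>I. (x $$ (i, j)) s * cnj ((x $$ (k, l)) s)) * vec_index v (j * n + l)))"
    by (rule sum_div_mod)
  also have "\<dots> = OHform I n x (fmat_of_vec n v) (fmat_of_vec n w)"
    by (simp add: OHform_def fmat_of_vec_def sum_distrib_left)
  finally show ?thesis .
qed

text \<open>Arranging vectors as matrices is isometric, so an operator norm bound becomes a bound on
  the form. For the converse the form is tested with \<open>w\<close> equal to the image of
  \<open>v\<close>.\<close>

lemma OHmat_opnorm_le_iff:
  assumes x: "x \<in> matrices (OH I) n n" and L: "0 \<le> L"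
  shows "mat_opnorm (OHmat I x) \<le> L \<longleftrightarrow>
    (\<forall>Z W. in_size n Z \<longrightarrow> in_size n W \<longrightarrow> cmod (OHform I n x Z W) \<le> L * norm Z * norm W)"
proof safe
  note d = matrices_D(1,2)[OF x]
  have dT: "dim_row (OHmat I x) = n * n" "dim_col (OHmat I x) = n * n" using d by (auto simp: mat_pairing_def)
  {
    fix Z W assume le: "mat_opnorm (OHmat I x) \<le> L" and ZW: "in_size n Z" "in_size n W"
    define v where "v = vec (n * n) (\<lambda>r. entry Z (r div n) (r mod n))"
    define w where "w = vec (n * n) (\<lambda>r. entry W (r div n) (r mod n))"
    have bound: "i * n + k < n * n" if "i < n" "k < n" for i k
    proof -
      have "i * n + k < Suc i * n" using that by simp
      also have "\<dots> \<le> n * n" using that by (intro mult_right_mono) auto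
      finally show ?thesis .
    qed
    have "fmat_of_vec n (vec (n * n) (\<lambda>r. entry Y (r div n) (r mod n))) = Y" if "in_size n Y" for Y
    proof (rule fmat_eqI)
      fix i j
      show "entry (fmat_of_vec n (vec (n * n) (\<lambda>r. entry Y (r div n) (r mod n)))) i j = entry Y i j"
        using that bound[of i j] by (cases "i < n \<and> j < n") (auto simp: fmat_of_vec_def in_size_D not_less)
    qed
    then have vw: "fmat_of_vec n v = Z" "fmat_of_vec n w = W" using ZW by (auto simp: v_def w_def)
    have c: "v \<in> carrier_vec (n * n)" "w \<in> carrier_vec (n * n)" by (auto simp: v_def w_def)
    have "cmod (OHform I n x Z W) = cmod (\<Sum>r<n * n. cnj (vec_index w r) * vec_index (OHmat I x *\<^sub>v v) r)"
      using OHmat_sform[OF x c(1), of w] vw by simp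
    also have "\<dots> \<le> sqrt (\<Sum>r<n * n. (cmod (cnj (vec_index w r)))\<^sup>2) * sqrt (\<Sum>r<n * n. (cmod (vec_index (OHmat I x *\<^sub>v v) r))\<^sup>2)"
      by (rule cmod_sum_mult_le)
    also have "\<dots> = vec_l2norm w * vec_l2norm (OHmat I x *\<^sub>v v)"
      using c dT by (simp add: vec_l2norm_def)
    also have "\<dots> \<le> vec_l2norm w * (L * vec_l2norm v)"
      using mat_opnorm_bound[of v "OHmat I x"] c dT mult_right_mono[OF le vec_l2norm_nonneg[of v]]
      by (intro mult_left_mono) auto
    also have "\<dots> = L * norm Z * norm W" using norm_fmat_of_vec[OF c(1)] norm_fmat_of_vec[OF c(2)] vw by simp
    finally show "cmod (OHform I n x Z W) \<le> L * norm Z * norm W" .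
  }
  assume *: "\<forall>Z W. in_size n Z \<longrightarrow> in_size n W \<longrightarrow> cmod (OHform I n x Z W) \<le> L * norm Z * norm W"
  show "mat_opnorm (OHmat I x) \<le> L"
  proof (rule mat_opnorm_le[OF L])
    fix v :: "complex vec" assume "v \<in> carrier_vec (dim_col (OHmat I x))"
    then have v: "v \<in> carrier_vec (n * n)" using dT by simp
    define w where "w = OHmat I x *\<^sub>v v"
    have w: "w \<in> carrier_vec (n * n)" 
      unfolding w_def by (rule carrier_vecI) (simp only: dim_mult_mat_vec dT)
    have "complex_of_real ((vec_l2norm w)\<^sup>2) = (\<Sum>r<n * n. cnj (vec_index w r) * vec_index w r)"
      using w by (simp add: vec_l2norm_sq mult_cnj_cmod)
    also have "\<dots> = OHform I n x (fmat_of_vec n v) (fmat_of_vec n w)" using OHmat_sform[OF x v, of w] by (simp add: w_def)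
    finally have "(vec_l2norm w)\<^sup>2 = cmod (OHform I n x (fmat_of_vec n v) (fmat_of_vec n w))"
      by (metis norm_of_real abs_of_nonneg zero_le_power2)
    also have "\<dots> \<le> L * norm (fmat_of_vec n v) * norm (fmat_of_vec n w)" using * by (simp add: fmat_of_vec_def)
    finally have "vec_l2norm w * vec_l2norm w \<le> L * vec_l2norm v * vec_l2norm w"
      by (simp add: norm_fmat_of_vec v w power2_eq_square)
    then show "vec_l2norm (OHmat I x *\<^sub>v v) \<le> L * vec_l2norm v"
      unfolding w_def[symmetric] using L vec_l2norm_nonneg[of w]
      by (cases "vec_l2norm w = 0") (simp, metis mult_right_le_imp_le less_le)
  qed
qed

text \<open>At positive arguments the finite sums grow with the index set, so each lies below the
  form over \<open>I\<close>; conversely, bounds over finite sets pass to the limit of the forms.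
  This reduces the matrix norms of \<open>OH I\<close> to finite families of matrices.\<close>

theorem OH_mnorm_le_iff:
  assumes x: "x \<in> matrices (OH I) n n" and t: "0 \<le> t"
  shows "mnorm (OH I) x \<le> t \<longleftrightarrow> (\<forall>A. finite A \<longrightarrow> A \<subseteq> I \<longrightarrow> oh_bound A (coord x) (t\<^sup>2))"
proof -
  have "mnorm (OH I) x \<le> t \<longleftrightarrow> mat_opnorm (OHmat I x) \<le> t\<^sup>2"
    unfolding OH_simps using real_sqrt_le_iff[of "mat_opnorm (OHmat I x)" "t\<^sup>2"] t by simp
  also have "\<dots> \<longleftrightarrow> (\<forall>A. finite A \<longrightarrow> A \<subseteq> I \<longrightarrow> oh_bound A (coord x) (t\<^sup>2))"
    unfolding OHmat_opnorm_le_iff[OF x zero_le_power2]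
  proof safe
    fix A assume *: "\<forall>Z W. in_size n Z \<longrightarrow> in_size n W \<longrightarrow> cmod (OHform I n x Z W) \<le> t\<^sup>2 * norm Z * norm W"
      and A: "finite A" "A \<subseteq> I"
    show "oh_bound A (coord x) (t\<^sup>2)"
    proof (rule oh_boundI_psd_in_size)
      fix y z assume yz: "in_size n y" "in_size n z"
      let ?Z = "y * adj y" and ?W = "z * adj z"
      have i: "in_size n ?Z" "in_size n ?W" using yz by auto
      have "((\<lambda>B. cmod (OHform B n x ?Z ?W)) \<longlongrightarrow> cmod (OHform I n x ?Z ?W)) (finite_subsets_at_top I)"
        by (intro tendsto_intros OHform_tendsto x)
      moreover have "eventually (\<lambda>B. (\<Sum>s\<in>A. (norm (adj z * coord x s * y))\<^sup>2) \<le> cmod (OHform B n x ?Z ?W)) (finite_subsets_at_top I)"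
        unfolding eventually_finite_subsets_at_top
      proof (intro exI conjI allI impI)
        fix B assume B: "finite B \<and> A \<subseteq> B \<and> B \<subseteq> I"
        have "(\<Sum>s\<in>A. (norm (adj z * coord x s * y))\<^sup>2) \<le> (\<Sum>s\<in>B. (norm (adj z * coord x s * y))\<^sup>2)"
          using B by (intro sum_mono2) auto
        also have "\<dots> = cmod (sform B (coord x) (coord x) ?Z ?W)"
          unfolding sform_psd norm_of_real by (simp add: sum_nonneg)
        finally show "(\<Sum>s\<in>A. (norm (adj z * coord x s * y))\<^sup>2) \<le> cmod (OHform B n x ?Z ?W)"
          using sform_eq_OHform[OF x i] B by simp
      qed (use A in auto)
      ultimately have "(\<Sum>s\<in>A. (norm (adj z * coord x s * y))\<^sup>2) \<le> cmod (OHform I n x ?Z ?W)"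
        by (rule tendsto_lowerbound) simp
      then show "(\<Sum>s\<in>A. (norm (adj z * coord x s * y))\<^sup>2) \<le> t\<^sup>2 * norm ?Z * norm ?W"
        using * i order_trans by blast
    qed (use x in auto)
  next
    fix Z W assume *: "\<forall>A. finite A \<longrightarrow> A \<subseteq> I \<longrightarrow> oh_bound A (coord x) (t\<^sup>2)" and ZW: "in_size n Z" "in_size n W"
    have "((\<lambda>A. cmod (OHform A n x Z W)) \<longlongrightarrow> cmod (OHform I n x Z W)) (finite_subsets_at_top I)"
      by (intro tendsto_intros OHform_tendsto x)
    moreover have "eventually (\<lambda>A. cmod (OHform A n x Z W) \<le> t\<^sup>2 * norm Z * norm W) (finite_subsets_at_top I)"
      using * sform_eq_OHform[OF x ZW] by (intro eventually_finite_subsets_at_top_weakI) (metis oh_boundD)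
    ultimately show "cmod (OHform I n x Z W) \<le> t\<^sup>2 * norm Z * norm W"
      by (rule tendsto_upperbound) simp
  qed
  finally show ?thesis .
qed

lemma OH_mnorm_nonneg: "0 \<le> mnorm (OH I) x"
  by (simp add: OH_simps)

lemma zero_in_OH: "(\<lambda>_. 0) \<in> carrier (OH I)"
  by (simp add: OH_simps)

lemma OH_rect_mnorm_nonneg: "0 \<le> rect_mnorm (OH I) x"
  by (simp add: rect_mnorm_def OH_mnorm_nonneg)

theorem OH_rect_mnorm_le_iff:
  assumes x: "x \<in> matrices (OH I) m n" and t: "0 \<le> t"
  shows "rect_mnorm (OH I) x \<le> t \<longleftrightarrow> (\<forall>A. finite A \<longrightarrow> A \<subseteq> I \<longrightarrow> oh_bound A (coord x) (t\<^sup>2))"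
proof -
  have p: "square_pad (OH I) x \<in> matrices (OH I) (max m n) (max m n)"
    using matrices_D[OF x] by (intro matrices_I) (auto simp: square_pad_def Let_def OH_simps)
  have "coord (square_pad (OH I) x) = coord x"
    using matrices_D[OF x] by (intro ext fmat_eqI) (auto simp: square_pad_def Let_def OH_simps)
  then show ?thesis using OH_mnorm_le_iff[OF p t] by (simp add: rect_mnorm_def)
qed

subsection \<open>Spaces with matrix norms, their quotients and completions\<close>

definition mat_add :: "('a, 'm) opspace_scheme \<Rightarrow> 'a mat \<Rightarrow> 'a mat \<Rightarrow> 'a mat" where
  "mat_add V x y = mat (dim_row x) (dim_col x) (\<lambda>ij. x $$ ij \<oplus>\<^bsub>V\<^esub> y $$ ij)"

definition mat_scale :: "('a, 'm) opspace_scheme \<Rightarrow> complex \<Rightarrow> 'a mat \<Rightarrow> 'a mat" where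
  "mat_scale V c x = mat (dim_row x) (dim_col x) (\<lambda>ij. c \<odot>\<^bsub>V\<^esub> x $$ ij)"

text \<open>A common framework for the algebraic Haagerup tensor product, its Cauchy sequences and
  the quotients. Norms may vanish on nonzero elements, as they do on Cauchy sequences, and only
  inequalities are required. By \<open>mnorm_entries\<close>, entrywise convergence implies
  convergence of matrix norms.\<close>

locale mspace = abelian_group V for V :: "('a, 'm) opspace_scheme" (structure) +
  assumes smult_closed [simp]: "x \<in> carrier V \<Longrightarrow> c \<odot> x \<in> carrier V"
    and smult_add: "x \<in> carrier V \<Longrightarrow> y \<in> carrier V \<Longrightarrow> c \<odot> (x \<oplus> y) = c \<odot> x \<oplus> c \<odot> y"
    and add_smult: "x \<in> carrier V \<Longrightarrow> (c + d) \<odot> x = c \<odot> x \<oplus> d \<odot> x"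
    and smult_smult: "x \<in> carrier V \<Longrightarrow> c \<odot> (d \<odot> x) = (c * d) \<odot> x"
    and one_smult: "x \<in> carrier V \<Longrightarrow> 1 \<odot> x = x"
    and mnorm_nonneg: "X \<in> matrices V n n \<Longrightarrow> 0 \<le> mnorm V X"
    and mnorm_add: "X \<in> matrices V n n \<Longrightarrow> Y \<in> matrices V n n \<Longrightarrow> mnorm V (mat_add V X Y) \<le> mnorm V X + mnorm V Y"
    and mnorm_scale: "X \<in> matrices V n n \<Longrightarrow> mnorm V (mat_scale V c X) \<le> cmod c * mnorm V X"
    and mnorm_entries: "X \<in> matrices V n n \<Longrightarrow> mnorm V X \<le> (\<Sum>i<n. \<Sum>j<n. vnorm V (X $$ (i, j)))"
begin

lemma mat_add_closed: "x \<in> matrices V n n \<Longrightarrow> y \<in> matrices V n n \<Longrightarrow> mat_add V x y \<in> matrices V n n"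
  by (rule matrices_I) (auto simp: mat_add_def matrices_D)

lemma mat_scale_closed: "x \<in> matrices V n n \<Longrightarrow> mat_scale V c x \<in> matrices V n n"
  by (rule matrices_I) (auto simp: mat_scale_def matrices_D)

lemma zero_smult: "x \<in> carrier V \<Longrightarrow> 0 \<odot> x = \<zero>"
  using add_smult[of x 0 0] by (metis add.r_cancel_one' add_0 smult_closed)

lemma minus_one_smult: "x \<in> carrier V \<Longrightarrow> (- 1) \<odot> x = \<ominus> x"
  using add_smult[of x "- 1" 1] by (simp add: zero_smult one_smult minus_equality)

lemma smult_zero: "c \<odot> \<zero> = \<zero>"
  using smult_smult[of \<zero> c 0] by (simp add: zero_smult)

lemma one_mat: "x \<in> carrier V \<Longrightarrow> mat 1 1 (\<lambda>_. x) \<in> matrices V 1 1"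
  by (rule matrices_I) auto

lemma vnorm_nonneg: "x \<in> carrier V \<Longrightarrow> 0 \<le> vnorm V x"
  unfolding vnorm_def by (rule mnorm_nonneg[OF one_mat])

lemma vnorm_add: assumes "x \<in> carrier V" "y \<in> carrier V" shows "vnorm V (x \<oplus> y) \<le> vnorm V x + vnorm V y"
proof -
  have "mat 1 1 (\<lambda>_. x \<oplus> y) = mat_add V (mat 1 1 (\<lambda>_. x)) (mat 1 1 (\<lambda>_. y))"
    by (rule eq_matI) (auto simp: mat_add_def)
  then show ?thesis using mnorm_add[OF one_mat one_mat, of x y] assms by (simp add: vnorm_def)
qed

lemma vnorm_smult: assumes "x \<in> carrier V" shows "vnorm V (c \<odot> x) \<le> cmod c * vnorm V x"
proof -
  have "mat 1 1 (\<lambda>_. c \<odot> x) = mat_scale V c (mat 1 1 (\<lambda>_. x))"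
    by (rule eq_matI) (auto simp: mat_scale_def)
  then show ?thesis using mnorm_scale[OF one_mat, of x c] assms by (simp add: vnorm_def)
qed

lemma vnorm_zero: "vnorm V \<zero> = 0"
  using vnorm_smult[of \<zero> 0] vnorm_nonneg[of \<zero>] by (simp add: zero_smult)

lemma vnorm_minus: assumes "x \<in> carrier V" "y \<in> carrier V" shows "vnorm V (x \<ominus> y) \<le> vnorm V x + vnorm V y"
  using vnorm_add[of x "\<ominus> y"] vnorm_smult[of y "- 1"] assms by (simp add: minus_one_smult a_minus_def)

lemma vnorm_minus_commute: assumes "x \<in> carrier V" "y \<in> carrier V" shows "vnorm V (x \<ominus> y) = vnorm V (y \<ominus> x)"
proof -
  have *: "vnorm V (b \<ominus> a) \<le> vnorm V (a \<ominus> b)" if "a \<in> carrier V" "b \<in> carrier V" for a b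
  proof -
    have "\<ominus> (a \<ominus> b) = b \<ominus> a" using that by (simp add: a_minus_def minus_add a_comm)
    then show ?thesis using vnorm_smult[of "a \<ominus> b" "- 1"] that by (simp add: minus_one_smult)
  qed
  show ?thesis using *[of x y] *[of y x] assms by simp
qed

lemma minus_add_cancel: "x \<in> carrier V \<Longrightarrow> y \<in> carrier V \<Longrightarrow> y \<oplus> (x \<ominus> y) = x"
  by (metis a_minus_def a_assoc a_comm a_inv_closed r_neg r_zero)

lemma add_minus_add:
  assumes "x \<in> carrier V" "y \<in> carrier V" "x' \<in> carrier V" "y' \<in> carrier V"
  shows "(x \<oplus> x') \<ominus> (y \<oplus> y') = (x \<ominus> y) \<oplus> (x' \<ominus> y')"
  using assms by (simp add: a_minus_def minus_add a_ac)

lemma smult_minus: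
  assumes "x \<in> carrier V" "y \<in> carrier V" shows "c \<odot> (x \<ominus> y) = c \<odot> x \<ominus> c \<odot> y"
proof -
  have "c \<odot> (\<ominus> y) = \<ominus> (c \<odot> y)"
    using assms by (simp add: smult_smult mult.commute flip: minus_one_smult)
  then show ?thesis using assms by (simp add: a_minus_def smult_add)
qed

text \<open>Matrix norms are Lipschitz in the entries; in this form \<open>mnorm_entries\<close>
  serves to pass to limits.\<close>

lemma mnorm_diff:
  assumes x: "x \<in> matrices V n n" and y: "y \<in> matrices V n n"
  shows "\<bar>mnorm V x - mnorm V y\<bar> \<le> (\<Sum>i<n. \<Sum>j<n. vnorm V (x $$ (i, j) \<ominus> y $$ (i, j)))"
proof -
  have *: "mnorm V a \<le> mnorm V b + (\<Sum>i<n. \<Sum>j<n. vnorm V (a $$ (i, j) \<ominus> b $$ (i, j)))"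
    if ab: "a \<in> matrices V n n" "b \<in> matrices V n n" for a b
  proof -
    define d where "d = mat n n (\<lambda>ij. a $$ ij \<ominus> b $$ ij)"
    have d: "d \<in> matrices V n n" using ab by (intro matrices_I) (auto simp: d_def matrices_D)
    have "a = mat_add V b d"
      using ab by (intro eq_matI) (auto simp: mat_add_def d_def matrices_D minus_add_cancel)
    then have "mnorm V a \<le> mnorm V b + mnorm V d" using mnorm_add[OF ab(2) d] by simp
    also have "mnorm V d \<le> (\<Sum>i<n. \<Sum>j<n. vnorm V (d $$ (i, j)))" by (rule mnorm_entries[OF d])
    finally show ?thesis by (simp add: d_def)
  qed
  have "(\<Sum>i<n. \<Sum>j<n. vnorm V (x $$ (i, j) \<ominus> y $$ (i, j))) = (\<Sum>i<n. \<Sum>j<n. vnorm V (y $$ (i, j) \<ominus> x $$ (i, j)))"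
    using matrices_D[OF x] matrices_D[OF y] by (intro sum.cong vnorm_minus_commute) auto
  then show ?thesis using *[OF x y] *[OF y x] by linarith
qed

lemma functional_minus:
  assumes "linear_functional V f" "x \<in> carrier V" "y \<in> carrier V"
  shows "f (x \<ominus> y) = f x - f y"
proof -
  have "f (x \<oplus> (- 1) \<odot> y) = f x + (- 1) * f y"
    using assms unfolding linear_functional_def by (metis smult_closed)
  then show ?thesis using assms by (simp add: minus_one_smult a_minus_def)
qed

end

section \<open>Quotients by subspaces\<close>

definition msubspace :: "('a, 'm) opspace_scheme \<Rightarrow> 'a set \<Rightarrow> bool" where
  "msubspace V N \<longleftrightarrow> N \<subseteq> carrier V \<and> \<zero>\<^bsub>V\<^esub> \<in> N \<and> (\<forall>x\<in>N. \<forall>y\<in>N. x \<oplus>\<^bsub>V\<^esub> y \<in> N) \<and> (\<forall>c. \<forall>x\<in>N. c \<odot>\<^bsub>V\<^esub> x \<in> N)"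

locale mspace_sub = mspace V for V :: "('a, 'm) opspace_scheme" (structure) +
  fixes N assumes sub: "msubspace V N"
begin

lemma abelian_sub: "abelian_subgroup N V"
proof (rule abelian_subgroupI3)
  show "additive_subgroup N V"
  proof (rule additive_subgroup.intro, rule subgroup.intro)
    show "inv\<^bsub>add_monoid V\<^esub> x \<in> N" if "x \<in> N" for x
    proof -
      have "x \<in> carrier V" "(- 1) \<odot> x \<in> N" using that sub unfolding msubspace_def by auto
      then show ?thesis using minus_one_smult[of x] by (simp add: a_inv_def)
    qed
  qed (use sub in \<open>auto simp: msubspace_def\<close>)
qed (rule abelian_group_axioms)

lemma N_carrier: "x \<in> N \<Longrightarrow> x \<in> carrier V"
  using sub by (auto simp: msubspace_def)

abbreviation q where "q x \<equiv> N +> x"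
abbreviation Q where "Q \<equiv> op_quotient V N"

lemma q_add: "x \<in> carrier V \<Longrightarrow> y \<in> carrier V \<Longrightarrow> q x <+>\<^bsub>V\<^esub> q y = q (x \<oplus> y)"
  using abelian_subgroup.a_rcos_sum[OF abelian_sub] .

lemma q_eq: "x \<in> carrier V \<Longrightarrow> y \<in> carrier V \<Longrightarrow> q x = q y \<longleftrightarrow> x \<ominus> y \<in> N"
proof
  assume xy: "x \<in> carrier V" "y \<in> carrier V"
  {
    assume "q x = q y"
    moreover have "x \<in> q x" using abelian_subgroup.a_rcos_self[OF abelian_sub xy(1)] .
    ultimately show "x \<ominus> y \<in> N"
      using abelian_subgroup.a_rcos_module[OF abelian_sub xy(2,1)] by (simp add: a_minus_def)
  }
  assume "x \<ominus> y \<in> N"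
  then have "x \<in> q y" using abelian_subgroup.a_rcos_module[OF abelian_sub xy(2,1)] by (simp add: a_minus_def)
  then show "q x = q y" using abelian_subgroup.a_repr_independence'[OF abelian_sub] xy by blast
qed

lemma Q_simps: "carrier Q = a_rcosets N" "\<zero>\<^bsub>Q\<^esub> = N" "C \<oplus>\<^bsub>Q\<^esub> D = C <+>\<^bsub>V\<^esub> D"
  "c \<odot>\<^bsub>Q\<^esub> C = (\<Union>x\<in>C. q (c \<odot> x))"
  "mnorm Q X = Inf {mnorm V x | x. x \<in> matrices V (dim_row X) (dim_col X) \<and> X = map_mat q x}"
  by (simp_all add: op_quotient_def)

lemma Q_carrier: "carrier Q = q ` carrier V"
  by (auto simp: Q_simps A_RCOSETS_def')

text \<open>The union in the definition of scalar multiples collapses, because all representatives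
  of a coset give the same scaled coset.\<close>

lemma q_smult: assumes "x \<in> carrier V" shows "c \<odot>\<^bsub>Q\<^esub> q x = q (c \<odot> x)"
proof -
  have "q (c \<odot> y) = q (c \<odot> x)" if y: "y \<in> q x" for y
  proof -
    obtain h where h: "h \<in> N" "y = h \<oplus> x" using y by (auto simp: a_r_coset_def')
    have c: "h \<in> carrier V" using h N_carrier by blast
    have "c \<odot> y \<ominus> c \<odot> x = c \<odot> h"
      using c assms by (simp add: h(2) smult_add a_minus_def a_assoc r_neg)
    also have "\<dots> \<in> N" using sub h by (auto simp: msubspace_def)
    finally show ?thesis using q_eq assms c h by simp
  qed
  moreover have "x \<in> q x" using abelian_subgroup.a_rcos_self[OF abelian_sub assms] .
  ultimately show ?thesis unfolding Q_simps by blast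
qed

lemma Q_abelian: "abelian_group Q"
proof (rule abelian_groupI)
  have z: "\<zero>\<^bsub>Q\<^esub> = q \<zero>" using N_carrier by (simp add: Q_simps a_coset_add_zero subsetI)
  then show "\<zero>\<^bsub>Q\<^esub> \<in> carrier Q" by (simp add: Q_carrier)
  fix X Y Z assume "X \<in> carrier Q"
  then obtain x where x: "x \<in> carrier V" "X = q x" by (auto simp: Q_carrier)
  show "\<zero>\<^bsub>Q\<^esub> \<oplus>\<^bsub>Q\<^esub> X = X" using x by (simp only: z) (simp add: Q_simps(3) q_add)
  show "\<exists>Y\<in>carrier Q. Y \<oplus>\<^bsub>Q\<^esub> X = \<zero>\<^bsub>Q\<^esub>"
    using x by (intro bexI[of _ "q (\<ominus> x)"]) (auto simp: z Q_simps(3) q_add l_neg Q_carrier)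
  assume "Y \<in> carrier Q"
  then obtain y where y: "y \<in> carrier V" "Y = q y" by (auto simp: Q_carrier)
  show "X \<oplus>\<^bsub>Q\<^esub> Y \<in> carrier Q" using x y by (simp add: Q_simps(3) q_add Q_carrier)
  show "X \<oplus>\<^bsub>Q\<^esub> Y = Y \<oplus>\<^bsub>Q\<^esub> X" using x y by (simp add: Q_simps(3) q_add a_comm)
  assume "Z \<in> carrier Q"
  then obtain z where "z \<in> carrier V" "Z = q z" by (auto simp: Q_carrier)
  then show "X \<oplus>\<^bsub>Q\<^esub> Y \<oplus>\<^bsub>Q\<^esub> Z = X \<oplus>\<^bsub>Q\<^esub> (Y \<oplus>\<^bsub>Q\<^esub> Z)"
    using x y by (simp add: Q_simps(3) q_add a_assoc)
qed

lemma q_mat: "x \<in> matrices V m n \<Longrightarrow> map_mat q x \<in> matrices Q m n"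
  by (rule matrices_I) (auto simp: matrices_D Q_carrier)

lemma q_mat_ex:
  assumes "X \<in> matrices Q m n"
  shows "\<exists>x\<in>matrices V m n. X = map_mat q x"
proof -
  have "\<exists>x\<in>carrier V. X $$ (i, j) = q x" if "i < m" "j < n" for i j
    using matrices_D(3)[OF assms that] by (auto simp: Q_carrier)
  then obtain f where f: "\<And>i j. i < m \<Longrightarrow> j < n \<Longrightarrow> f i j \<in> carrier V \<and> X $$ (i, j) = q (f i j)" by metis
  then show ?thesis using matrices_D(1,2)[OF assms]
    by (intro bexI[of _ "mat m n (\<lambda>(i, j). f i j)"] eq_matI matrices_I) auto
qed

lemma Q_mnorm_le:
  assumes "x \<in> matrices V n n" shows "mnorm Q (map_mat q x) \<le> mnorm V x"
  unfolding Q_simps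
proof (rule cInf_lower)
  show "mnorm V x \<in> {mnorm V y | y. y \<in> matrices V (dim_row (map_mat q x)) (dim_col (map_mat q x)) \<and> map_mat q x = map_mat q y}"
    using assms matrices_D(1,2)[OF assms] by auto
  show "bdd_below {mnorm V y | y. y \<in> matrices V (dim_row (map_mat q x)) (dim_col (map_mat q x)) \<and> map_mat q x = map_mat q y}"
    using matrices_D(1,2)[OF assms] by (auto intro!: bdd_belowI[of _ 0] mnorm_nonneg)
qed

text \<open>The infimum need not be attained, so estimates in quotients go through lifts of strictly
  larger norm and end with an arbitrarily small loss.\<close>

lemma Q_mnorm_lift:
  assumes "X \<in> matrices Q n n" "mnorm Q X < t"
  shows "\<exists>x\<in>matrices V n n. X = map_mat q x \<and> mnorm V x < t"
proof -
  have "{mnorm V y | y. y \<in> matrices V n n \<and> X = map_mat q y} \<noteq> {}" using q_mat_ex[OF assms(1)] by auto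
  then have "\<exists>r\<in>{mnorm V y | y. y \<in> matrices V n n \<and> X = map_mat q y}. r < t"
    using assms(2) matrices_D(1,2)[OF assms(1)] by (intro cInf_lessD) (simp_all add: Q_simps)
  then show ?thesis by auto
qed

lemma Q_mnorm_nonneg: assumes "X \<in> matrices Q n n" shows "0 \<le> mnorm Q X"
  using Q_mnorm_lift[OF assms, of 0] mnorm_nonneg by (meson linorder_not_le)

lemma Q_vnorm_le: assumes "x \<in> carrier V" shows "vnorm Q (q x) \<le> vnorm V x"
proof -
  have "map_mat q (mat 1 1 (\<lambda>_. x)) = mat 1 1 (\<lambda>_. q x)" by (rule eq_matI) auto
  then show ?thesis using Q_mnorm_le[OF one_mat[OF assms]] by (simp add: vnorm_def)
qed

lemma Q_vnorm_lift: assumes "C \<in> carrier Q" "vnorm Q C < t" shows "\<exists>x\<in>carrier V. C = q x \<and> vnorm V x < t"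
proof -
  have "mat 1 1 (\<lambda>_. C) \<in> matrices Q 1 1" by (rule matrices_I) (use assms in auto)
  then obtain x where x: "x \<in> matrices V 1 1" "mat 1 1 (\<lambda>_. C) = map_mat q x" "mnorm V x < t"
    using Q_mnorm_lift assms by (force simp: vnorm_def)
  have "x = mat 1 1 (\<lambda>_. x $$ (0, 0))" using matrices_D[OF x(1)] by (intro eq_matI) auto
  moreover have "C = q (x $$ (0, 0))" using arg_cong[OF x(2), of "\<lambda>y. y $$ (0, 0)"] matrices_D[OF x(1)] by simp
  ultimately show ?thesis using x matrices_D(3)[OF x(1), of 0 0] by (auto simp: vnorm_def)
qed

lemma Q_mspace: "mspace Q"
proof (rule mspace.intro[OF Q_abelian], unfold_locales)
  fix X Y c d
  {
    assume "X \<in> carrier Q" then obtain x where x: "x \<in> carrier V" "X = q x" by (auto simp: Q_carrier)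
    show "c \<odot>\<^bsub>Q\<^esub> X \<in> carrier Q" using x by (simp add: q_smult Q_carrier)
    show "(c + d) \<odot>\<^bsub>Q\<^esub> X = c \<odot>\<^bsub>Q\<^esub> X \<oplus>\<^bsub>Q\<^esub> d \<odot>\<^bsub>Q\<^esub> X" using x by (simp add: q_smult add_smult Q_simps(3) q_add)
    show "c \<odot>\<^bsub>Q\<^esub> (d \<odot>\<^bsub>Q\<^esub> X) = (c * d) \<odot>\<^bsub>Q\<^esub> X" using x by (simp add: q_smult smult_smult)
    show "1 \<odot>\<^bsub>Q\<^esub> X = X" using x by (simp add: q_smult one_smult)
    assume "Y \<in> carrier Q" then obtain y where y: "y \<in> carrier V" "Y = q y" by (auto simp: Q_carrier)
    show "c \<odot>\<^bsub>Q\<^esub> (X \<oplus>\<^bsub>Q\<^esub> Y) = c \<odot>\<^bsub>Q\<^esub> X \<oplus>\<^bsub>Q\<^esub> c \<odot>\<^bsub>Q\<^esub> Y"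
      using x y by (simp add: q_smult smult_add Q_simps(3) q_add)
  }
next
  fix X :: "'a set mat" and n assume X: "X \<in> matrices Q n n"
  show "0 \<le> mnorm Q X" by (rule Q_mnorm_nonneg[OF X])
  show "mnorm Q X \<le> (\<Sum>i<n. \<Sum>j<n. vnorm Q (X $$ (i, j)))"
  proof (rule field_le_epsilon)
    fix e :: real assume e: "0 < e"
    \<comment> \<open>The slack is shared among \<open>n * n\<close> entries; the added 1 covers
      \<open>n = 0\<close>.\<close>
    define d where "d = e / (real n * real n + 1)"
    have "0 < real n * real n + 1" by (simp add: add_nonneg_pos)
    then have d: "d > 0" "real n * real n * d \<le> e" using e by (simp_all add: d_def divide_le_eq)
    have "\<exists>x\<in>carrier V. X $$ (i, j) = q x \<and> vnorm V x < vnorm Q (X $$ (i, j)) + d" if "i < n" "j < n" for i j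
      by (rule Q_vnorm_lift) (use matrices_D(3)[OF X that] d in auto)
    then obtain f where f: "\<And>i j. i < n \<Longrightarrow> j < n \<Longrightarrow> f i j \<in> carrier V \<and> X $$ (i, j) = q (f i j)
      \<and> vnorm V (f i j) < vnorm Q (X $$ (i, j)) + d" by metis
    define x where "x = mat n n (\<lambda>(i, j). f i j)"
    have x: "x \<in> matrices V n n" "X = map_mat q x"
      using f matrices_D(1,2)[OF X] by (auto simp: x_def intro!: matrices_I eq_matI)
    have "mnorm Q X \<le> mnorm V x" using Q_mnorm_le[OF x(1)] x(2) by simp
    also have "\<dots> \<le> (\<Sum>i<n. \<Sum>j<n. vnorm V (x $$ (i, j)))" by (rule mnorm_entries[OF x(1)])
    also have "\<dots> \<le> (\<Sum>i<n. \<Sum>j<n. vnorm Q (X $$ (i, j)) + d)"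
    proof (intro sum_mono)
      fix i j assume "i \<in> {..<n}" "j \<in> {..<n}"
      then show "vnorm V (x $$ (i, j)) \<le> vnorm Q (X $$ (i, j)) + d"
        using f[of i j] unfolding x_def by (metis index_mat(1) lessThan_iff less_imp_le split_conv)
    qed
    also have "\<dots> \<le> (\<Sum>i<n. \<Sum>j<n. vnorm Q (X $$ (i, j))) + e" using d by (simp add: sum.distrib mult.assoc)
    finally show "mnorm Q X \<le> (\<Sum>i<n. \<Sum>j<n. vnorm Q (X $$ (i, j))) + e" .
  qed
  show "mnorm Q (mat_scale Q c X) \<le> cmod c * mnorm Q X" for c
  proof (rule field_le_epsilon)
    fix e :: real assume e: "0 < e"
    have ce: "0 < e / (cmod c + 1)" using e by (simp add: add_nonneg_pos)
    obtain x where x: "x \<in> matrices V n n" "X = map_mat q x" "mnorm V x < mnorm Q X + e / (cmod c + 1)"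
      using Q_mnorm_lift[OF X, of "mnorm Q X + e / (cmod c + 1)"] ce by auto
    have "mat_scale Q c X = map_mat q (mat_scale V c x)"
      using x(1,2) by (intro eq_matI) (auto simp: mat_scale_def q_smult matrices_D)
    then have "mnorm Q (mat_scale Q c X) \<le> mnorm V (mat_scale V c x)"
      using Q_mnorm_le[OF mat_scale_closed[OF x(1)]] by simp
    also have "\<dots> \<le> cmod c * mnorm V x" by (rule mnorm_scale[OF x(1)])
    also have "\<dots> \<le> cmod c * (mnorm Q X + e / (cmod c + 1))" using x(3) by (intro mult_left_mono) auto
    also have "\<dots> \<le> cmod c * mnorm Q X + e"
    proof -
      have "cmod c * (e / (cmod c + 1)) \<le> e"
        using e by (simp add: divide_le_eq add_nonneg_pos)
      then show ?thesis by (simp add: distrib_left)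
    qed
    finally show "mnorm Q (mat_scale Q c X) \<le> cmod c * mnorm Q X + e" .
  qed
  fix Y :: "'a set mat" assume Y: "Y \<in> matrices Q n n"
  show "mnorm Q (mat_add Q X Y) \<le> mnorm Q X + mnorm Q Y"
  proof (rule field_le_epsilon)
    fix e :: real assume e: "0 < e"
    obtain x where x: "x \<in> matrices V n n" "X = map_mat q x" "mnorm V x < mnorm Q X + e / 2"
      using Q_mnorm_lift[OF X, of "mnorm Q X + e / 2"] e by auto
    obtain y where y: "y \<in> matrices V n n" "Y = map_mat q y" "mnorm V y < mnorm Q Y + e / 2"
      using Q_mnorm_lift[OF Y, of "mnorm Q Y + e / 2"] e by auto
    have "mat_add Q X Y = map_mat q (mat_add V x y)"
      using x(1,2) y(1,2) by (intro eq_matI) (auto simp: mat_add_def q_add Q_simps(3) matrices_D)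
    then have "mnorm Q (mat_add Q X Y) \<le> mnorm V (mat_add V x y)"
      using Q_mnorm_le[OF mat_add_closed[OF x(1) y(1)]] by simp
    also have "\<dots> \<le> mnorm V x + mnorm V y" by (rule mnorm_add[OF x(1) y(1)])
    finally show "mnorm Q (mat_add Q X Y) \<le> mnorm Q X + mnorm Q Y + e" using x(3) y(3) by linarith
  qed
qed

lemma functional_pullback:
  assumes "linear_functional Q h" "\<And>X. X \<in> carrier Q \<Longrightarrow> cmod (h X) \<le> C * vnorm Q X" "0 \<le> C"
  shows "linear_functional V (\<lambda>x. h (q x))" "x \<in> carrier V \<Longrightarrow> cmod (h (q x)) \<le> C * vnorm V x"
proof -
  show "linear_functional V (\<lambda>x. h (q x))"
    using assms(1) unfolding linear_functional_def
    by (simp add: Q_carrier q_smult[symmetric] Q_simps(3) q_add[symmetric] del: UN_simps)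
  assume x: "x \<in> carrier V"
  have "cmod (h (q x)) \<le> C * vnorm Q (q x)" using assms(2) x by (simp add: Q_carrier)
  also have "\<dots> \<le> C * vnorm V x" by (intro mult_left_mono Q_vnorm_le x assms)
  finally show "cmod (h (q x)) \<le> C * vnorm V x" .
qed

text \<open>Any representative gives the same value because \<open>g\<close> vanishes on
  \<open>N\<close>. Choosing nearly optimal representatives keeps the constant \<open>C\<close>
  unchanged.\<close>

lemma functional_descend:
  assumes g: "linear_functional V g" "\<And>x. x \<in> N \<Longrightarrow> g x = 0"
    and bd: "\<And>x. x \<in> carrier V \<Longrightarrow> cmod (g x) \<le> C * vnorm V x" "0 \<le> C"
  shows "\<exists>h. linear_functional Q h \<and> (\<forall>x\<in>carrier V. h (q x) = g x) \<and> (\<forall>X\<in>carrier Q. cmod (h X) \<le> C * vnorm Q X)"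
proof -
  define h where "h X = g (SOME x. x \<in> carrier V \<and> X = q x)" for X
  have h: "h (q x) = g x" if x: "x \<in> carrier V" for x
  proof -
    define y where "y = (SOME y. y \<in> carrier V \<and> q x = q y)"
    have y: "y \<in> carrier V \<and> q x = q y" unfolding y_def by (rule someI[of _ x]) (use x in simp)
    then have "x \<ominus> y \<in> N" using q_eq x by blast
    then have "g x - g y = 0" using g(2) functional_minus[OF g(1) x] y by metis
    then show ?thesis by (simp add: h_def y_def)
  qed
  have "linear_functional Q h"
    using g(1) unfolding linear_functional_def
    by (auto simp: Q_carrier q_smult Q_simps(3) q_add h)
  moreover have "cmod (h X) \<le> C * vnorm Q X" if X: "X \<in> carrier Q" for X
  proof (rule field_le_epsilon)
    fix e :: real assume e: "0 < e"
    have ce: "0 < e / (C + 1)" using e bd(2) by simp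
    obtain x where x: "x \<in> carrier V" "X = q x" "vnorm V x < vnorm Q X + e / (C + 1)"
      using Q_vnorm_lift[OF X, of "vnorm Q X + e / (C + 1)"] ce by auto
    have "cmod (h X) \<le> C * vnorm V x" using bd(1) x by (simp add: h)
    also have "\<dots> \<le> C * (vnorm Q X + e / (C + 1))" using x bd(2) by (intro mult_left_mono) auto
    also have "\<dots> \<le> C * vnorm Q X + e"
    proof -
      have "C * (e / (C + 1)) \<le> e" using e bd(2) by (simp add: divide_le_eq)
      then show ?thesis by (simp add: distrib_left)
    qed
    finally show "cmod (h X) \<le> C * vnorm Q X + e" .
  qed
  ultimately show ?thesis using h by blast
qed

end

section \<open>Cauchy sequences and the completion\<close>

context mspace
begin

abbreviation CS where "CS \<equiv> cauchy_space V"

lemma CS_simps: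
  "\<zero>\<^bsub>CS\<^esub> = (\<lambda>_. \<zero>)" "s \<oplus>\<^bsub>CS\<^esub> t = (\<lambda>k. s k \<oplus> t k)" "c \<odot>\<^bsub>CS\<^esub> s = (\<lambda>k. c \<odot> s k)"
  "mnorm CS S = lim (\<lambda>k. mnorm V (map_mat (\<lambda>s. s k) S))"
  by (simp_all add: cauchy_space_def)

lemma CS_carrier:
  "s \<in> carrier CS \<longleftrightarrow> (\<forall>k. s k \<in> carrier V) \<and> (\<forall>e>0. \<exists>K. \<forall>m\<ge>K. \<forall>n\<ge>K. vnorm V (s m \<ominus> s n) < e)"
  by (auto simp: cauchy_space_def)

lemma CS_D: "s \<in> carrier CS \<Longrightarrow> s k \<in> carrier V"
  by (simp add: CS_carrier)

lemma CS_add: assumes "s \<in> carrier CS" "t \<in> carrier CS" shows "(\<lambda>k. s k \<oplus> t k) \<in> carrier CS"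
  unfolding CS_carrier
proof (intro conjI allI impI)
  show "s k \<oplus> t k \<in> carrier V" for k using assms by (simp add: CS_D)
  fix e :: real assume "0 < e"
  then have e: "0 < e / 2" by simp
  obtain K where K: "\<forall>m\<ge>K. \<forall>n\<ge>K. vnorm V (s m \<ominus> s n) < e / 2" using assms(1) e unfolding CS_carrier by blast
  obtain L where L: "\<forall>m\<ge>L. \<forall>n\<ge>L. vnorm V (t m \<ominus> t n) < e / 2" using assms(2) e unfolding CS_carrier by blast
  show "\<exists>K. \<forall>m\<ge>K. \<forall>n\<ge>K. vnorm V (s m \<oplus> t m \<ominus> (s n \<oplus> t n)) < e"
  proof (intro exI allI impI)
    fix m n assume mn: "max K L \<le> m" "max K L \<le> n"
    have "vnorm V (s m \<oplus> t m \<ominus> (s n \<oplus> t n)) \<le> vnorm V (s m \<ominus> s n) + vnorm V (t m \<ominus> t n)"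
      using assms by (simp add: add_minus_add CS_D vnorm_add)
    moreover have "vnorm V (s m \<ominus> s n) < e / 2" "vnorm V (t m \<ominus> t n) < e / 2" using K L mn by auto
    ultimately show "vnorm V (s m \<oplus> t m \<ominus> (s n \<oplus> t n)) < e" by linarith
  qed
qed

lemma CS_smult: assumes "s \<in> carrier CS" shows "(\<lambda>k. c \<odot> s k) \<in> carrier CS"
  unfolding CS_carrier
proof (intro conjI allI impI)
  show "c \<odot> s k \<in> carrier V" for k using assms by (simp add: CS_D)
  fix e :: real assume "0 < e"
  moreover have c: "0 < cmod c + 1" by (simp add: add_nonneg_pos)
  ultimately have "0 < e / (cmod c + 1)" by simp
  then obtain K where K: "\<forall>m\<ge>K. \<forall>n\<ge>K. vnorm V (s m \<ominus> s n) < e / (cmod c + 1)" using assms(1) unfolding CS_carrier by blast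
  show "\<exists>K. \<forall>m\<ge>K. \<forall>n\<ge>K. vnorm V (c \<odot> s m \<ominus> c \<odot> s n) < e"
  proof (intro exI allI impI)
    fix m n assume mn: "K \<le> m" "K \<le> n"
    have "vnorm V (c \<odot> s m \<ominus> c \<odot> s n) \<le> cmod c * vnorm V (s m \<ominus> s n)"
      using vnorm_smult[of "s m \<ominus> s n" c] assms by (simp add: smult_minus CS_D)
    also have "\<dots> \<le> (cmod c + 1) * vnorm V (s m \<ominus> s n)"
      using assms by (intro mult_right_mono vnorm_nonneg) (auto simp: CS_D)
    also have "\<dots> < (cmod c + 1) * (e / (cmod c + 1))" using K mn c by (intro mult_strict_left_mono) auto
    finally show "vnorm V (c \<odot> s m \<ominus> c \<odot> s n) < e" using c by simp
  qed
qed

lemma CS_const: assumes "v \<in> carrier V" shows "(\<lambda>_. v) \<in> carrier CS"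
  using assms by (auto simp: CS_carrier vnorm_zero a_minus_def r_neg)

lemma CS_neg: assumes "s \<in> carrier CS" shows "(\<lambda>k. \<ominus> s k) \<in> carrier CS"
  using CS_smult[OF assms, of "- 1"] assms by (simp add: minus_one_smult CS_D)

lemma CS_abelian: "abelian_group CS"
proof (rule abelian_groupI)
  fix s assume s: "s \<in> carrier CS"
  show "\<exists>t\<in>carrier CS. t \<oplus>\<^bsub>CS\<^esub> s = \<zero>\<^bsub>CS\<^esub>"
    by (rule bexI[OF _ CS_neg[OF s]]) (use s in \<open>simp add: CS_simps l_neg CS_D\<close>)
qed (auto simp: CS_simps CS_add CS_const CS_D a_ac intro!: ext)

lemma CS_minus: assumes "s \<in> carrier CS" "t \<in> carrier CS" shows "s \<ominus>\<^bsub>CS\<^esub> t = (\<lambda>k. s k \<ominus> t k)"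
proof -
  have "\<ominus>\<^bsub>CS\<^esub> t = (\<lambda>k. \<ominus> t k)"
    by (rule abelian_group.minus_equality[OF CS_abelian])
      (use assms in \<open>simp_all add: CS_simps l_neg CS_D CS_neg\<close>)
  then show ?thesis unfolding a_minus_def[of CS] by (simp add: CS_simps a_minus_def)
qed

lemma CS_mat: "S \<in> matrices CS m n \<Longrightarrow> map_mat (\<lambda>s. s k) S \<in> matrices V m n"
  by (rule matrices_I) (auto simp: matrices_D(1,2) intro!: CS_D matrices_D(3))

text \<open>This gives meaning to \<open>lim\<close> in \<open>cauchy_space\<close>: the entries are
  Cauchy sequences, and matrix norms are Lipschitz in the entries.\<close>

lemma CS_mnorm_tendsto:
  assumes S: "S \<in> matrices CS n n"
  shows "(\<lambda>k. mnorm V (map_mat (\<lambda>s. s k) S)) \<longlonglongrightarrow> mnorm CS S"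
proof -
  have "Cauchy (\<lambda>k. mnorm V (map_mat (\<lambda>s. s k) S))"
  proof (rule metric_CauchyI)
    fix e :: real assume e: "0 < e"
    define d where "d = e / (real n * real n + 1)"
    have p: "0 < real n * real n + 1" by (simp add: add_nonneg_pos)
    then have d: "d > 0" using e by (simp add: d_def)
    have "\<forall>i<n. \<forall>j<n. \<exists>K. \<forall>a\<ge>K. \<forall>b\<ge>K. vnorm V ((S $$ (i, j)) a \<ominus> (S $$ (i, j)) b) < d"
      using matrices_D(3)[OF S] d unfolding CS_carrier by blast
    then obtain K where K: "\<And>i j a b. i < n \<Longrightarrow> j < n \<Longrightarrow> K i j \<le> a \<Longrightarrow> K i j \<le> b \<Longrightarrow>
        vnorm V ((S $$ (i, j)) a \<ominus> (S $$ (i, j)) b) < d" by metis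
    \<comment> \<open>A sum instead of a maximum serves as common starting index for all entries,
      also when \<open>n = 0\<close>.\<close>
    define M where "M = (\<Sum>i<n. \<Sum>j<n. K i j)"
    have M: "K i j \<le> M" if "i < n" "j < n" for i j
    proof -
      have "K i j \<le> (\<Sum>j<n. K i j)" using that by (intro member_le_sum) auto
      also have "\<dots> \<le> M" unfolding M_def using that by (intro member_le_sum) auto
      finally show ?thesis .
    qed
    show "\<exists>M. \<forall>a\<ge>M. \<forall>b\<ge>M. dist (mnorm V (map_mat (\<lambda>s. s a) S)) (mnorm V (map_mat (\<lambda>s. s b) S)) < e"
    proof (intro exI allI impI)
      fix a b assume ab: "M \<le> a" "M \<le> b"
      have "dist (mnorm V (map_mat (\<lambda>s. s a) S)) (mnorm V (map_mat (\<lambda>s. s b) S)) \<le>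
        (\<Sum>i<n. \<Sum>j<n. vnorm V (map_mat (\<lambda>s. s a) S $$ (i, j) \<ominus> map_mat (\<lambda>s. s b) S $$ (i, j)))"
        unfolding dist_real_def by (rule mnorm_diff[OF CS_mat[OF S] CS_mat[OF S]])
      also have "\<dots> \<le> (\<Sum>i<n. \<Sum>j<n. d)"
        using matrices_D(1,2)[OF S] K M ab by (intro sum_mono) (simp, meson le_trans less_imp_le)
      also have "\<dots> < e" using p e by (simp add: d_def divide_less_eq)
      finally show "dist (mnorm V (map_mat (\<lambda>s. s a) S)) (mnorm V (map_mat (\<lambda>s. s b) S)) < e" .
    qed
  qed
  then show ?thesis unfolding CS_simps by (simp add: Cauchy_convergent_iff convergent_LIMSEQ_iff)
qed

lemma CS_vnorm_tendsto:
  assumes "s \<in> carrier CS" shows "(\<lambda>k. vnorm V (s k)) \<longlonglongrightarrow> vnorm CS s"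
proof -
  have "map_mat (\<lambda>s. s k) (mat 1 1 (\<lambda>_. s)) = mat 1 1 (\<lambda>_. s k)" for k by (rule eq_matI) auto
  moreover have "mat 1 1 (\<lambda>_. s) \<in> matrices CS 1 1" by (rule matrices_I) (use assms in auto)
  ultimately show ?thesis using CS_mnorm_tendsto[of "mat 1 1 (\<lambda>_. s)" 1] by (simp add: vnorm_def)
qed

lemma CS_mspace: "mspace CS"
proof (rule mspace.intro[OF CS_abelian], unfold_locales)
  fix s t c d assume s: "s \<in> carrier CS"
  show "c \<odot>\<^bsub>CS\<^esub> s \<in> carrier CS" using s by (simp add: CS_simps CS_smult)
  show "(c + d) \<odot>\<^bsub>CS\<^esub> s = c \<odot>\<^bsub>CS\<^esub> s \<oplus>\<^bsub>CS\<^esub> d \<odot>\<^bsub>CS\<^esub> s"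
    "c \<odot>\<^bsub>CS\<^esub> (d \<odot>\<^bsub>CS\<^esub> s) = (c * d) \<odot>\<^bsub>CS\<^esub> s" "1 \<odot>\<^bsub>CS\<^esub> s = s"
    using s by (simp_all add: CS_simps add_smult smult_smult one_smult CS_D)
  assume t: "t \<in> carrier CS"
  show "c \<odot>\<^bsub>CS\<^esub> (s \<oplus>\<^bsub>CS\<^esub> t) = c \<odot>\<^bsub>CS\<^esub> s \<oplus>\<^bsub>CS\<^esub> c \<odot>\<^bsub>CS\<^esub> t"
    using s t by (simp add: CS_simps smult_add CS_D)
next
  fix S :: "(nat \<Rightarrow> 'a) mat" and n assume S: "S \<in> matrices CS n n"
  note lS = CS_mnorm_tendsto[OF S]
  show "0 \<le> mnorm CS S"
    by (rule LIMSEQ_le_const[OF lS]) (use mnorm_nonneg[OF CS_mat[OF S]] in blast)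
  show "mnorm CS S \<le> (\<Sum>i<n. \<Sum>j<n. vnorm CS (S $$ (i, j)))"
  proof (rule LIMSEQ_le[OF lS])
    show "(\<lambda>k. \<Sum>i<n. \<Sum>j<n. vnorm V ((S $$ (i, j)) k)) \<longlonglongrightarrow> (\<Sum>i<n. \<Sum>j<n. vnorm CS (S $$ (i, j)))"
      using matrices_D(3)[OF S] by (intro tendsto_sum CS_vnorm_tendsto) auto
    show "\<exists>N. \<forall>k\<ge>N. mnorm V (map_mat (\<lambda>s. s k) S) \<le> (\<Sum>i<n. \<Sum>j<n. vnorm V ((S $$ (i, j)) k))"
      using mnorm_entries[OF CS_mat[OF S]] matrices_D(1,2)[OF S] by (intro exI[of _ 0]) simp
  qed
  show "mnorm CS (mat_scale CS c S) \<le> cmod c * mnorm CS S" for c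
  proof (rule LIMSEQ_le)
    have "mat_scale CS c S \<in> matrices CS n n"
      using S by (intro matrices_I) (auto simp: mat_scale_def matrices_D CS_simps(3) CS_smult)
    then show "(\<lambda>k. mnorm V (map_mat (\<lambda>s. s k) (mat_scale CS c S))) \<longlonglongrightarrow> mnorm CS (mat_scale CS c S)"
      by (rule CS_mnorm_tendsto)
    show "(\<lambda>k. cmod c * mnorm V (map_mat (\<lambda>s. s k) S)) \<longlonglongrightarrow> cmod c * mnorm CS S"
      by (intro tendsto_intros lS)
    have "map_mat (\<lambda>s. s k) (mat_scale CS c S) = mat_scale V c (map_mat (\<lambda>s. s k) S)" for k
      by (rule eq_matI) (auto simp: mat_scale_def CS_simps(3))
    then show "\<exists>N. \<forall>k\<ge>N. mnorm V (map_mat (\<lambda>s. s k) (mat_scale CS c S)) \<le> cmod c * mnorm V (map_mat (\<lambda>s. s k) S)"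
      using mnorm_scale[OF CS_mat[OF S]] by simp
  qed
  fix T :: "(nat \<Rightarrow> 'a) mat" assume T: "T \<in> matrices CS n n"
  show "mnorm CS (mat_add CS S T) \<le> mnorm CS S + mnorm CS T"
  proof (rule LIMSEQ_le)
    have "mat_add CS S T \<in> matrices CS n n"
      using S T by (intro matrices_I) (auto simp: mat_add_def matrices_D CS_simps(2) CS_add)
    then show "(\<lambda>k. mnorm V (map_mat (\<lambda>s. s k) (mat_add CS S T))) \<longlonglongrightarrow> mnorm CS (mat_add CS S T)"
      by (rule CS_mnorm_tendsto)
    show "(\<lambda>k. mnorm V (map_mat (\<lambda>s. s k) S) + mnorm V (map_mat (\<lambda>s. s k) T)) \<longlonglongrightarrow> mnorm CS S + mnorm CS T"
      by (intro tendsto_intros lS CS_mnorm_tendsto[OF T])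
    have "map_mat (\<lambda>s. s k) (mat_add CS S T) = mat_add V (map_mat (\<lambda>s. s k) S) (map_mat (\<lambda>s. s k) T)" for k
      by (rule eq_matI) (use matrices_D(1,2)[OF S] matrices_D(1,2)[OF T] in \<open>auto simp: mat_add_def CS_simps(2)\<close>)
    then show "\<exists>N. \<forall>k\<ge>N. mnorm V (map_mat (\<lambda>s. s k) (mat_add CS S T)) \<le> mnorm V (map_mat (\<lambda>s. s k) S) + mnorm V (map_mat (\<lambda>s. s k) T)"
      using mnorm_add[OF CS_mat[OF S] CS_mat[OF T]] by simp
  qed
qed

text \<open>A null sequence is Cauchy by the triangle inequality, so the null sequences are exactly
  the kernel of the seminorm; that they form a subspace follows from the seminorm
  inequalities.\<close>

lemma null_sequences_iff: "s \<in> null_sequences V \<longleftrightarrow> s \<in> carrier CS \<and> vnorm CS s = 0"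
proof
  assume "s \<in> null_sequences V"
  then have s: "\<And>k. s k \<in> carrier V" "(\<lambda>k. vnorm V (s k)) \<longlonglongrightarrow> 0" by (auto simp: null_sequences_def)
  have "\<exists>K. \<forall>m\<ge>K. \<forall>n\<ge>K. vnorm V (s m \<ominus> s n) < e" if e: "0 < e" for e
  proof -
    have "eventually (\<lambda>k. vnorm V (s k) < e / 2) sequentially" by (rule order_tendstoD[OF s(2)]) (use e in simp)
    then obtain K where K: "\<And>k. K \<le> k \<Longrightarrow> vnorm V (s k) < e / 2" by (auto simp: eventually_sequentially)
    have "vnorm V (s m \<ominus> s n) < e" if "K \<le> m" "K \<le> n" for m n
      using vnorm_minus[OF s(1) s(1), of m n] K[OF that(1)] K[OF that(2)] by linarith
    then show ?thesis by blast
  qed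
  then have c: "s \<in> carrier CS" using s(1) by (simp add: CS_carrier)
  then show "s \<in> carrier CS \<and> vnorm CS s = 0" using LIMSEQ_unique[OF CS_vnorm_tendsto[OF c] s(2)] by simp
next
  assume "s \<in> carrier CS \<and> vnorm CS s = 0"
  then show "s \<in> null_sequences V" using CS_vnorm_tendsto[of s] by (auto simp: null_sequences_def CS_D)
qed

lemma null_msubspace: "msubspace CS (null_sequences V)"
proof -
  interpret C: mspace CS by (rule CS_mspace)
  have *: "x \<in> null_sequences V" if "x \<in> carrier CS" "vnorm CS x \<le> 0" for x
    using C.vnorm_nonneg[OF that(1)] that by (simp add: null_sequences_iff)
  show ?thesis
    unfolding msubspace_def
  proof (intro conjI ballI allI)
    show "null_sequences V \<subseteq> carrier CS" by (auto simp: null_sequences_iff)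
    show "\<zero>\<^bsub>CS\<^esub> \<in> null_sequences V" by (simp add: null_sequences_iff C.vnorm_zero)
    fix x assume "x \<in> null_sequences V"
    then have x: "x \<in> carrier CS" "vnorm CS x = 0" by (auto simp: null_sequences_iff)
    show "c \<odot>\<^bsub>CS\<^esub> x \<in> null_sequences V" for c
      using C.vnorm_smult[OF x(1), of c] x by (intro *) auto
    fix y assume "y \<in> null_sequences V"
    then have y: "y \<in> carrier CS" "vnorm CS y = 0" by (auto simp: null_sequences_iff)
    show "x \<oplus>\<^bsub>CS\<^esub> y \<in> null_sequences V"
      using C.vnorm_add[OF x(1) y(1)] x y by (intro *) auto
  qed
qed

lemma CS_const_mnorm:
  assumes "x \<in> matrices V n n"
  shows "map_mat (\<lambda>v _. v) x \<in> matrices CS n n" "mnorm CS (map_mat (\<lambda>v _. v) x) = mnorm V x"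
proof -
  show *: "map_mat (\<lambda>v _. v) x \<in> matrices CS n n"
    by (rule matrices_I) (auto simp: matrices_D[OF assms] intro!: CS_const)
  have "map_mat (\<lambda>s. s k) (map_mat (\<lambda>v _. v) x) = x" for k :: nat by (rule eq_matI) auto
  then have "(\<lambda>k::nat. mnorm V (map_mat (\<lambda>s. s k) (map_mat (\<lambda>v _. v) x))) = (\<lambda>_. mnorm V x)"
    by (intro ext arg_cong[of _ _ "mnorm V"])
  then have "(\<lambda>_::nat. mnorm V x) \<longlonglongrightarrow> mnorm CS (map_mat (\<lambda>v _. v) x)"
    using CS_mnorm_tendsto[OF *] by simp
  then show "mnorm CS (map_mat (\<lambda>v _. v) x) = mnorm V x" by (simp add: LIMSEQ_const_iff)
qed

text \<open>In the seminorm a Cauchy sequence is the limit of the constant sequences formed from its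
  terms. A bounded functional is therefore determined by its values on constant sequences.\<close>

lemma CS_functional_limit:
  assumes g: "linear_functional CS g" and bd: "\<And>s. s \<in> carrier CS \<Longrightarrow> cmod (g s) \<le> C * vnorm CS s" "0 \<le> C"
    and s: "s \<in> carrier CS"
  shows "(\<lambda>m. g (\<lambda>_. s m)) \<longlonglongrightarrow> g s"
proof (rule metric_LIMSEQ_I)
  interpret C: mspace CS by (rule CS_mspace)
  fix e :: real assume e: "0 < e"
  define d where "d = e / (2 * (C + 1))"
  have d: "d > 0" "C * d < e" using e bd(2) by (auto simp: d_def divide_less_eq)
  obtain K where K: "\<And>m n. K \<le> m \<Longrightarrow> K \<le> n \<Longrightarrow> vnorm V (s m \<ominus> s n) < d"
    using s d(1) unfolding CS_carrier by blast
  have "dist (g (\<lambda>_. s m)) (g s) < e" if m: "K \<le> m" for m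
  proof -
    have c: "(\<lambda>_. s m) \<in> carrier CS" using s by (simp add: CS_const CS_D)
    have "vnorm CS ((\<lambda>_. s m) \<ominus>\<^bsub>CS\<^esub> s) \<le> d"
    proof (rule LIMSEQ_le_const2[OF CS_vnorm_tendsto])
      show "(\<lambda>_. s m) \<ominus>\<^bsub>CS\<^esub> s \<in> carrier CS" using c s by simp
      show "\<exists>N. \<forall>n\<ge>N. vnorm V (((\<lambda>_. s m) \<ominus>\<^bsub>CS\<^esub> s) n) \<le> d"
        using K[OF m] c s by (intro exI[of _ K]) (auto simp: CS_minus less_imp_le)
    qed
    then have "C * vnorm CS ((\<lambda>_. s m) \<ominus>\<^bsub>CS\<^esub> s) \<le> C * d" by (intro mult_left_mono bd(2))
    then have "cmod (g ((\<lambda>_. s m) \<ominus>\<^bsub>CS\<^esub> s)) \<le> C * d"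
      using bd(1)[of "(\<lambda>_. s m) \<ominus>\<^bsub>CS\<^esub> s"] c s by simp
    then show ?thesis using C.functional_minus[OF g c s] d(2) by (simp add: dist_norm)
  qed
  then show "\<exists>N. \<forall>n\<ge>N. dist (g (\<lambda>_. s n)) (g s) < e" by blast
qed

text \<open>A bounded functional carries Cauchy sequences to Cauchy sequences of numbers, and its
  constant \<open>C\<close> survives the limit.\<close>

lemma CS_functional_extend:
  assumes f: "linear_functional V f" and bd: "\<And>v. v \<in> carrier V \<Longrightarrow> cmod (f v) \<le> C * vnorm V v" "0 \<le> C"
  shows "\<exists>g. linear_functional CS g \<and> (\<forall>s\<in>carrier CS. (\<lambda>k. f (s k)) \<longlonglongrightarrow> g s) \<and>
    (\<forall>s\<in>carrier CS. cmod (g s) \<le> C * vnorm CS s)"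
proof -
  define g where "g s = lim (\<lambda>k. f (s k))" for s
  have g: "(\<lambda>k. f (s k)) \<longlonglongrightarrow> g s" if s: "s \<in> carrier CS" for s
  proof -
    have "Cauchy (\<lambda>k. f (s k))"
    proof (rule metric_CauchyI)
      fix e :: real assume e: "0 < e"
      define d where "d = e / (C + 1)"
      have d: "d > 0" "(C + 1) * d = e" using e bd(2) by (auto simp: d_def)
      obtain K where K: "\<And>m n. K \<le> m \<Longrightarrow> K \<le> n \<Longrightarrow> vnorm V (s m \<ominus> s n) < d"
        using s d(1) unfolding CS_carrier by blast
      have "dist (f (s m)) (f (s n)) < e" if "K \<le> m" "K \<le> n" for m n
      proof -
        have sc: "s m \<in> carrier V" "s n \<in> carrier V" using s CS_D by auto
        have "dist (f (s m)) (f (s n)) = cmod (f (s m \<ominus> s n))"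
          using functional_minus[OF f sc] by (simp add: dist_norm)
        also have "\<dots> \<le> C * vnorm V (s m \<ominus> s n)" using bd(1) sc by simp
        also have "\<dots> \<le> (C + 1) * vnorm V (s m \<ominus> s n)" using sc by (intro mult_right_mono vnorm_nonneg) auto
        also have "\<dots> < (C + 1) * d" using K[OF that] bd(2) by (intro mult_strict_left_mono) auto
        finally show ?thesis using d(2) by simp
      qed
      then show "\<exists>M. \<forall>m\<ge>M. \<forall>n\<ge>M. dist (f (s m)) (f (s n)) < e" by blast
    qed
    then show ?thesis unfolding g_def by (simp add: Cauchy_convergent_iff convergent_LIMSEQ_iff)
  qed
  have "linear_functional CS g"
    unfolding linear_functional_def
  proof (intro conjI ballI allI)
    fix s t assume s: "s \<in> carrier CS" "t \<in> carrier CS"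
    have "(\<lambda>k. f ((s \<oplus>\<^bsub>CS\<^esub> t) k)) = (\<lambda>k. f (s k) + f (t k))"
      using f s unfolding linear_functional_def by (simp add: CS_simps CS_D)
    then have "(\<lambda>k. f ((s \<oplus>\<^bsub>CS\<^esub> t) k)) \<longlonglongrightarrow> g s + g t" using tendsto_add[OF g[OF s(1)] g[OF s(2)]] by simp
    moreover have "s \<oplus>\<^bsub>CS\<^esub> t \<in> carrier CS" using s by (simp add: CS_simps CS_add)
    ultimately show "g (s \<oplus>\<^bsub>CS\<^esub> t) = g s + g t" using LIMSEQ_unique g by blast
  next
    fix c s assume s: "s \<in> carrier CS"
    have "(\<lambda>k. f ((c \<odot>\<^bsub>CS\<^esub> s) k)) = (\<lambda>k. c * f (s k))"
      using f s unfolding linear_functional_def by (simp add: CS_simps CS_D)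
    then have "(\<lambda>k. f ((c \<odot>\<^bsub>CS\<^esub> s) k)) \<longlonglongrightarrow> c * g s" using tendsto_mult_left[OF g[OF s]] by simp
    moreover have "c \<odot>\<^bsub>CS\<^esub> s \<in> carrier CS" using s by (simp add: CS_simps CS_smult)
    ultimately show "g (c \<odot>\<^bsub>CS\<^esub> s) = c * g s" using LIMSEQ_unique g by blast
  qed
  moreover have "cmod (g s) \<le> C * vnorm CS s" if s: "s \<in> carrier CS" for s
    by (rule LIMSEQ_le[OF tendsto_norm[OF g[OF s]] tendsto_mult_left[OF CS_vnorm_tendsto[OF s]]])
      (use bd(1) CS_D[OF s] in blast)
  ultimately show ?thesis using g by blast
qed

end

section \<open>Linear spans, closures and functionals vanishing on them\<close>

lemma lin_span_closed:
  assumes "mspace V" "S \<subseteq> carrier V"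
  shows "msubspace V (lin_span V S)"
proof -
  interpret mspace V by fact
  have fs: "finsum V f {..<n} \<in> carrier V" if "\<And>k. k < n \<Longrightarrow> f k \<in> carrier V" for f n
    using that by (intro finsum_closed) auto
  \<comment> \<open>Linear combinations are indexed by initial segments of the naturals, so the sum
    of two of them is indexed by the concatenated segment.\<close>
  have split: "finsum V f {..<n} \<oplus>\<^bsub>V\<^esub> finsum V g {..<m} = finsum V (\<lambda>k. if k < n then f k else g (k - n)) {..<n + m}"
    if f: "\<And>k. k < n \<Longrightarrow> f k \<in> carrier V" and g: "\<And>k. k < m \<Longrightarrow> g k \<in> carrier V" for f g and n m :: nat
    using g
  proof (induction m)
    case 0
    have "finsum V f {..<n} = finsum V (\<lambda>k. if k < n then f k else g (k - n)) {..<n}"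
      using f by (intro finsum_cong) (auto simp: simp_implies_def)
    moreover have "finsum V f {..<n} \<in> carrier V" using fs f by blast
    ultimately show ?case by simp
  next
    case (Suc m)
    define h where "h k = (if k < n then f k else g (k - n))" for k
    have h: "h k \<in> carrier V" if "k < n + Suc m" for k using f Suc.prems that by (auto simp: h_def)
    have "finsum V g {..<Suc m} = g m \<oplus>\<^bsub>V\<^esub> finsum V g {..<m}"
      unfolding lessThan_Suc using Suc.prems by (intro finsum_insert) auto
    moreover have "finsum V h {..<n + Suc m} = h (n + m) \<oplus>\<^bsub>V\<^esub> finsum V h {..<n + m}"
      unfolding add_Suc_right lessThan_Suc using h by (intro finsum_insert) auto
    moreover have "h (n + m) = g m" by (simp add: h_def)
    moreover have "finsum V f {..<n} \<oplus>\<^bsub>V\<^esub> finsum V g {..<m} = finsum V h {..<n + m}"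
      unfolding h_def using Suc by auto
    moreover have "finsum V f {..<n} \<in> carrier V" "finsum V g {..<m} \<in> carrier V" "g m \<in> carrier V"
      using fs f Suc.prems by auto
    ultimately show ?case unfolding h_def[symmetric] by (metis a_lcomm)
  qed
  show ?thesis
    unfolding msubspace_def
  proof (intro conjI ballI allI)
    show "lin_span V S \<subseteq> carrier V" using assms(2) by (auto simp: lin_span_def Pi_iff intro!: fs)
    show "\<zero>\<^bsub>V\<^esub> \<in> lin_span V S" unfolding lin_span_def
      by (rule CollectI, rule exI[of _ "0::nat"]) auto
    fix x assume "x \<in> lin_span V S"
    then obtain n c s where x: "s \<in> {..<n::nat} \<rightarrow> S" "x = finsum V (\<lambda>k. c k \<odot>\<^bsub>V\<^esub> s k) {..<n}" by (auto simp: lin_span_def)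
    have sc: "s k \<in> carrier V" if "k < n" for k using x(1) assms(2) that by auto
    {
      fix y assume "y \<in> lin_span V S"
      then obtain m d t where y: "t \<in> {..<m::nat} \<rightarrow> S" "y = finsum V (\<lambda>k. d k \<odot>\<^bsub>V\<^esub> t k) {..<m}" by (auto simp: lin_span_def)
      have tc: "t k \<in> carrier V" if "k < m" for k using y(1) assms(2) that by auto
      define u where "u k = (if k < n then s k else t (k - n))" for k
      define e where "e k = (if k < n then c k else d (k - n))" for k
      have "x \<oplus>\<^bsub>V\<^esub> y = finsum V (\<lambda>k. if k < n then c k \<odot>\<^bsub>V\<^esub> s k else d (k - n) \<odot>\<^bsub>V\<^esub> t (k - n)) {..<n + m}"
        unfolding x(2) y(2) using sc tc by (intro split) auto
      also have "\<dots> = finsum V (\<lambda>k. e k \<odot>\<^bsub>V\<^esub> u k) {..<n + m}"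
        by (intro finsum_cong) (use sc tc in \<open>auto simp: e_def u_def simp_implies_def\<close>)
      finally show "x \<oplus>\<^bsub>V\<^esub> y \<in> lin_span V S"
        unfolding lin_span_def using x(1) y(1)
        by (intro CollectI exI[of _ "n + m"] exI[of _ e] exI[of _ u]) (auto simp: u_def Pi_iff)
    }
    fix a
    have "a \<odot>\<^bsub>V\<^esub> finsum V f {..<j} = finsum V (\<lambda>k. a \<odot>\<^bsub>V\<^esub> f k) {..<j}"
      if "\<And>k. k < j \<Longrightarrow> f k \<in> carrier V" for f and j :: nat
      using that
    proof (induction j)
      case (Suc j)
      then show ?case
        using fs[of j f] by (simp add: lessThan_Suc finsum_insert smult_add Pi_def)
    qed (simp add: smult_zero)
    then have "a \<odot>\<^bsub>V\<^esub> x = finsum V (\<lambda>k. a \<odot>\<^bsub>V\<^esub> (c k \<odot>\<^bsub>V\<^esub> s k)) {..<n}"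
      using sc by (simp add: x(2))
    also have "\<dots> = finsum V (\<lambda>k. (a * c k) \<odot>\<^bsub>V\<^esub> s k) {..<n}"
      by (intro finsum_cong) (use sc in \<open>auto simp: smult_smult simp_implies_def\<close>)
    finally show "a \<odot>\<^bsub>V\<^esub> x \<in> lin_span V S"
      unfolding lin_span_def using x(1) by (intro CollectI exI[of _ n] exI[of _ "\<lambda>k. a * c k"] exI[of _ s]) auto
  qed
qed

lemma norm_closure_msubspace:
  assumes "mspace V" "msubspace V S"
  shows "msubspace V (norm_closure V S)"
proof -
  interpret mspace V by fact
  have S: "\<And>x. x \<in> S \<Longrightarrow> x \<in> carrier V" "\<zero>\<^bsub>V\<^esub> \<in> S" "\<And>x y. x \<in> S \<Longrightarrow> y \<in> S \<Longrightarrow> x \<oplus>\<^bsub>V\<^esub> y \<in> S"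
    "\<And>c x. x \<in> S \<Longrightarrow> c \<odot>\<^bsub>V\<^esub> x \<in> S"
    using assms(2) by (auto simp: msubspace_def)
  have clo: "\<exists>s\<in>S. vnorm V (x \<ominus>\<^bsub>V\<^esub> s) < e" if "x \<in> norm_closure V S" "0 < e" for x e
    using that by (simp add: norm_closure_def)
  show ?thesis
    unfolding msubspace_def
  proof (intro conjI ballI allI)
    show "norm_closure V S \<subseteq> carrier V" by (auto simp: norm_closure_def)
    show "\<zero>\<^bsub>V\<^esub> \<in> norm_closure V S"
      using S(2) minus_one_smult[of "\<zero>\<^bsub>V\<^esub>"]
      by (auto simp: norm_closure_def a_minus_def vnorm_zero smult_zero intro!: bexI[of _ "\<zero>\<^bsub>V\<^esub>"])
    fix x assume x: "x \<in> norm_closure V S"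
    then have xc: "x \<in> carrier V" by (simp add: norm_closure_def)
    {
      fix y assume y: "y \<in> norm_closure V S"
      then have yc: "y \<in> carrier V" by (simp add: norm_closure_def)
      have "\<exists>s\<in>S. vnorm V (x \<oplus>\<^bsub>V\<^esub> y \<ominus>\<^bsub>V\<^esub> s) < e" if e: "0 < e" for e
      proof -
        obtain s where s: "s \<in> S" "vnorm V (x \<ominus>\<^bsub>V\<^esub> s) < e / 2"
          using clo[OF x, of "e / 2"] e by auto
        obtain t where t: "t \<in> S" "vnorm V (y \<ominus>\<^bsub>V\<^esub> t) < e / 2"
          using clo[OF y, of "e / 2"] e by auto
        have "vnorm V (x \<oplus>\<^bsub>V\<^esub> y \<ominus>\<^bsub>V\<^esub> (s \<oplus>\<^bsub>V\<^esub> t)) \<le> vnorm V (x \<ominus>\<^bsub>V\<^esub> s) + vnorm V (y \<ominus>\<^bsub>V\<^esub> t)"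
          using xc yc S(1) s(1) t(1) by (simp add: add_minus_add vnorm_add)
        then show ?thesis using s t S(3) by (intro bexI[of _ "s \<oplus>\<^bsub>V\<^esub> t"]) auto
      qed
      then show "x \<oplus>\<^bsub>V\<^esub> y \<in> norm_closure V S" using xc yc by (simp add: norm_closure_def)
    }
    fix c
    have "\<exists>s\<in>S. vnorm V (c \<odot>\<^bsub>V\<^esub> x \<ominus>\<^bsub>V\<^esub> s) < e" if e: "0 < e" for e
    proof -
      have p: "0 < cmod c + 1" by (simp add: add_nonneg_pos)
      then have "0 < e / (cmod c + 1)" using e by simp
      then obtain s where s: "s \<in> S" "vnorm V (x \<ominus>\<^bsub>V\<^esub> s) < e / (cmod c + 1)"
        using x unfolding norm_closure_def by blast
      have "vnorm V (c \<odot>\<^bsub>V\<^esub> x \<ominus>\<^bsub>V\<^esub> c \<odot>\<^bsub>V\<^esub> s) \<le> cmod c * vnorm V (x \<ominus>\<^bsub>V\<^esub> s)"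
        using vnorm_smult[of "x \<ominus>\<^bsub>V\<^esub> s" c] xc S(1)[OF s(1)] by (simp add: smult_minus)
      also have "\<dots> \<le> (cmod c + 1) * vnorm V (x \<ominus>\<^bsub>V\<^esub> s)"
        using xc S(1)[OF s(1)] by (intro mult_right_mono vnorm_nonneg) auto
      also have "\<dots> < (cmod c + 1) * (e / (cmod c + 1))" using s(2) p by (intro mult_strict_left_mono) auto
      finally show ?thesis using s(1) S(4) p by (intro bexI[of _ "c \<odot>\<^bsub>V\<^esub> s"]) auto
    qed
    then show "c \<odot>\<^bsub>V\<^esub> x \<in> norm_closure V S" using xc by (simp add: norm_closure_def)
  qed
qed

text \<open>The kernel of a bounded functional is a closed subspace. It suffices therefore to check
  the balancing relations on generators to obtain a functional that vanishes on the whole balanced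
  kernel.\<close>

lemma functional_zero_closure:
  assumes "mspace V" "S \<subseteq> carrier V" and g: "linear_functional V g" "\<And>s. s \<in> S \<Longrightarrow> g s = 0"
    and bd: "\<And>x. x \<in> carrier V \<Longrightarrow> cmod (g x) \<le> C * vnorm V x" "0 \<le> C"
    and x: "x \<in> norm_closure V (lin_span V S)"
  shows "g x = 0"
proof -
  interpret mspace V by fact
  have gadd: "\<And>x y. x \<in> carrier V \<Longrightarrow> y \<in> carrier V \<Longrightarrow> g (x \<oplus>\<^bsub>V\<^esub> y) = g x + g y"
    "\<And>c x. x \<in> carrier V \<Longrightarrow> g (c \<odot>\<^bsub>V\<^esub> x) = c * g x"
    using g(1) by (auto simp: linear_functional_def)
  have g0: "g \<zero>\<^bsub>V\<^esub> = 0" using gadd(2)[of "\<zero>\<^bsub>V\<^esub>" 0] by (simp add: smult_zero)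
  have "g (finsum V (\<lambda>k. c k \<odot>\<^bsub>V\<^esub> s k) {..<n}) = 0" if "s \<in> {..<n::nat} \<rightarrow> S" for c s n
    using that
  proof (induction n)
    case (Suc n)
    have sc: "s k \<in> carrier V" if "k < Suc n" for k using Suc.prems assms(2) that by auto
    have "finsum V (\<lambda>k. c k \<odot>\<^bsub>V\<^esub> s k) {..<Suc n} = c n \<odot>\<^bsub>V\<^esub> s n \<oplus>\<^bsub>V\<^esub> finsum V (\<lambda>k. c k \<odot>\<^bsub>V\<^esub> s k) {..<n}"
      unfolding lessThan_Suc using sc by (intro finsum_insert) auto
    moreover have "finsum V (\<lambda>k. c k \<odot>\<^bsub>V\<^esub> s k) {..<n} \<in> carrier V" using sc by (intro finsum_closed) auto
    moreover have "g (s n) = 0" using g(2) Suc.prems by auto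
    moreover have "s \<in> {..<n} \<rightarrow> S" using Suc.prems by auto
    ultimately show ?case using Suc.IH sc[of n] by (auto simp: gadd)
  qed (simp add: g0)
  then have span: "g y = 0" if "y \<in> lin_span V S" for y using that by (auto simp: lin_span_def)
  have spc: "lin_span V S \<subseteq> carrier V" using lin_span_closed[OF assms(1,2)] by (simp add: msubspace_def)
  have xc: "x \<in> carrier V" using x by (simp add: norm_closure_def)
  have "cmod (g x) \<le> 0"
  proof (rule field_le_epsilon)
    fix e :: real assume "0 < e"
    then have e: "0 < e / (C + 1)" using bd(2) by simp
    then obtain s where s: "s \<in> lin_span V S" "vnorm V (x \<ominus>\<^bsub>V\<^esub> s) < e / (C + 1)"
      using x unfolding norm_closure_def by blast
    have sc: "s \<in> carrier V" using s spc by blast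
    have "cmod (g x) = cmod (g (x \<ominus>\<^bsub>V\<^esub> s))" using functional_minus[OF g(1) xc sc] span[OF s(1)] by simp
    also have "\<dots> \<le> C * vnorm V (x \<ominus>\<^bsub>V\<^esub> s)" using bd(1) xc sc by simp
    also have "\<dots> \<le> (C + 1) * vnorm V (x \<ominus>\<^bsub>V\<^esub> s)" using xc sc by (intro mult_right_mono vnorm_nonneg) auto
    also have "\<dots> \<le> (C + 1) * (e / (C + 1))" using s(2) bd(2) by (intro mult_left_mono) auto
    finally show "cmod (g x) \<le> 0 + e" using bd(2) by simp
  qed
  then show ?thesis by simp
qed

subsection \<open>The Haagerup norm on \<open>OH \<otimes> OH\<close>\<close>

lemma times_funit_right: "(\<And>i j. k \<le> j \<Longrightarrow> entry A i j = 0) \<Longrightarrow> A * funit k = A"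
  by (rule fmat_eqI) (auto simp: entry_times[OF disjI2[OF in_size_funit[OF order_refl]]] sum_funit not_less)

lemma oh_bound_cong: "(\<And>s. s \<in> A \<Longrightarrow> a s = b s) \<Longrightarrow> oh_bound A a L \<longleftrightarrow> oh_bound A b L"
  by (simp add: oh_bound_def sform_def)

lemma oh_bound_support:
  assumes F: "finite F" "\<And>s. s \<notin> F \<Longrightarrow> a s = 0" and L: "0 \<le> L" "oh_bound F a L" and A: "finite A"
  shows "oh_bound A a L"
proof -
  have "sform A a a Z W = sform (A \<inter> F) a a Z W" for Z W
    unfolding sform_def using A F(2) by (intro sum.mono_neutral_right) auto
  then show ?thesis using oh_bound_subset[OF F(1) _ L, of "A \<inter> F"] by (simp add: oh_bound_def)
qed

text \<open>Multiplication by it from the right moves the first \<open>n\<close> columns to the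
  positions from \<open>k\<close> on. It is the partial isometry from which rows of blocks are
  assembled.\<close>

definition fshift :: "nat \<Rightarrow> nat \<Rightarrow> fmat" where
  "fshift n k = fmat_of (n + k) (\<lambda>i j. if i < n \<and> j = k + i then 1 else 0)"

lemma entry_fshift: "entry (fshift n k) i j = (if i < n \<and> j = k + i then 1 else 0)"
  by (auto simp: fshift_def)

lemma in_size_fshift [simp]: "in_size (n + k) (fshift n k)" by (simp add: fshift_def)

lemma sum_if_and:
  "(\<Sum>k<n. if P \<and> k = (j::nat) then f k else 0) = (if P \<and> j < n then f j else (0::complex))"
  by (cases P) auto

lemma entry_times_fshift: "entry (A * fshift n k) i j = (if k \<le> j \<and> j < n + k then entry A i (j - k) else 0)"
proof -
  have "entry (A * fshift n k) i j = (\<Sum>l<n + k. if (k \<le> j \<and> j < n + k) \<and> l = j - k then entry A i l else 0)"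
    by (subst entry_times[of "n + k"]) (auto simp: entry_fshift intro!: sum.cong)
  then show ?thesis unfolding sum_if_and by auto
qed

lemma entry_times_adj_fshift: "entry (A * adj (fshift n k)) i j = (if j < n then entry A i (k + j) else 0)"
proof -
  have "entry (A * adj (fshift n k)) i j = (\<Sum>l<n + k. if j < n \<and> l = k + j then entry A i l else 0)"
    by (subst entry_times[of "n + k"]) (auto simp: entry_fshift intro!: sum.cong)
  then show ?thesis unfolding sum_if_and by auto
qed

lemma fshift_adj: "fshift n k * adj (fshift n k) = funit n"
  by (rule fmat_eqI) (auto simp: entry_times_adj_fshift entry_fshift entry_funit)

lemma fshift_partial_isometry:
  "adj (fshift n k) * fshift n k * (adj (fshift n k) * fshift n k) = adj (fshift n k) * fshift n k"
proof -
  have "adj (fshift n k) * funit n = adj (fshift n k)"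
    by (rule times_funit_right) (auto simp: entry_fshift)
  moreover have "adj (fshift n k) * fshift n k * (adj (fshift n k) * fshift n k)
    = adj (fshift n k) * (fshift n k * adj (fshift n k)) * fshift n k" by (simp only: mult.assoc)
  ultimately show ?thesis by (simp add: fshift_adj)
qed

text \<open>The columns of \<open>x\<close> end before \<open>k\<close> and those of
  \<open>y\<close> are shifted past them, so \<open>oh_bound_row\<close> applies with the
  projections onto the two ranges of columns.\<close>

lemma oh_bound_concat:
  assumes A: "finite A" and t: "0 \<le> t" "oh_bound A x t" and t': "0 \<le> t'" "oh_bound A y t'"
    and x: "\<And>s i j. s \<in> A \<Longrightarrow> k \<le> j \<Longrightarrow> entry (x s) i j = 0"
  shows "oh_bound A (\<lambda>s. x s + y s * fshift k' k) (t + t')"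
proof (rule oh_bound_row[OF A t t'(1) oh_bound_times_right[OF fshift_partial_isometry t'(2,1)]])
  show "funit k * funit k = funit k" "adj (funit k) = funit k" by (simp_all add: funit_times_funit)
  show "adj (funit (k + k') - funit k) = funit (k + k') - funit k" by simp
  show "(funit (k + k') - funit k) * (funit (k + k') - funit k) = funit (k + k') - funit k"
    "funit k * (funit (k + k') - funit k) = 0"
    by (simp_all add: left_diff_distrib right_diff_distrib funit_times_funit)
  show "x s * funit k = x s" if "s \<in> A" for s by (rule times_funit_right) (rule x[OF that])
  show "y s * fshift k' k * (funit (k + k') - funit k) = y s * fshift k' k" for s
  proof -
    have "fshift k' k * funit (k + k') = fshift k' k" by (rule times_funit_right) (auto simp: entry_fshift)
    moreover have "fshift k' k * funit k = 0"
      by (rule fmat_eqI) (auto simp: entry_times[OF disjI2[OF in_size_funit[OF order_refl]]] entry_fshift entry_funit intro!: sum.neutral)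
    ultimately show ?thesis by (simp add: right_diff_distrib mult.assoc)
  qed
qed

lemma mat_opnorm_1x1:
  assumes "dim_row A = 1" "dim_col A = 1" "A $$ (0, 0) = of_real c" "0 \<le> c"
  shows "mat_opnorm A = c"
proof -
  have l: "vec_l2norm (A *\<^sub>v v) = c * vec_l2norm v" if "v \<in> carrier_vec 1" for v
  proof -
    have "A *\<^sub>v v = of_real c \<cdot>\<^sub>v v"
      by (rule eq_vecI) (use assms that in \<open>auto simp: scalar_prod_def\<close>)
    then show ?thesis using assms(4) by (simp add: vec_l2norm_smult)
  qed
  have "mat_opnorm A \<le> c" by (rule mat_opnorm_le[OF assms(4)]) (use l assms in auto)
  moreover have "c * vec_l2norm (vec 1 (\<lambda>_. 1)) \<le> mat_opnorm A * vec_l2norm (vec 1 (\<lambda>_. 1))"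
    using mat_opnorm_bound[of "vec 1 (\<lambda>_. 1)" A] l[of "vec 1 (\<lambda>_. 1)"] assms by simp
  then have "c \<le> mat_opnorm A" by (simp add: vec_l2norm_def)
  ultimately show ?thesis by simp
qed

definition trunc :: "'i set \<Rightarrow> ('i \<Rightarrow> complex) \<Rightarrow> 'i \<Rightarrow> complex" where
  "trunc A x = (\<lambda>i. if i \<in> A then x i else 0)"

definition delta :: "'i \<Rightarrow> 'i \<Rightarrow> complex" where
  "delta i = (\<lambda>j. if j = i then 1 else 0)"

text \<open>The matrix norms of \<open>op_dual\<close> are suprema that are not known to be finite here; since
  \<open>Sup\<close> on the reals is the least upper bound, only the set of upper bounds matters.\<close>

lemma Sup_real_eqI:
  assumes "\<And>z. (\<forall>x\<in>A. x \<le> z) \<longleftrightarrow> (\<forall>x\<in>B. x \<le> z)"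
  shows "Sup A = Sup (B :: real set)"
  unfolding Sup_real_def assms ..

context
  fixes I :: "'i set"
begin

abbreviation H where "H \<equiv> alg_haagerup (OH I) (OH I)"
abbreviation el where "el \<equiv> elem_tensor (OH I) (OH I)"
abbreviation ell2 where "ell2 \<equiv> carrier (OH I)"
abbreviation Mat where "Mat \<equiv> matrices (OH I)"
abbreviation nrm where "nrm \<equiv> vnorm (OH I)"
abbreviation fins where "fins \<equiv> finite_subsets_at_top I"
abbreviation helem where "helem \<equiv> haagerup_elem (OH I) (OH I)"
abbreviation (input) ap where "ap \<equiv> mat_pairing (\<lambda>f v. f v)"
abbreviation tp where "tp \<equiv> tensor_matprod (OH I) (OH I)"

section \<open>Square summable families and elementary tensors\<close>

lemma OH_add: assumes "f \<in> ell2" "g \<in> ell2" shows "(\<lambda>i. f i + g i) \<in> ell2"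
proof -
  have "(\<lambda>i. (cmod (f i + g i))\<^sup>2) summable_on I"
  proof (rule summable_on_comparison_test)
    show "(\<lambda>i. 2 * (cmod (f i))\<^sup>2 + 2 * (cmod (g i))\<^sup>2) summable_on I"
      using assms by (intro summable_on_add summable_on_cmult_right) (auto simp: OH_simps)
    fix i
    have "(cmod (f i + g i))\<^sup>2 \<le> (cmod (f i) + cmod (g i))\<^sup>2" by (intro power_mono norm_triangle_ineq) auto
    also have "\<dots> \<le> 2 * (cmod (f i))\<^sup>2 + 2 * (cmod (g i))\<^sup>2"
      using zero_le_power2[of "cmod (f i) - cmod (g i)"] by (simp add: power2_eq_square algebra_simps)
    finally show "(cmod (f i + g i))\<^sup>2 \<le> 2 * (cmod (f i))\<^sup>2 + 2 * (cmod (g i))\<^sup>2" .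
  qed simp
  then show ?thesis using assms by (simp add: OH_simps)
qed

lemma OH_smult: assumes "f \<in> ell2" shows "(\<lambda>i. c * f i) \<in> ell2"
  using assms by (auto simp: OH_simps norm_mult power_mult_distrib intro!: summable_on_cmult_right)

text \<open>Square summable families are bounded, so a pointwise product of two of them is dominated
  by a multiple of one factor.\<close>

lemma OH_mult: assumes "f \<in> ell2" "g \<in> ell2" shows "(\<lambda>i. f i * g i) \<in> ell2"
proof -
  have f: "(\<lambda>i. (cmod (f i))\<^sup>2) summable_on I" using assms by (simp add: OH_simps)
  have le: "(cmod (f i))\<^sup>2 \<le> infsum (\<lambda>i. (cmod (f i))\<^sup>2) I" if "i \<in> I" for i
    using finite_sum_le_infsum[OF f, of "{i}"] that by simp
  have "(\<lambda>i. (cmod (f i * g i))\<^sup>2) summable_on I"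
  proof (rule summable_on_comparison_test)
    show "(\<lambda>i. infsum (\<lambda>i. (cmod (f i))\<^sup>2) I * (cmod (g i))\<^sup>2) summable_on I"
      using assms by (intro summable_on_cmult_right) (auto simp: OH_simps)
    show "(cmod (f i * g i))\<^sup>2 \<le> infsum (\<lambda>i. (cmod (f i))\<^sup>2) I * (cmod (g i))\<^sup>2" if "i \<in> I" for i
      unfolding norm_mult power_mult_distrib by (intro mult_right_mono le that) simp
  qed simp
  then show ?thesis using assms by (simp add: OH_simps)
qed

lemma OH_finite_support:
  assumes "finite F" "F \<subseteq> I" "\<And>i. i \<notin> F \<Longrightarrow> f i = 0" shows "f \<in> ell2"
proof -
  have "(\<lambda>i. (cmod (f i))\<^sup>2) summable_on F" using assms by (intro summable_on_finite)
  then have "(\<lambda>i. (cmod (f i))\<^sup>2) summable_on I"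
    by (subst summable_on_cong_neutral[of F I]) (use assms in auto)
  then show ?thesis using assms by (auto simp: OH_simps)
qed

lemma bilinear_D:
  assumes "B \<in> bilinear_forms (OH I) (OH I)" "x \<in> ell2" "y \<in> ell2"
  shows "x' \<in> ell2 \<Longrightarrow> B (\<lambda>i. x i + x' i) y = B x y + B x' y" "B (\<lambda>i. c * x i) y = c * B x y"
    "y' \<in> ell2 \<Longrightarrow> B x (\<lambda>i. y i + y' i) = B x y + B x y'" "B x (\<lambda>i. c * y i) = c * B x y"
proof -
  have l: "linear_functional (OH I) (\<lambda>x. B x y)" "linear_functional (OH I) (\<lambda>y. B x y)"
    using assms by (auto simp: bilinear_forms_def)
  show "x' \<in> ell2 \<Longrightarrow> B (\<lambda>i. x i + x' i) y = B x y + B x' y" "B (\<lambda>i. c * x i) y = c * B x y"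
    using l(1) assms(2) unfolding linear_functional_def OH_simps(3,4) by blast+
  show "y' \<in> ell2 \<Longrightarrow> B x (\<lambda>i. y i + y' i) = B x y + B x y'" "B x (\<lambda>i. c * y i) = c * B x y"
    using l(2) assms(3) unfolding linear_functional_def OH_simps(3,4) by blast+
qed

lemma el_add:
  assumes "x \<in> ell2" "x' \<in> ell2" "y \<in> ell2"
  shows "el (\<lambda>i. x i + x' i) y B = el x y B + el x' y B" "el y (\<lambda>i. x i + x' i) B = el y x B + el y x' B"
  using assms by (simp_all add: elem_tensor_def bilinear_D)

lemma el_smult:
  assumes "x \<in> ell2" "y \<in> ell2"
  shows "el (\<lambda>i. c * x i) y B = c * el x y B" "el x (\<lambda>i. c * y i) B = c * el x y B"
  using assms by (simp_all add: elem_tensor_def bilinear_D)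

lemma el_zero: "y \<in> ell2 \<Longrightarrow> el (\<lambda>_. 0) y B = 0" "y \<in> ell2 \<Longrightarrow> el y (\<lambda>_. 0) B = 0"
  using el_smult[OF zero_in_OH, of y 0 B] el_smult[OF _ zero_in_OH, of y 0 B] by simp_all

lemma H_simps:
  "\<zero>\<^bsub>H\<^esub> = (\<lambda>_. 0)" "u \<oplus>\<^bsub>H\<^esub> v = (\<lambda>B. u B + v B)" "c \<odot>\<^bsub>H\<^esub> u = (\<lambda>B. c * u B)"
  "mnorm H U = Inf {rect_mnorm (OH I) a * rect_mnorm (OH I) b | a b k.
     a \<in> Mat (dim_row U) k \<and> b \<in> Mat k (dim_col U) \<and> U = tp a b}"
  by (simp_all add: alg_haagerup_def)

lemma H_carrier: "u \<in> carrier H \<longleftrightarrow> (\<exists>(n::nat) x y. u = (\<lambda>B. \<Sum>k<n. el (x k) (y k) B) \<and>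
    (\<forall>k<n. x k \<in> ell2 \<and> y k \<in> ell2))"
  unfolding alg_haagerup_def by (simp add: Pi_iff) blast

lemma H_carrierI:
  "(\<And>k. k < n \<Longrightarrow> x k \<in> ell2) \<Longrightarrow> (\<And>k. k < n \<Longrightarrow> y k \<in> ell2) \<Longrightarrow>
    (\<lambda>B. \<Sum>k<n::nat. el (x k) (y k) B) \<in> carrier H"
  unfolding H_carrier by blast

lemma sum_lessThan_add:
  "(\<Sum>k<n + m::nat. f k) = (\<Sum>k<n. f k) + (\<Sum>k<m. f (n + k) :: 'b :: comm_monoid_add)"
  by (induction m) (simp_all add: add.assoc)

lemma H_add: assumes "u \<in> carrier H" "v \<in> carrier H" shows "(\<lambda>B. u B + v B) \<in> carrier H"
proof -
  obtain n x y where u: "u = (\<lambda>B. \<Sum>k<n::nat. el (x k) (y k) B)" "\<And>k. k < n \<Longrightarrow> x k \<in> ell2 \<and> y k \<in> ell2"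
    using assms(1) unfolding H_carrier by blast
  obtain m x' y' where v: "v = (\<lambda>B. \<Sum>k<m::nat. el (x' k) (y' k) B)" "\<And>k. k < m \<Longrightarrow> x' k \<in> ell2 \<and> y' k \<in> ell2"
    using assms(2) unfolding H_carrier by blast
  have "(\<lambda>B. u B + v B) = (\<lambda>B. \<Sum>k<n + m. el (if k < n then x k else x' (k - n)) (if k < n then y k else y' (k - n)) B)"
    by (simp add: u(1) v(1) sum_lessThan_add)
  also have "\<dots> \<in> carrier H" by (rule H_carrierI) (use u(2) v(2) in auto)
  finally show ?thesis .
qed

lemma H_smult: assumes "u \<in> carrier H" shows "(\<lambda>B. c * u B) \<in> carrier H"
proof -
  obtain n x y where u: "u = (\<lambda>B. \<Sum>k<n::nat. el (x k) (y k) B)" "\<And>k. k < n \<Longrightarrow> x k \<in> ell2 \<and> y k \<in> ell2"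
    using assms(1) unfolding H_carrier by blast
  have "(\<lambda>B. c * u B) = (\<lambda>B. \<Sum>k<n. el (\<lambda>i. c * x k i) (y k) B)"
    using u by (simp add: sum_distrib_left el_smult)
  also have "\<dots> \<in> carrier H" by (rule H_carrierI) (use u(2) OH_smult in auto)
  finally show ?thesis .
qed

lemma H_zero: "(\<lambda>_. 0) \<in> carrier H"
  unfolding H_carrier by (intro exI[of _ "0::nat"]) auto

lemma H_abelian: "abelian_group H"
proof (rule abelian_groupI)
  fix u assume u: "u \<in> carrier H"
  show "\<exists>v\<in>carrier H. v \<oplus>\<^bsub>H\<^esub> u = \<zero>\<^bsub>H\<^esub>"
    by (rule bexI[OF _ H_smult[OF u, of "- 1"]]) (simp add: H_simps)
qed (auto simp: H_simps H_add H_zero)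

section \<open>Factorizations and the norm inequalities of the Haagerup tensor product\<close>

lemma tp_index:
  "i < dim_row a \<Longrightarrow> j < dim_col b \<Longrightarrow> tp a b $$ (i, j) = (\<lambda>B. \<Sum>l<dim_col a. el (a $$ (i, l)) (b $$ (l, j)) B)"
  "dim_row (tp a b) = dim_row a" "dim_col (tp a b) = dim_col b"
  by (auto simp: tensor_matprod_def)

lemma tp_closed: "a \<in> Mat m k \<Longrightarrow> b \<in> Mat k n \<Longrightarrow> tp a b \<in> matrices H m n"
  by (rule matrices_I) (auto simp: tp_index matrices_D(1,2) intro!: H_carrierI matrices_D(3))

text \<open>This keeps the infimum in the Haagerup norm over a nonempty set. The inner index encodes
  triples \<open>(i', j', l)\<close>: the \<open>l\<close>-th elementary tensor of the entry at
  \<open>(i', j')\<close> gets its own slot, in row \<open>i'\<close> of \<open>a\<close> and column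
  \<open>j'\<close> of \<open>b\<close>.\<close>

lemma factorization_exists:
  assumes "U \<in> matrices H m n"
  shows "\<exists>a b k. a \<in> Mat m k \<and> b \<in> Mat k n \<and> U = tp a b"
proof -
  define R where "R i j N x y \<longleftrightarrow> U $$ (i, j) = (\<lambda>B. \<Sum>k<N. el (x k) (y k) B) \<and>
    (\<forall>k<N. x k \<in> ell2 \<and> y k \<in> ell2)" for i j and N :: nat and x y
  have "\<exists>N x y. R i j N x y" if "i < m" "j < n" for i j
    using matrices_D(3)[OF assms that] unfolding H_carrier R_def .
  then obtain N x y where "\<And>i j. i < m \<Longrightarrow> j < n \<Longrightarrow> R i j (N i j) (x i j) (y i j)" by metis
  then have U: "\<And>i j. i < m \<Longrightarrow> j < n \<Longrightarrow> U $$ (i, j) = (\<lambda>B. \<Sum>k<N i j. el (x i j k) (y i j k) B) \<and>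
    (\<forall>k<N i j. x i j k \<in> ell2 \<and> y i j k \<in> ell2)"
    unfolding R_def by blast
  then have xy: "\<And>i j k. i < m \<Longrightarrow> j < n \<Longrightarrow> k < N i j \<Longrightarrow> x i j k \<in> ell2 \<and> y i j k \<in> ell2"
    by blast
  define M where "M = (\<Sum>i<m. \<Sum>j<n. N i j)"
  have M: "N i j \<le> M" if "i < m" "j < n" for i j
  proof -
    have "N i j \<le> (\<Sum>j<n. N i j)" using that by (intro member_le_sum) auto
    also have "\<dots> \<le> M" unfolding M_def using that by (intro member_le_sum) auto
    finally show ?thesis .
  qed
  define a where "a = mat m (m * n * M) (\<lambda>(i, r). let p = r div M; l = r mod M; i' = p div n; j' = p mod n in
    if i = i' \<and> l < N i' j' then x i' j' l else (\<lambda>_. 0))"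
  define b where "b = mat (m * n * M) n (\<lambda>(r, j). let p = r div M; l = r mod M; i' = p div n; j' = p mod n in
    if j = j' \<and> l < N i' j' then y i' j' l else (\<lambda>_. 0))"
  have dm: "r div M div n < m \<and> r div M mod n < n" if "r < m * n * M" for r
  proof -
    have "0 < n" using that by (cases n) auto
    moreover have "r div M < m * n" using that by (simp add: less_mult_imp_div_less)
    ultimately show ?thesis by (simp add: less_mult_imp_div_less)
  qed
  have a: "a \<in> Mat m (m * n * M)"
  proof (rule matrices_I)
    fix i r assume "i < m" "r < m * n * M"
    then show "a $$ (i, r) \<in> ell2"
      using xy[of "r div M div n" "r div M mod n" "r mod M"] dm[of r] zero_in_OH[of I] by (simp add: a_def Let_def)
  qed (simp_all add: a_def)
  have b: "b \<in> Mat (m * n * M) n"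
  proof (rule matrices_I)
    fix r j assume "r < m * n * M" "j < n"
    then show "b $$ (r, j) \<in> ell2"
      using xy[of "r div M div n" "r div M mod n" "r mod M"] dm[of r] zero_in_OH[of I] by (simp add: b_def Let_def)
  qed (simp_all add: b_def)
  have "U = tp a b"
  proof (rule eq_matI)
    fix i j assume "i < dim_row (tp a b)" "j < dim_col (tp a b)"
    then have ij: "i < m" "j < n" by (auto simp: tp_index a_def b_def)
    have "(tp a b $$ (i, j)) B = (U $$ (i, j)) B" for B
    proof -
      define g where "g p l = (let i' = p div n; j' = p mod n in
        el (if i = i' \<and> l < N i' j' then x i' j' l else (\<lambda>_. 0)) (if j = j' \<and> l < N i' j' then y i' j' l else (\<lambda>_. 0)) B)" for p l
      define h where "h i' j' = (\<Sum>l<M. el (if i = i' \<and> l < N i' j' then x i' j' l else (\<lambda>_. 0)) (if j = j' \<and> l < N i' j' then y i' j' l else (\<lambda>_. 0)) B)" for i' j'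
      have "(tp a b $$ (i, j)) B = (\<Sum>r<m * n * M. g (r div M) (r mod M))"
        using ij by (simp add: tp_index a_def b_def g_def Let_def)
      also have "\<dots> = (\<Sum>p<m * n. \<Sum>l<M. g p l)" by (rule sum_div_mod)
      also have "\<dots> = (\<Sum>p<m * n. h (p div n) (p mod n))" by (simp add: g_def h_def Let_def)
      also have "\<dots> = (\<Sum>i'<m. \<Sum>j'<n. h i' j')" by (rule sum_div_mod)
      also have "\<dots> = (\<Sum>i'<m. \<Sum>j'<n. if i' = i \<and> j' = j then h i j else 0)"
      proof (intro sum.cong refl)
        fix i' j' assume l: "i' \<in> {..<m}" "j' \<in> {..<n}"
        have "el (if i = i' \<and> l < N i' j' then x i' j' l else (\<lambda>_. 0)) (if j = j' \<and> l < N i' j' then y i' j' l else (\<lambda>_. 0)) B = 0"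
          if "\<not> (i' = i \<and> j' = j)" for l
          using U[of i' j'] l that by (auto simp: el_zero zero_in_OH)
        then show "h i' j' = (if i' = i \<and> j' = j then h i j else 0)" by (auto simp: h_def)
      qed
      also have "\<dots> = h i j" unfolding sum_if_and using ij by simp
      also have "\<dots> = (\<Sum>l<N i j. el (x i j l) (y i j l) B)"
        unfolding h_def using M[OF ij] by (intro sum.mono_neutral_cong_right) (auto simp: el_zero zero_in_OH)
      finally show ?thesis using U[OF ij] by simp
    qed
    then show "U $$ (i, j) = tp a b $$ (i, j)" by auto
  qed (use matrices_D(1,2)[OF assms] in \<open>auto simp: tp_index a_def b_def\<close>)
  then show ?thesis using a b by blast
qed

text \<open>The parameter bounds the square of the matrix norm, the scale on which rows and columns
  add.\<close>

definition oh_bound_mat :: "real \<Rightarrow> ('i \<Rightarrow> complex) mat \<Rightarrow> bool" where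
  "oh_bound_mat t a \<longleftrightarrow> (\<forall>A. finite A \<longrightarrow> A \<subseteq> I \<longrightarrow> oh_bound A (coord a) t)"

lemma oh_bound_mat_rect: "a \<in> Mat m n \<Longrightarrow> 0 \<le> t \<Longrightarrow> rect_mnorm (OH I) a \<le> t \<longleftrightarrow> oh_bound_mat (t\<^sup>2) a"
  unfolding oh_bound_mat_def by (rule OH_rect_mnorm_le_iff)

lemma oh_bound_mat_cscale:
  assumes "a \<in> Mat m n" "oh_bound_mat t a"
  shows "mat_scale (OH I) c a \<in> Mat m n" "oh_bound_mat ((cmod c)\<^sup>2 * t) (mat_scale (OH I) c a)"
proof -
  show "mat_scale (OH I) c a \<in> Mat m n"
    by (rule matrices_I) (auto simp: mat_scale_def matrices_D[OF assms(1)] OH_simps(4) OH_smult)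
  have "coord (mat_scale (OH I) c a) = (\<lambda>s. cscale c (coord a s))"
    by (intro ext fmat_eqI) (auto simp: mat_scale_def OH_simps(4))
  then show "oh_bound_mat ((cmod c)\<^sup>2 * t) (mat_scale (OH I) c a)"
    using assms(2) by (auto simp: oh_bound_mat_def intro: oh_bound_cscale)
qed

lemma tp_scale:
  assumes a: "a \<in> Mat m k" and b: "b \<in> Mat k n"
  shows "tp (mat_scale (OH I) c a) (mat_scale (OH I) d b) = mat_scale H (c * d) (tp a b)"
proof (rule eq_matI)
  fix i j assume "i < dim_row (mat_scale H (c * d) (tp a b))" "j < dim_col (mat_scale H (c * d) (tp a b))"
  then have ij: "i < m" "j < n" using matrices_D(1,2)[OF a] matrices_D(1,2)[OF b] by (auto simp: mat_scale_def tp_index)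
  then show "tp (mat_scale (OH I) c a) (mat_scale (OH I) d b) $$ (i, j) = mat_scale H (c * d) (tp a b) $$ (i, j)"
    using matrices_D[OF a] matrices_D[OF b]
    by (auto simp: mat_scale_def tp_index OH_simps(4) H_simps(3) el_smult OH_smult sum_distrib_left mult.assoc intro!: ext sum.cong)
qed (auto simp: mat_scale_def tp_index)

lemma H_mnorm_le:
  assumes a: "a \<in> Mat n k" "oh_bound_mat t a" and b: "b \<in> Mat k n" "oh_bound_mat t' b"
    and t: "0 \<le> t" "0 \<le> t'"
  shows "mnorm H (tp a b) \<le> sqrt t * sqrt t'"
proof -
  have "mnorm H (tp a b) \<le> rect_mnorm (OH I) a * rect_mnorm (OH I) b"
    unfolding H_simps
  proof (rule cInf_lower)
    show "bdd_below {rect_mnorm (OH I) a' * rect_mnorm (OH I) b' | a' b' k.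
      a' \<in> Mat (dim_row (tp a b)) k \<and> b' \<in> Mat k (dim_col (tp a b)) \<and> tp a b = tp a' b'}"
      by (rule bdd_belowI[of _ 0]) (auto simp: OH_rect_mnorm_nonneg)
  qed (use a b matrices_D(1,2)[OF a(1)] matrices_D(1,2)[OF b(1)] in \<open>auto simp: tp_index\<close>)
  also have "\<dots> \<le> sqrt t * sqrt t'"
    using oh_bound_mat_rect[OF a(1), of "sqrt t"] oh_bound_mat_rect[OF b(1), of "sqrt t'"] a(2) b(2) t
    by (intro mult_mono) (auto simp: OH_rect_mnorm_nonneg)
  finally show ?thesis .
qed

text \<open>Only the product of the two norms is known to be below \<open>t\<close>. Scaling
  \<open>a\<close> by \<open>r\<close> and \<open>b\<close> by \<open>1 / r\<close> leaves the
  tensor unchanged and brings both norms down to at most \<open>sqrt t\<close>.\<close>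

lemma H_mnorm_factor:
  assumes U: "U \<in> matrices H n n" and t: "mnorm H U < t"
  shows "0 < t \<and> (\<exists>a b k. a \<in> Mat n k \<and> b \<in> Mat k n \<and> U = tp a b \<and> oh_bound_mat t a \<and> oh_bound_mat t b)"
proof -
  let ?S = "{rect_mnorm (OH I) a * rect_mnorm (OH I) b | a b k.
     a \<in> Mat n k \<and> b \<in> Mat k n \<and> U = tp a b}"
  have "?S \<noteq> {}" using factorization_exists[OF U] by blast
  then have "\<exists>r\<in>?S. r < t" using t matrices_D(1,2)[OF U] by (intro cInf_lessD) (auto simp: H_simps)
  then obtain a b k where ab: "a \<in> Mat n k" "b \<in> Mat k n" "U = tp a b"
    "rect_mnorm (OH I) a * rect_mnorm (OH I) b < t" by blast
  define p q where "p = rect_mnorm (OH I) a" and "q = rect_mnorm (OH I) b"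
  have pq: "0 \<le> p" "0 \<le> q" "p * q < t" using ab(4) by (auto simp: p_def q_def OH_rect_mnorm_nonneg)
  then have t0: "0 < t" by (meson le_less_trans mult_nonneg_nonneg)
  obtain r where r: "0 < r" "r * p \<le> sqrt t" "q / r \<le> sqrt t"
  proof (cases "p = 0")
    case True
    \<comment> \<open>When \<open>a\<close> has norm 0, any sufficiently large factor
      \<open>r\<close> will do.\<close>
    have "0 < (q + 1) / sqrt t" using pq t0 by simp
    moreover have "q / ((q + 1) / sqrt t) \<le> sqrt t" using pq t0 by (simp add: divide_le_eq algebra_simps)
    ultimately show ?thesis using True t0 by (intro that[of "(q + 1) / sqrt t"]) auto
  next
    case False
    then have p: "p > 0" using pq by simp
    have "p * q \<le> sqrt t * sqrt t" using pq(3) t0 by simp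
    then have "q / (sqrt t / p) \<le> sqrt t" using p t0 by (simp add: divide_le_eq mult.commute)
    then show ?thesis using p t0 by (intro that[of "sqrt t / p"]) auto
  qed
  have sq: "r\<^sup>2 * p\<^sup>2 \<le> t" "(1 / r)\<^sup>2 * q\<^sup>2 \<le> t"
    using power_mono[OF r(2), of 2] power_mono[OF r(3), of 2] pq r(1) t0
    by (auto simp: power_mult_distrib power_divide)
  have "oh_bound_mat (p\<^sup>2) a" "oh_bound_mat (q\<^sup>2) b"
    using oh_bound_mat_rect[OF ab(1) pq(1)] oh_bound_mat_rect[OF ab(2) pq(2)] by (auto simp: p_def q_def)
  then have o: "oh_bound_mat (r\<^sup>2 * p\<^sup>2) (mat_scale (OH I) (of_real r) a)" "oh_bound_mat ((1 / r)\<^sup>2 * q\<^sup>2) (mat_scale (OH I) (of_real (1 / r)) b)"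
    using oh_bound_mat_cscale(2)[OF ab(1), of "p\<^sup>2" "of_real r"] oh_bound_mat_cscale(2)[OF ab(2), of "q\<^sup>2" "of_real (1 / r)"]
    by (simp_all only: norm_of_real power2_abs)
  have "tp (mat_scale (OH I) (of_real r) a) (mat_scale (OH I) (of_real (1 / r)) b) = mat_scale H 1 (tp a b)"
    using tp_scale[OF ab(1,2), of "of_real r" "of_real (1 / r)"] r(1) by (simp flip: of_real_mult)
  also have "\<dots> = U" by (rule eq_matI) (auto simp: mat_scale_def H_simps(3) ab(3))
  finally have "U = tp (mat_scale (OH I) (of_real r) a) (mat_scale (OH I) (of_real (1 / r)) b)" by simp
  moreover have "oh_bound_mat t (mat_scale (OH I) (of_real r) a)" "oh_bound_mat t (mat_scale (OH I) (of_real (1 / r)) b)"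
    using o sq by (auto simp: oh_bound_mat_def intro: oh_bound_nonneg_mono)
  ultimately show ?thesis
    using t0 oh_bound_mat_cscale(1)[OF ab(1) \<open>oh_bound_mat (p\<^sup>2) a\<close>] oh_bound_mat_cscale(1)[OF ab(2) \<open>oh_bound_mat (q\<^sup>2) b\<close>] by blast
qed

text \<open>The sum of two factored tensors is a concatenated row of blocks times a concatenated
  column. Bounds on squared norms add on both sides, so balanced factorizations yield the triangle
  inequality.\<close>

lemma oh_bound_mat_factor_concat:
  assumes a: "a \<in> Mat n k" "oh_bound_mat t a" and a': "a' \<in> Mat n k'" "oh_bound_mat t' a'"
    and b: "b \<in> Mat k n" "oh_bound_mat t b" and b': "b' \<in> Mat k' n" "oh_bound_mat t' b'"
    and t: "0 \<le> t" "0 \<le> t'"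
  shows "mnorm H (mat_add H (tp a b) (tp a' b')) \<le> t + t'"
proof -
  note da = matrices_D[OF a(1)] and da' = matrices_D[OF a'(1)] and db = matrices_D[OF b(1)] and db' = matrices_D[OF b'(1)]
  define c where "c = mat n (k + k') (\<lambda>(i, l). if l < k then a $$ (i, l) else a' $$ (i, l - k))"
  define d where "d = mat (k + k') n (\<lambda>(l, j). if l < k then b $$ (l, j) else b' $$ (l - k, j))"
  have c: "c \<in> Mat n (k + k')"
    using da(3) da'(3) by (intro matrices_I) (auto simp: c_def)
  have d: "d \<in> Mat (k + k') n"
    using db(3) db'(3) by (intro matrices_I) (auto simp: d_def)
  have "tp c d = mat_add H (tp a b) (tp a' b')"
  proof (rule eq_matI)
    fix i j assume "i < dim_row (mat_add H (tp a b) (tp a' b'))" "j < dim_col (mat_add H (tp a b) (tp a' b'))"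
    then have "i < n" "j < n" using da db by (auto simp: mat_add_def tp_index)
    then show "tp c d $$ (i, j) = mat_add H (tp a b) (tp a' b') $$ (i, j)"
      using da(1,2) db(1,2) da'(1,2) db'(1,2)
      by (auto simp: tp_index mat_add_def c_def d_def H_simps(2) sum_lessThan_add intro!: ext)
  qed (use da db in \<open>auto simp: mat_add_def tp_index c_def d_def\<close>)
  moreover have "oh_bound_mat (t + t') c"
    unfolding oh_bound_mat_def
  proof (intro allI impI)
    fix A assume A: "finite A" "A \<subseteq> I"
    have "coord c = (\<lambda>s. coord a s + coord a' s * fshift k' k)"
      using da(1,2) da'(1,2) by (intro ext fmat_eqI) (auto simp: entry_times_fshift c_def)
    moreover have "oh_bound A (\<lambda>s. coord a s + coord a' s * fshift k' k) (t + t')"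
      by (rule oh_bound_concat) (use A a(2) a'(2) t da(1,2) in \<open>auto simp: oh_bound_mat_def\<close>)
    ultimately show "oh_bound A (coord c) (t + t')" by simp
  qed
  moreover have "oh_bound_mat (t + t') d"
    unfolding oh_bound_mat_def
  proof (intro allI impI)
    fix A assume A: "finite A" "A \<subseteq> I"
    have "coord d = (\<lambda>s. adj (adj (coord b s) + adj (coord b' s) * fshift k' k))"
      using db(1,2) db'(1,2) by (intro ext fmat_eqI) (auto simp: entry_times_fshift d_def simp del: adj_times adj_plus)
    moreover have "oh_bound A (\<lambda>s. adj (coord b s) + adj (coord b' s) * fshift k' k) (t + t')"
      by (rule oh_bound_concat) (use A b(2) b'(2) t db(1,2) in \<open>auto simp: oh_bound_mat_def intro: oh_bound_adj\<close>)
    ultimately show "oh_bound A (coord d) (t + t')" using oh_bound_adj[of A "\<lambda>s. adj (coord b s) + adj (coord b' s) * fshift k' k"] by simp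
  qed
  ultimately show ?thesis
    using H_mnorm_le[OF c _ d, of "t + t'" "t + t'"] t by simp
qed

lemma H_mnorm_nonneg: assumes "U \<in> matrices H n n" shows "0 \<le> mnorm H U"
  using H_mnorm_factor[OF assms, of 0] by (meson less_irrefl linorder_not_le)

lemma H_mnorm_add:
  assumes U: "U \<in> matrices H n n" and V: "V \<in> matrices H n n"
  shows "mnorm H (mat_add H U V) \<le> mnorm H U + mnorm H V"
proof (rule field_le_epsilon)
  fix e :: real assume e: "0 < e"
  define t t' where "t = mnorm H U + e / 2" and "t' = mnorm H V + e / 2"
  obtain a b k where a: "0 < t" "a \<in> Mat n k" "b \<in> Mat k n" "U = tp a b" "oh_bound_mat t a" "oh_bound_mat t b"
    using H_mnorm_factor[OF U, of t] e by (auto simp: t_def)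
  obtain a' b' k' where a': "0 < t'" "a' \<in> Mat n k'" "b' \<in> Mat k' n" "V = tp a' b'" "oh_bound_mat t' a'" "oh_bound_mat t' b'"
    using H_mnorm_factor[OF V, of t'] e by (auto simp: t'_def)
  have "mnorm H (mat_add H U V) \<le> t + t'"
    unfolding a(4) a'(4) using oh_bound_mat_factor_concat[OF a(2,5) a'(2,5) a(3,6) a'(3,6)] a(1) a'(1) by simp
  then show "mnorm H (mat_add H U V) \<le> mnorm H U + mnorm H V + e" by (simp add: t_def t'_def)
qed

lemma H_mnorm_scale:
  assumes U: "U \<in> matrices H n n"
  shows "mnorm H (mat_scale H c U) \<le> cmod c * mnorm H U"
proof (rule field_le_epsilon)
  fix e :: real assume e: "0 < e"
  have c1: "0 < cmod c + 1" by (simp add: add_nonneg_pos)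
  define t where "t = mnorm H U + e / (cmod c + 1)"
  obtain a b k where a: "0 < t" "a \<in> Mat n k" "b \<in> Mat k n" "U = tp a b" "oh_bound_mat t a" "oh_bound_mat t b"
    using H_mnorm_factor[OF U, of t] e c1 by (auto simp: t_def)
  have "mat_scale (OH I) 1 b = b"
    by (rule eq_matI) (auto simp: mat_scale_def OH_simps(4))
  then have "mat_scale H c U = tp (mat_scale (OH I) c a) b" using tp_scale[OF a(2,3), of c 1] a(4) by simp
  then have "mnorm H (mat_scale H c U) \<le> sqrt ((cmod c)\<^sup>2 * t) * sqrt t"
    using H_mnorm_le[OF oh_bound_mat_cscale[OF a(2,5), of c] a(3,6)] a(1) by simp
  also have "\<dots> = cmod c * t" using a(1) by (simp add: real_sqrt_mult)
  also have "\<dots> \<le> cmod c * mnorm H U + e"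
  proof -
    have "cmod c * (e / (cmod c + 1)) \<le> e" using e c1 by (simp add: divide_le_eq)
    then show ?thesis by (simp add: t_def distrib_left)
  qed
  finally show "mnorm H (mat_scale H c U) \<le> cmod c * mnorm H U + e" .
qed

text \<open>A tensor is moved to the position \<open>(i, j)\<close> by multiplying its factors with
  partial isometries, which does not increase their norms.\<close>

lemma H_mnorm_single:
  assumes w: "w \<in> carrier H" and ij: "i < n" "j < n"
  shows "mnorm H (mat n n (\<lambda>pq. if pq = (i, j) then w else \<zero>\<^bsub>H\<^esub>)) \<le> vnorm H w"
proof (rule field_le_epsilon)
  fix e :: real assume e: "0 < e"
  define t where "t = vnorm H w + e"
  have "mat 1 1 (\<lambda>_. w) \<in> matrices H 1 1" by (rule matrices_I) (use w in auto)
  then obtain a b k where a: "0 < t" "a \<in> Mat 1 k" "b \<in> Mat k 1" "mat 1 1 (\<lambda>_. w) = tp a b" "oh_bound_mat t a" "oh_bound_mat t b"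
    using H_mnorm_factor[of "mat 1 1 (\<lambda>_. w)" 1 t] e by (auto simp: t_def vnorm_def)
  note da = matrices_D[OF a(2)] and db = matrices_D[OF a(3)]
  define c where "c = mat n k (\<lambda>(p, l). if p = i then a $$ (0, l) else (\<lambda>_. 0))"
  define d where "d = mat k n (\<lambda>(l, q). if q = j then b $$ (l, 0) else (\<lambda>_. 0))"
  have c: "c \<in> Mat n k" using da(3)[of 0] zero_in_OH[of I] by (intro matrices_I) (auto simp: c_def)
  have d: "d \<in> Mat k n" using db(3)[of _ 0] zero_in_OH[of I] by (intro matrices_I) (auto simp: d_def)
  have w: "w = (\<lambda>B. \<Sum>l<k. el (a $$ (0, l)) (b $$ (l, 0)) B)"
    using arg_cong[OF a(4), of "\<lambda>x. x $$ (0, 0)"] da db by (simp add: tp_index)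
  have "mat n n (\<lambda>pq. if pq = (i, j) then w else \<zero>\<^bsub>H\<^esub>) = tp c d"
  proof (rule eq_matI)
    fix p q assume "p < dim_row (tp c d)" "q < dim_col (tp c d)"
    then have pq: "p < n" "q < n" by (auto simp: tp_index c_def d_def)
    have ca: "a $$ (0, l) \<in> ell2" "b $$ (l, 0) \<in> ell2" if "l < k" for l
      using da(3)[of 0 l] db(3)[of l 0] that by auto
    show "mat n n (\<lambda>pq. if pq = (i, j) then w else \<zero>\<^bsub>H\<^esub>) $$ (p, q) = tp c d $$ (p, q)"
      using pq ca by (auto simp: tp_index c_def d_def w H_simps(1) el_zero zero_in_OH intro!: ext sum.neutral[symmetric])
  qed (auto simp: tp_index c_def d_def)
  moreover have "oh_bound_mat t c"
    unfolding oh_bound_mat_def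
  proof (intro allI impI)
    fix A assume A: "finite A" "A \<subseteq> I"
    have "coord c = (\<lambda>s. adj (adj (coord a s) * fshift 1 i))"
      using da(1,2) ij by (intro ext fmat_eqI) (auto simp: entry_times_fshift c_def simp del: adj_times)
    moreover have "oh_bound A (\<lambda>s. adj (adj (coord a s) * fshift 1 i)) t"
      using a(1,5) A by (intro oh_bound_adj oh_bound_times_right[OF fshift_partial_isometry]) (auto simp: oh_bound_mat_def)
    ultimately show "oh_bound A (coord c) t" by simp
  qed
  moreover have "oh_bound_mat t d"
    unfolding oh_bound_mat_def
  proof (intro allI impI)
    fix A assume A: "finite A" "A \<subseteq> I"
    have "coord d = (\<lambda>s. coord b s * fshift 1 j)"
      using db(1,2) ij by (intro ext fmat_eqI) (auto simp: entry_times_fshift d_def)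
    moreover have "oh_bound A (\<lambda>s. coord b s * fshift 1 j) t"
      using a(1,6) A by (intro oh_bound_times_right[OF fshift_partial_isometry]) (auto simp: oh_bound_mat_def)
    ultimately show "oh_bound A (coord d) t" by simp
  qed
  ultimately have "mnorm H (mat n n (\<lambda>pq. if pq = (i, j) then w else \<zero>\<^bsub>H\<^esub>)) \<le> sqrt t * sqrt t"
    using H_mnorm_le[OF c _ d, of t t] a(1) by simp
  then show "mnorm H (mat n n (\<lambda>pq. if pq = (i, j) then w else \<zero>\<^bsub>H\<^esub>)) \<le> vnorm H w + e"
    using a(1) by (simp add: t_def)
qed

lemma H_mnorm_entries:
  assumes U: "U \<in> matrices H n n"
  shows "mnorm H U \<le> (\<Sum>i<n. \<Sum>j<n. vnorm H (U $$ (i, j)))"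
proof -
  note dU = matrices_D[OF U]
  define part where "part S = mat n n (\<lambda>pq. if pq \<in> S then U $$ pq else \<zero>\<^bsub>H\<^esub>)" for S
  have part: "part S \<in> matrices H n n" for S
    using dU(3) H_zero by (intro matrices_I) (auto simp: part_def H_simps(1))
  have "mnorm H (part S) \<le> (\<Sum>ij\<in>S. vnorm H (U $$ ij))" if "S \<subseteq> {..<n} \<times> {..<n}" for S
  proof -
    have "finite S" using that finite_subset by blast
    then show ?thesis using that
    proof (induction S)
      case empty
      have "part {} = mat_scale H 0 (part {})"
        by (rule eq_matI) (auto simp: part_def mat_scale_def H_simps)
      then show ?case using H_mnorm_scale[OF part, of 0 "{}"] by simp
    next
      case (insert ij S)
      obtain i j where ij: "ij = (i, j)" "i < n" "j < n" using insert.prems by auto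
      have "part (insert ij S) = mat_add H (mat n n (\<lambda>pq. if pq = (i, j) then U $$ (i, j) else \<zero>\<^bsub>H\<^esub>)) (part S)"
        using insert.hyps by (intro eq_matI) (auto simp: part_def mat_add_def H_simps ij)
      moreover have "mat n n (\<lambda>pq. if pq = (i, j) then U $$ (i, j) else \<zero>\<^bsub>H\<^esub>) \<in> matrices H n n"
        using dU(3) ij H_zero by (intro matrices_I) (auto simp: H_simps(1))
      ultimately have "mnorm H (part (insert ij S)) \<le> mnorm H (mat n n (\<lambda>pq. if pq = (i, j) then U $$ (i, j) else \<zero>\<^bsub>H\<^esub>)) + mnorm H (part S)"
        using H_mnorm_add[OF _ part] by metis
      also have "\<dots> \<le> vnorm H (U $$ (i, j)) + (\<Sum>ij\<in>S. vnorm H (U $$ ij))"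
        using insert.IH insert.prems ij dU(3) by (intro add_mono H_mnorm_single) auto
      finally show ?case using insert.hyps ij by simp
    qed
  qed
  from this[of "{..<n} \<times> {..<n}"] have "mnorm H (part ({..<n} \<times> {..<n})) \<le> (\<Sum>i<n. \<Sum>j<n. vnorm H (U $$ (i, j)))"
    by (simp add: sum.cartesian_product)
  moreover have "part ({..<n} \<times> {..<n}) = U"
    using dU(1,2) by (intro eq_matI) (auto simp: part_def)
  ultimately show ?thesis by simp
qed

lemma H_mspace: "mspace H"
  by (rule mspace.intro[OF H_abelian], unfold_locales)
    (use H_mnorm_nonneg H_mnorm_add H_mnorm_scale H_mnorm_entries in
      \<open>auto simp: H_simps(2,3) H_smult algebra_simps simp del: H_simps(4)\<close>)

subsection \<open>The multiplication map\<close>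

text \<open>Tensors are functionals on bilinear forms, so the product is read off by evaluating at
  the forms \<open>\<lambda>x y. x i * y i\<close>. Linearity and independence of the representation
  are then built in.\<close>

definition mul :: "((('i \<Rightarrow> complex) \<Rightarrow> ('i \<Rightarrow> complex) \<Rightarrow> complex) \<Rightarrow> complex) \<Rightarrow> 'i \<Rightarrow> complex" where
  "mul u = (\<lambda>i. u (\<lambda>x y. x i * y i))"

lemma mul_el: "x \<in> ell2 \<Longrightarrow> y \<in> ell2 \<Longrightarrow> mul (el x y) = (\<lambda>i. x i * y i)"
  by (auto simp: mul_def elem_tensor_def bilinear_forms_def linear_functional_def OH_simps algebra_simps)

lemma mul_linear: "mul (\<lambda>B. u B + v B) = (\<lambda>i. mul u i + mul v i)" "mul (\<lambda>B. c * u B) = (\<lambda>i. c * mul u i)"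
  "mul (\<lambda>B. \<Sum>k<n::nat. w k B) = (\<lambda>i. \<Sum>k<n. mul (w k) i)"
  by (simp_all add: mul_def)

lemma OH_sum: "(\<And>k. k < n \<Longrightarrow> f k \<in> ell2) \<Longrightarrow> (\<lambda>i. \<Sum>k<n::nat. f k i) \<in> ell2"
  by (induction n) (simp_all add: zero_in_OH OH_add)

lemma mul_closed: assumes "u \<in> carrier H" shows "mul u \<in> ell2"
proof -
  obtain n x y where u: "u = (\<lambda>B. \<Sum>k<n::nat. el (x k) (y k) B)" "\<And>k. k < n \<Longrightarrow> x k \<in> ell2 \<and> y k \<in> ell2"
    using assms(1) unfolding H_carrier by blast
  have "mul u = (\<lambda>i. \<Sum>k<n. x k i * y k i)"
    unfolding u(1) mul_linear using u(2) by (simp add: mul_el)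
  also have "\<dots> \<in> ell2" using u(2) by (intro OH_sum OH_mult) auto
  finally show ?thesis .
qed

lemma mul_tp:
  assumes "a \<in> Mat m k" "b \<in> Mat k n" "i < m" "j < n"
  shows "mul (tp a b $$ (i, j)) = (\<lambda>s. \<Sum>l<k. (a $$ (i, l)) s * (b $$ (l, j)) s)"
  using assms(3,4) matrices_D[OF assms(1)] matrices_D[OF assms(2)] by (simp add: tp_index mul_linear mul_el)

text \<open>The coordinates of the product matrix are the products of the coordinate matrices, so
  \<open>oh_bound_mult\<close> applies to every factorization.\<close>

theorem mul_contractive:
  assumes U: "U \<in> matrices H n n"
  shows "map_mat mul U \<in> Mat n n" "mnorm (OH I) (map_mat mul U) \<le> mnorm H U"
proof -
  note dU = matrices_D[OF U]
  show m: "map_mat mul U \<in> Mat n n"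
    by (rule matrices_I) (use dU in \<open>auto intro: mul_closed\<close>)
  show "mnorm (OH I) (map_mat mul U) \<le> mnorm H U"
  proof (rule field_le_epsilon)
    fix e :: real assume e: "0 < e"
    define t where "t = mnorm H U + e"
    obtain a b k where a: "0 < t" "a \<in> Mat n k" "b \<in> Mat k n" "U = tp a b" "oh_bound_mat t a" "oh_bound_mat t b"
      using H_mnorm_factor[OF U, of t] e by (auto simp: t_def)
    have evm: "coord (map_mat mul U) s = coord a s * coord b s" for s
    proof (rule fmat_eqI)
      fix i j
      have "in_size (max n k) (coord a s)" using matrices_D[OF a(2)] by (auto simp: in_size_def)
      then have "entry (coord a s * coord b s) i j = (\<Sum>l<max n k. entry (coord a s) i l * entry (coord b s) l j)"
        by (intro entry_times) simp
      also have "\<dots> = (\<Sum>l<k. entry (coord a s) i l * entry (coord b s) l j)"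
        using matrices_D[OF a(2)] by (intro sum.mono_neutral_right) auto
      also have "\<dots> = entry (coord (map_mat mul U) s) i j"
        using dU(1,2) matrices_D(1,2)[OF a(2)] matrices_D(1,2)[OF a(3)] mul_tp[OF a(2,3), of i j]
        by (auto simp: a(4) tp_index(2,3))
      finally show "entry (coord (map_mat mul U) s) i j = entry (coord a s * coord b s) i j" by simp
    qed
    have "oh_bound A (coord (map_mat mul U)) (t\<^sup>2)" if "finite A" "A \<subseteq> I" for A
      using oh_bound_mult[OF that(1), of t "coord a" t "coord b"] a(1,5,6) that
      by (simp add: evm[abs_def] oh_bound_mat_def power2_eq_square)
    then have "mnorm (OH I) (map_mat mul U) \<le> t"
      using OH_mnorm_le_iff[OF m, of t] a(1) by auto
    then show "mnorm (OH I) (map_mat mul U) \<le> mnorm H U + e" by (simp add: t_def)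
  qed
qed

text \<open>The factorization of each coordinate is spread over an inner index with one block per
  element of \<open>F\<close>: \<open>\<alpha> s * J s\<close> fills block \<open>s\<close> of the
  row and \<open>adj (J s) * \<beta> s\<close> that of the column. The support of \<open>a\<close>
  is recorded because functionals will be evaluated on the lift term by term.\<close>

theorem mul_lift:
  assumes F: "finite F" "F \<subseteq> I" and x: "x \<in> Mat n n" "mnorm (OH I) x < t"
    and supp: "\<And>i j s. i < n \<Longrightarrow> j < n \<Longrightarrow> s \<notin> F \<Longrightarrow> (x $$ (i, j)) s = 0"
  shows "\<exists>a b k. a \<in> Mat n k \<and> b \<in> Mat k n \<and>
    (\<forall>i<n. \<forall>l<k. \<forall>s. s \<notin> F \<longrightarrow> (a $$ (i, l)) s = 0) \<and>
    mnorm H (tp a b) \<le> t \<and> map_mat mul (tp a b) = x"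
proof -
  define L where "L = (mnorm (OH I) x)\<^sup>2"
  have t: "0 \<le> t" using x(2) OH_mnorm_nonneg[of I x] by linarith
  have L: "oh_bound F (coord x) L" "0 \<le> L" "L < t\<^sup>2"
    using OH_mnorm_le_iff[OF x(1) OH_mnorm_nonneg] F x(2) OH_mnorm_nonneg[of I x]
    by (auto simp: L_def power_strict_mono)
  obtain \<alpha> \<beta> where ab: "\<And>s. s \<in> F \<Longrightarrow> in_size n (\<alpha> s) \<and> in_size n (\<beta> s) \<and> coord x s = \<alpha> s * \<beta> s"
    "oh_bound F (\<lambda>s. \<alpha> s * adj (\<alpha> s)) (t\<^sup>2)" "oh_bound F (\<lambda>s. adj (\<beta> s) * \<beta> s) (t\<^sup>2)"
    using oh_factorization[OF F(1) in_size_coord[OF x(1)] L] by blast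
  obtain h where h: "bij_betw h F {..<card F}" using ex_bij_betw_finite_nat[OF F(1)] atLeast0LessThan by metis
  define k where "k = n * card F"
  define J where "J s = fshift n (h s * n)" for s
  have block: "h s * n + i < k" if "s \<in> F" "i < n" for s i
  proof -
    have "h s < card F" using h that by (auto simp: bij_betw_def)
    then have "Suc (h s) * n \<le> card F * n" by (intro mult_right_mono) auto
    then show ?thesis using that by (simp add: k_def mult.commute)
  qed
  \<comment> \<open>Distinct blocks do not overlap, so the projections
    \<open>adj (J s) * J s\<close> are orthogonal, as the block estimate requires.\<close>
  have JJ: "J s * adj (J s') = (if s = s' then funit n else 0)" if s: "s \<in> F" "s' \<in> F" for s s'
  proof (cases "s = s'")
    case False
    then have ne: "h s \<noteq> h s'" using h s by (auto simp: bij_betw_def inj_on_def)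
    have "J s * adj (J s') = 0"
    proof (rule fmat_eqI)
      fix i j
      have "h s' * n + j \<noteq> h s * n + i" if "i < n" "j < n"
      proof
        assume "h s' * n + j = h s * n + i"
        then have "(h s' * n + j) div n = (h s * n + i) div n" by simp
        then show False using that ne by simp
      qed
      then show "entry (J s * adj (J s')) i j = entry 0 i j"
        by (auto simp: J_def entry_times_adj_fshift entry_fshift)
    qed
    then show ?thesis using False by simp
  qed (simp add: J_def fshift_adj)
  have idJ: "funit n * J s = J s" for s
  proof -
    have "adj (J s) * funit n = adj (J s)" by (rule times_funit_right) (auto simp: J_def entry_fshift)
    then show ?thesis by (metis adj_adj adj_funit adj_times)
  qed
  have proj: "adj (J s) * J s * (adj (J s') * J s') = (if s = s' then adj (J s) * J s else 0)" if "s \<in> F" "s' \<in> F" for s s'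
  proof -
    have "adj (J s) * J s * (adj (J s') * J s') = adj (J s) * (J s * adj (J s')) * J s'" by (simp add: mult.assoc)
    then show ?thesis using JJ[OF that] by (simp add: mult.assoc idJ)
  qed
  have oa: "oh_bound F (\<lambda>s. \<alpha> s * J s) t"
    using oh_bound_block_row[OF F(1) _ ab(2) proj] t by simp
  have "oh_bound F (\<lambda>s. adj (\<beta> s) * adj (adj (\<beta> s))) (t\<^sup>2)" using ab(3) by simp
  then have "oh_bound F (\<lambda>s. adj (\<beta> s) * J s) t"
    using oh_bound_block_row[OF F(1) _ _ proj, of "t\<^sup>2" "\<lambda>s. adj (\<beta> s)"] t by simp
  from oh_bound_adj[OF this] have ob: "oh_bound F (\<lambda>s. adj (J s) * \<beta> s) t" by simp
  define a where "a = mat n k (\<lambda>(i, c). \<lambda>s. if s \<in> F then entry (\<alpha> s * J s) i c else 0)"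
  define b where "b = mat k n (\<lambda>(r, j). \<lambda>s. if s \<in> F then entry (adj (J s) * \<beta> s) r j else 0)"
  have a: "a \<in> Mat n k"
    by (rule matrices_I) (auto simp: a_def intro!: OH_finite_support[OF F])
  have b: "b \<in> Mat k n"
    by (rule matrices_I) (auto simp: b_def intro!: OH_finite_support[OF F])
  have Jk: "entry (\<alpha> s * J s) i c = 0" if "s \<in> F" "\<not> (i < n \<and> c < k)" for s i c
  proof (cases "h s * n \<le> c \<and> c < n + h s * n")
    case True
    then have "c - h s * n < n" by linarith
    then have "c < k" using block[OF that(1), of "c - h s * n"] True by simp
    then show ?thesis using that ab(1)[OF that(1)] by (auto simp: J_def entry_times_fshift in_size_D not_less)
  qed (auto simp: J_def entry_times_fshift)
  have Jk': "entry (adj (J s) * \<beta> s) r j = 0" if "s \<in> F" "\<not> (r < k \<and> j < n)" for s r j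
  proof -
    have "entry (adj (\<beta> s) * J s) j r = 0"
    proof (cases "h s * n \<le> r \<and> r < n + h s * n")
      case True
      then have "r - h s * n < n" by linarith
      then have "r < k" using block[OF that(1), of "r - h s * n"] True by simp
      then show ?thesis using that ab(1)[OF that(1)] by (auto simp: J_def entry_times_fshift in_size_D not_less)
    qed (auto simp: J_def entry_times_fshift)
    then have "entry (adj (adj (\<beta> s) * J s)) r j = 0" by (simp only: entry_adj complex_cnj_zero)
    then show ?thesis by simp
  qed
  have eva: "coord a s = (if s \<in> F then \<alpha> s * J s else 0)" for s
    using Jk by (intro fmat_eqI) (auto simp: a_def)
  have evb: "coord b s = (if s \<in> F then adj (J s) * \<beta> s else 0)" for s
    using Jk' by (intro fmat_eqI) (auto simp: b_def)
  have "oh_bound_mat t a" unfolding oh_bound_mat_def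
  proof (intro allI impI)
    fix A assume A: "finite A" "A \<subseteq> I"
    have "oh_bound F (coord a) t" using oa by (subst oh_bound_cong[of F _ "\<lambda>s. \<alpha> s * J s"]) (auto simp: eva)
    then show "oh_bound A (coord a) t" using oh_bound_support[OF F(1) _ t _ A(1)] by (simp add: eva)
  qed
  moreover have "oh_bound_mat t b" unfolding oh_bound_mat_def
  proof (intro allI impI)
    fix A assume A: "finite A" "A \<subseteq> I"
    have "oh_bound F (coord b) t" using ob by (subst oh_bound_cong[of F _ "\<lambda>s. adj (J s) * \<beta> s"]) (auto simp: evb)
    then show "oh_bound A (coord b) t" using oh_bound_support[OF F(1) _ t _ A(1)] by (simp add: evb)
  qed
  ultimately have "mnorm H (tp a b) \<le> t" using H_mnorm_le[OF a _ b, of t t] t by simp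
  moreover have "map_mat mul (tp a b) = x"
  proof (rule eq_matI)
    fix i j assume "i < dim_row x" "j < dim_col x"
    then have ij: "i < n" "j < n" using matrices_D(1,2)[OF x(1)] by auto
    \<comment> \<open>Multiplication pairs each coordinate only with itself, so in coordinate
      \<open>s\<close> the blocks recombine to \<open>\<alpha> s * \<beta> s\<close> without cross
      terms.\<close>
    have "(\<Sum>l<k. (a $$ (i, l)) s * (b $$ (l, j)) s) = (x $$ (i, j)) s" for s
    proof (cases "s \<in> F")
      case True
      have kn: "in_size (k + n) (\<alpha> s * J s)" using Jk[OF True] by (auto simp: in_size_def)
      have "(\<Sum>l<k. (a $$ (i, l)) s * (b $$ (l, j)) s) = (\<Sum>l<k. entry (\<alpha> s * J s) i l * entry (adj (J s) * \<beta> s) l j)"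
        using ij True by (intro sum.cong) (auto simp: a_def b_def)
      also have "\<dots> = (\<Sum>l<k + n. entry (\<alpha> s * J s) i l * entry (adj (J s) * \<beta> s) l j)"
        using Jk[OF True] by (intro sum.mono_neutral_left) auto
      also have "\<dots> = entry (\<alpha> s * J s * (adj (J s) * \<beta> s)) i j" using kn by (simp add: entry_times[of "k + n"])
      also have "\<alpha> s * J s * (adj (J s) * \<beta> s) = \<alpha> s * (J s * adj (J s)) * \<beta> s" by (simp add: mult.assoc)
      also have "\<dots> = coord x s" using ab(1)[OF True] JJ[OF True True] by simp
      finally show ?thesis using ij matrices_D(1,2)[OF x(1)] by simp
    next
      case False
      then show ?thesis using supp[OF ij False] ij by (simp add: a_def b_def)
    qed
    then show "map_mat mul (tp a b) $$ (i, j) = x $$ (i, j)"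
      using mul_tp[OF a b ij] ij matrices_D(1,2)[OF a] matrices_D(1,2)[OF b] by (simp add: tp_index(2,3))
  qed (use matrices_D(1,2)[OF x(1)] matrices_D(1,2)[OF a] matrices_D(1,2)[OF b] in \<open>auto simp: tp_index\<close>)
  moreover have "\<forall>i<n. \<forall>l<k. \<forall>s. s \<notin> F \<longrightarrow> (a $$ (i, l)) s = 0" by (simp add: a_def)
  ultimately show ?thesis using a b by blast
qed

subsection \<open>Truncation in \<open>OH\<close>\<close>

lemma OH_vnorm:
  assumes "x \<in> ell2"
  shows "nrm x = sqrt (\<Sum>\<^sub>\<infinity>i\<in>I. (cmod (x i))\<^sup>2)"
proof -
  have s: "(\<lambda>i. (cmod (x i))\<^sup>2) summable_on I" using assms by (simp add: OH_simps)
  have "((\<lambda>i. complex_of_real ((cmod (x i))\<^sup>2)) has_sum of_real (\<Sum>\<^sub>\<infinity>i\<in>I. (cmod (x i))\<^sup>2)) I"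
    by (rule has_sum_of_real) (use s in simp)
  then have "(\<Sum>\<^sub>\<infinity>i\<in>I. x i * cnj (x i)) = of_real (\<Sum>\<^sub>\<infinity>i\<in>I. (cmod (x i))\<^sup>2)"
    by (simp add: mult_cnj_cmod infsumI)
  then have "mat_opnorm (OHmat I (mat 1 1 (\<lambda>_. x))) = (\<Sum>\<^sub>\<infinity>i\<in>I. (cmod (x i))\<^sup>2)"
    by (intro mat_opnorm_1x1) (auto simp: mat_pairing_def infsum_nonneg)
  then show ?thesis by (simp add: vnorm_def OH_simps)
qed

lemma trunc_closed: "finite A \<Longrightarrow> A \<subseteq> I \<Longrightarrow> trunc A x \<in> ell2"
  by (rule OH_finite_support[of A]) (auto simp: trunc_def)

lemma delta_closed: "i \<in> I \<Longrightarrow> delta i \<in> ell2"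
  by (rule OH_finite_support[of "{i}"]) (auto simp: delta_def)

lemma OH_diff: assumes "x \<in> ell2" "y \<in> ell2" shows "(\<lambda>i. x i - y i) \<in> ell2"
  using OH_add[OF assms(1) OH_smult[OF assms(2), of "- 1"]] by simp

lemma OH_vnorm_finite:
  assumes "finite F" "F \<subseteq> I" "\<And>i. i \<notin> F \<Longrightarrow> x i = 0"
  shows "nrm x = sqrt (\<Sum>i\<in>F. (cmod (x i))\<^sup>2)"
proof -
  have "(\<Sum>\<^sub>\<infinity>i\<in>I. (cmod (x i))\<^sup>2) = (\<Sum>\<^sub>\<infinity>i\<in>F. (cmod (x i))\<^sup>2)"
    by (rule infsum_cong_neutral) (use assms in auto)
  then show ?thesis using OH_vnorm[OF OH_finite_support[OF assms]] assms(1) by simp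
qed

lemma OH_vnorm_trunc_le:
  assumes "x \<in> ell2" "finite A" "A \<subseteq> I"
  shows "nrm (trunc A x) \<le> nrm x"
proof -
  have "(\<Sum>i\<in>A. (cmod (trunc A x i))\<^sup>2) \<le> (\<Sum>\<^sub>\<infinity>i\<in>I. (cmod (x i))\<^sup>2)"
    using finite_sum_le_infsum[of "\<lambda>i. (cmod (x i))\<^sup>2" I A] assms by (simp add: trunc_def OH_simps)
  then show ?thesis
    using OH_vnorm[OF assms(1)] OH_vnorm_finite[OF assms(2,3), of "trunc A x"] by (simp add: trunc_def)
qed

text \<open>The squared norm of the remainder is the total sum minus a partial sum.\<close>

lemma OH_trunc_tendsto:
  assumes x: "x \<in> ell2"
  shows "((\<lambda>A. nrm (\<lambda>i. x i - trunc A x i)) \<longlongrightarrow> 0) fins"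
proof -
  have s: "(\<lambda>i. (cmod (x i))\<^sup>2) summable_on I" using x by (simp add: OH_simps)
  have e: "nrm (\<lambda>i. x i - trunc A x i) = sqrt ((\<Sum>\<^sub>\<infinity>i\<in>I. (cmod (x i))\<^sup>2) - (\<Sum>i\<in>A. (cmod (x i))\<^sup>2))"
    if A: "finite A" "A \<subseteq> I" for A
  proof -
    have "(\<Sum>\<^sub>\<infinity>i\<in>I. (cmod (x i - trunc A x i))\<^sup>2) = (\<Sum>\<^sub>\<infinity>i\<in>I - A. (cmod (x i))\<^sup>2)"
      by (rule infsum_cong_neutral) (auto simp: trunc_def)
    also have "\<dots> = (\<Sum>\<^sub>\<infinity>i\<in>I. (cmod (x i))\<^sup>2) - (\<Sum>\<^sub>\<infinity>i\<in>A. (cmod (x i))\<^sup>2)"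
      using A by (intro infsum_Diff s) auto
    finally show ?thesis using OH_vnorm[OF OH_diff[OF x trunc_closed[OF A]]] A by simp
  qed
  have "((\<lambda>A. sqrt ((\<Sum>\<^sub>\<infinity>i\<in>I. (cmod (x i))\<^sup>2) - (\<Sum>i\<in>A. (cmod (x i))\<^sup>2))) \<longlongrightarrow>
    sqrt ((\<Sum>\<^sub>\<infinity>i\<in>I. (cmod (x i))\<^sup>2) - (\<Sum>\<^sub>\<infinity>i\<in>I. (cmod (x i))\<^sup>2))) fins"
    by (intro tendsto_intros infsum_tendsto s)
  moreover have "eventually (\<lambda>A. sqrt ((\<Sum>\<^sub>\<infinity>i\<in>I. (cmod (x i))\<^sup>2) - (\<Sum>i\<in>A. (cmod (x i))\<^sup>2)) = nrm (\<lambda>i. x i - trunc A x i)) fins"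
    by (intro eventually_finite_subsets_at_top_weakI) (simp add: e)
  ultimately show ?thesis by (simp add: Lim_transform_eventually)
qed

lemma OH_mnorm_scale:
  assumes x: "x \<in> Mat n n"
  shows "mat_scale (OH I) c x \<in> Mat n n" "mnorm (OH I) (mat_scale (OH I) c x) \<le> cmod c * mnorm (OH I) x"
proof -
  have "oh_bound_mat ((mnorm (OH I) x)\<^sup>2) x"
    using OH_mnorm_le_iff[OF x OH_mnorm_nonneg[of I x]] by (auto simp: oh_bound_mat_def)
  note o = oh_bound_mat_cscale[OF x this, of c]
  show "mat_scale (OH I) c x \<in> Mat n n" by (rule o(1))
  show "mnorm (OH I) (mat_scale (OH I) c x) \<le> cmod c * mnorm (OH I) x"
    using OH_mnorm_le_iff[OF o(1), of "cmod c * mnorm (OH I) x"] o(2) OH_mnorm_nonneg[of I x]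
    by (simp add: oh_bound_mat_def power_mult_distrib)
qed

text \<open>Truncation drops terms from the family of coordinates, and this does not increase the
  norm at any matrix size.\<close>

lemma OH_mnorm_trunc:
  assumes x: "x \<in> Mat n n" and A: "finite A" "A \<subseteq> I"
  shows "map_mat (trunc A) x \<in> Mat n n" "mnorm (OH I) (map_mat (trunc A) x) \<le> mnorm (OH I) x"
proof -
  show m: "map_mat (trunc A) x \<in> Mat n n"
    by (rule matrices_I) (simp_all add: matrices_D(1,2)[OF x] trunc_closed[OF A])
  let ?t = "mnorm (OH I) x"
  have t: "0 \<le> ?t" by (rule OH_mnorm_nonneg)
  have e: "coord (map_mat (trunc A) x) s = (if s \<in> A then coord x s else 0)" for s
    by (rule fmat_eqI) (auto simp: trunc_def)
  have "oh_bound A (coord x) (?t\<^sup>2)" using OH_mnorm_le_iff[OF x t] A by blast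
  then have "oh_bound A (coord (map_mat (trunc A) x)) (?t\<^sup>2)" by (subst oh_bound_cong[of A _ "coord x"]) (auto simp: e)
  then have "oh_bound B (coord (map_mat (trunc A) x)) (?t\<^sup>2)" if "finite B" for B
    by (intro oh_bound_support[OF A(1) _ _ _ that]) (auto simp: e)
  then show "mnorm (OH I) (map_mat (trunc A) x) \<le> ?t" using OH_mnorm_le_iff[OF m t] by blast
qed

lemma OH_functional_bound:
  assumes "f \<in> carrier (op_dual (OH I))"
  obtains C where "0 \<le> C" "\<And>x. x \<in> ell2 \<Longrightarrow> cmod (f x) \<le> C * nrm x"
proof -
  obtain C where C: "\<forall>x\<in>ell2. cmod (f x) \<le> C * nrm x" using assms by (auto simp: op_dual_def)
  have "0 \<le> nrm x" for x by (simp add: vnorm_def OH_mnorm_nonneg)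
  then have "C * nrm x \<le> \<bar>C\<bar> * nrm x" for x by (intro mult_right_mono) auto
  then show ?thesis using C order_trans by (intro that[of "\<bar>C\<bar>"]) (auto, blast)
qed

lemma OH_functional_linear:
  assumes "f \<in> carrier (op_dual (OH I))"
  shows "linear_functional (OH I) f" "x \<notin> ell2 \<Longrightarrow> f x = 0"
    "x \<in> ell2 \<Longrightarrow> y \<in> ell2 \<Longrightarrow> f (\<lambda>i. x i + y i) = f x + f y"
    "x \<in> ell2 \<Longrightarrow> f (\<lambda>i. c * x i) = c * f x"
    "x \<in> ell2 \<Longrightarrow> y \<in> ell2 \<Longrightarrow> f (\<lambda>i. x i - y i) = f x - f y"
proof -
  show l: "linear_functional (OH I) f" and "x \<notin> ell2 \<Longrightarrow> f x = 0" for x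
    using assms by (auto simp: op_dual_def)
  show a: "x \<in> ell2 \<Longrightarrow> y \<in> ell2 \<Longrightarrow> f (\<lambda>i. x i + y i) = f x + f y"
    and s: "x \<in> ell2 \<Longrightarrow> f (\<lambda>i. c * x i) = c * f x" for x y c
    using l unfolding linear_functional_def OH_simps(3,4) by blast+
  show "x \<in> ell2 \<Longrightarrow> y \<in> ell2 \<Longrightarrow> f (\<lambda>i. x i - y i) = f x - f y"
    using a[of x "\<lambda>i. - 1 * y i"] s[of y "- 1"] OH_smult[of y "- 1"] by simp
qed

lemma OH_functional_trunc:
  assumes "f \<in> carrier (op_dual (OH I))" "finite A" "A \<subseteq> I"
  shows "f (trunc A x) = (\<Sum>i\<in>A. x i * f (delta i))"
  using assms(2,3)
proof (induction A)
  case empty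
  show ?case using OH_functional_linear(4)[OF assms(1) zero_in_OH, of 0] by (simp add: trunc_def)
next
  case (insert j A)
  have "trunc (insert j A) x = (\<lambda>i. x j * delta j i + trunc A x i)"
    using insert.hyps by (auto simp: trunc_def delta_def)
  moreover have "delta j \<in> ell2" "trunc A x \<in> ell2"
    using insert by (auto intro: delta_closed trunc_closed)
  ultimately show ?case
    using insert OH_smult[of "delta j" "x j"]
    by (simp add: OH_functional_linear(3)[OF assms(1)] OH_functional_linear(4)[OF assms(1)])
qed

text \<open>Finitely supported vectors are dense, so a bounded functional on \<open>OH I\<close> is
  determined by its values at the vectors \<open>delta i\<close>.\<close>

lemma OH_functional_trunc_tendsto:
  assumes f: "f \<in> carrier (op_dual (OH I))" and x: "x \<in> ell2"
  shows "((\<lambda>A. f (trunc A x)) \<longlongrightarrow> f x) fins"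
proof -
  obtain C where C: "0 \<le> C" "\<And>x. x \<in> ell2 \<Longrightarrow> cmod (f x) \<le> C * nrm x"
    using OH_functional_bound[OF f] by blast
  have "((\<lambda>A. f x - f (trunc A x)) \<longlongrightarrow> 0) fins"
  proof (rule tendsto_0_le[OF OH_trunc_tendsto[OF x]])
    show "eventually (\<lambda>A. norm (f x - f (trunc A x)) \<le> norm (nrm (\<lambda>i. x i - trunc A x i)) * C) fins"
    proof (intro eventually_finite_subsets_at_top_weakI)
      fix A assume A: "finite A" "A \<subseteq> I"
      show "norm (f x - f (trunc A x)) \<le> norm (nrm (\<lambda>i. x i - trunc A x i)) * C"
        using C(2)[OF OH_diff[OF x trunc_closed[OF A]], of x] OH_functional_linear(5)[OF f x trunc_closed[OF A], of x]
        by (simp add: vnorm_def OH_mnorm_nonneg mult.commute)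
    qed
  qed
  then show ?thesis using tendsto_diff[OF tendsto_const[of "f x"]] by fastforce
qed

lemma pairing_index:
  assumes "r < dim_row F * dim_row X" "s < dim_col F * dim_col X"
  shows "mat_pairing b F X $$ (r, s) = b (F $$ (r div dim_row X, s div dim_col X)) (X $$ (r mod dim_row X, s mod dim_col X))"
    "r div dim_row X < dim_row F" "r mod dim_row X < dim_row X" "s div dim_col X < dim_col F" "s mod dim_col X < dim_col X"
proof -
  have "0 < dim_row X" "0 < dim_col X" using assms by (auto intro!: Nat.gr0I)
  then show "r div dim_row X < dim_row F" "r mod dim_row X < dim_row X" "s div dim_col X < dim_col F" "s mod dim_col X < dim_col X"
    using assms by (auto simp: less_mult_imp_div_less)
qed (use assms in \<open>simp add: mat_pairing_def\<close>)

lemma pairing_apply: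
  assumes "r < dim_row F * dim_row X" "s < dim_col F * dim_col X"
  shows "ap F X $$ (r, s) =
    (F $$ (r div dim_row X, s div dim_col X)) (X $$ (r mod dim_row X, s mod dim_col X))"
  by (rule pairing_index(1)[OF assms])

lemma pairing_dim [simp]: "dim_row (mat_pairing b F X) = dim_row F * dim_row X" "dim_col (mat_pairing b F X) = dim_col F * dim_col X"
  by (simp_all add: mat_pairing_def)

subsection \<open>The module tensor product and its dual\<close>

abbreviation (input) CA where "CA \<equiv> cauchy_space H"
abbreviation (input) NA where "NA \<equiv> null_sequences H"
abbreviation (input) TA where "TA \<equiv> op_quotient CA NA"
abbreviation (input) act where "act \<equiv> \<lambda>a x. a \<otimes>\<^bsub>OH I\<^esub> x"
abbreviation (input) NB where "NB \<equiv> balanced_kernel (OH I) (OH I) act"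
abbreviation (input) MA where "MA \<equiv> op_quotient TA NB"

definition gens where
  "gens = {helem (a \<otimes>\<^bsub>OH I\<^esub> b) x \<ominus>\<^bsub>TA\<^esub> helem a (act b x)
         | a b x. a \<in> ell2 \<and> b \<in> ell2 \<and> x \<in> ell2}"

lemma NB_eq: "NB = norm_closure TA (lin_span TA gens)"
  by (simp add: balanced_kernel_def haagerup_tensor_def op_completion_def gens_def)

lemma module_tensor_eq: "haagerup_module_tensor (OH I) (OH I) act = MA"
  by (simp add: haagerup_module_tensor_def haagerup_tensor_def op_completion_def)

interpretation Hm: mspace H by (rule H_mspace)
interpretation CN: mspace_sub CA NA
  using Hm.CS_mspace Hm.null_msubspace by (simp add: mspace_sub_def mspace_sub_axioms_def)
interpretation TA: mspace TA by (rule CN.Q_mspace)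

lemma el_closed: "x \<in> ell2 \<Longrightarrow> y \<in> ell2 \<Longrightarrow> el x y \<in> carrier H"
  using H_carrierI[of 1 "\<lambda>_. x" "\<lambda>_. y"] by simp

lemma elem_eq: "helem x y = CN.q (\<lambda>_. el x y)"
  by (simp add: haagerup_elem_def to_completion_def)

lemma elem_closed: "x \<in> ell2 \<Longrightarrow> y \<in> ell2 \<Longrightarrow> helem x y \<in> carrier TA"
  unfolding elem_eq CN.Q_carrier using Hm.CS_const[OF el_closed] by blast

lemma gens_closed: "gens \<subseteq> carrier TA"
  by (auto simp: gens_def OH_simps(5) intro!: TA.minus_closed elem_closed OH_mult)

interpretation TN: mspace_sub TA NB
  unfolding NB_eq
  by (rule mspace_sub.intro[OF TA.mspace_axioms], rule mspace_sub_axioms.intro,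
      rule norm_closure_msubspace[OF TA.mspace_axioms lin_span_closed[OF TA.mspace_axioms gens_closed]])

interpretation MA: mspace MA by (rule TN.Q_mspace)

section \<open>Canonical maps into the module tensor product\<close>

definition cls where "cls s = TN.q (CN.q s)"
text \<open>While \<open>cls\<close> passes through both quotients, this is its restriction to
  constant sequences: the image of an algebraic tensor in the module tensor product.\<close>

definition emb where "emb u = cls (\<lambda>_. u)"

lemma MA_carrier: "carrier MA = cls ` carrier CA"
  by (auto simp: TN.Q_carrier CN.Q_carrier cls_def)

lemma emb_closed: "u \<in> carrier H \<Longrightarrow> emb u \<in> carrier MA"
  using Hm.CS_const unfolding MA_carrier emb_def by blast

lemma gens_NB: "g \<in> gens \<Longrightarrow> g \<in> NB"
proof -
  assume g: "g \<in> gens"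
  then have gc: "g \<in> carrier TA" using gens_closed by blast
  have "finsum TA (\<lambda>k. (1::complex) \<odot>\<^bsub>TA\<^esub> g) {..<1::nat} = g"
    using gc by (simp add: lessThan_Suc TA.one_smult)
  then have "g \<in> lin_span TA gens"
    unfolding lin_span_def using g
    by (intro CollectI exI[of _ "1::nat"] exI[of _ "\<lambda>_. 1"] exI[of _ "\<lambda>_. g"]) auto
  then show "g \<in> NB"
    unfolding NB_eq norm_closure_def using gc by (auto intro!: bexI[of _ g] simp: a_minus_def TA.r_neg TA.vnorm_zero)
qed

lemma emb_balanced:
  assumes "a \<in> ell2" "b \<in> ell2" "x \<in> ell2"
  shows "emb (el (\<lambda>i. a i * b i) x) = emb (el a (\<lambda>i. b i * x i))"
proof -
  have "helem (a \<otimes>\<^bsub>OH I\<^esub> b) x \<ominus>\<^bsub>TA\<^esub> helem a (act b x) \<in> NB"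
    by (rule gens_NB) (use assms in \<open>auto simp: gens_def\<close>)
  then have "TN.q (helem (a \<otimes>\<^bsub>OH I\<^esub> b) x) = TN.q (helem a (act b x))"
    using TN.q_eq elem_closed OH_mult assms by (simp add: OH_simps(5))
  then show ?thesis by (simp add: emb_def cls_def elem_eq OH_simps(5))
qed

lemma emb_mnorm:
  assumes "u \<in> matrices H n n"
  shows "map_mat emb u \<in> matrices MA n n" "mnorm MA (map_mat emb u) \<le> mnorm H u"
proof -
  note c = Hm.CS_const_mnorm[OF assms]
  have e: "map_mat emb u = map_mat TN.q (map_mat CN.q (map_mat (\<lambda>v _. v) u))"
    by (rule eq_matI) (auto simp: emb_def cls_def)
  show "map_mat emb u \<in> matrices MA n n" unfolding e by (rule TN.q_mat[OF CN.q_mat[OF c(1)]])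
  have "mnorm MA (map_mat emb u) \<le> mnorm TA (map_mat CN.q (map_mat (\<lambda>v _. v) u))"
    unfolding e by (rule TN.Q_mnorm_le[OF CN.q_mat[OF c(1)]])
  also have "\<dots> \<le> mnorm CA (map_mat (\<lambda>v _. v) u)" by (rule CN.Q_mnorm_le[OF c(1)])
  finally show "mnorm MA (map_mat emb u) \<le> mnorm H u" using c(2) by simp
qed

lemma emb_vnorm: assumes "u \<in> carrier H" shows "vnorm MA (emb u) \<le> vnorm H u"
proof -
  have "map_mat emb (mat 1 1 (\<lambda>_. u)) = mat 1 1 (\<lambda>_. emb u)" by (rule eq_matI) auto
  then show ?thesis using emb_mnorm(2)[OF Hm.one_mat[OF assms]] by (simp add: vnorm_def)
qed

lemma MA_mnorm_lift:
  assumes "X \<in> matrices MA n n" "mnorm MA X < t"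
  shows "\<exists>S\<in>matrices CA n n. X = map_mat cls S \<and> mnorm CA S < t"
proof -
  obtain Y where Y: "Y \<in> matrices TA n n" "X = map_mat TN.q Y" "mnorm TA Y < t"
    using TN.Q_mnorm_lift[OF assms] by blast
  obtain S where S: "S \<in> matrices CA n n" "Y = map_mat CN.q S" "mnorm CA S < t"
    using CN.Q_mnorm_lift[OF Y(1,3)] by blast
  have "X = map_mat cls S" by (rule eq_matI) (auto simp: Y(2) S(2) cls_def)
  then show ?thesis using S by blast
qed

section \<open>Functionals on the module tensor product and their coordinates\<close>

lemma MA_functional:
  assumes "p \<in> carrier (op_dual MA)"
  obtains C where "0 \<le> C" "linear_functional MA p" "\<And>X. X \<in> carrier MA \<Longrightarrow> cmod (p X) \<le> C * vnorm MA X"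
    "\<And>X. X \<notin> carrier MA \<Longrightarrow> p X = 0"
proof -
  obtain C where C: "\<forall>X\<in>carrier MA. cmod (p X) \<le> C * vnorm MA X" using assms by (auto simp: op_dual_def)
  have "cmod (p X) \<le> \<bar>C\<bar> * vnorm MA X" if "X \<in> carrier MA" for X
    using C that mult_right_mono[OF abs_ge_self[of C] MA.vnorm_nonneg[OF that]] by (meson order_trans)
  then show ?thesis using assms by (intro that[of "\<bar>C\<bar>"]) (auto simp: op_dual_def)
qed

text \<open>Pulled back through both quotients, a bounded functional lives on Cauchy sequences and
  is there determined by constant ones. So its values on images of algebraic tensors determine
  it.\<close>

lemma MA_functional_cls:
  assumes p: "p \<in> carrier (op_dual MA)" and s: "s \<in> carrier CA"
  shows "(\<lambda>k. p (emb (s k))) \<longlonglongrightarrow> p (cls s)"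
proof -
  obtain C where C: "0 \<le> C" "linear_functional MA p" "\<And>X. X \<in> carrier MA \<Longrightarrow> cmod (p X) \<le> C * vnorm MA X"
    using MA_functional[OF p] by metis
  note t = TN.functional_pullback[OF C(2,3,1)]
  note c = CN.functional_pullback[OF t C(1)]
  show ?thesis using Hm.CS_functional_limit[OF c C(1) s] by (simp add: cls_def emb_def)
qed

lemma MA_functional_emb:
  assumes p: "p \<in> carrier (op_dual MA)"
  shows "u \<in> carrier H \<Longrightarrow> v \<in> carrier H \<Longrightarrow> p (emb (\<lambda>B. u B + v B)) = p (emb u) + p (emb v)"
    "u \<in> carrier H \<Longrightarrow> p (emb (\<lambda>B. c * u B)) = c * p (emb u)"
proof -
  obtain C where C: "0 \<le> C" "linear_functional MA p" "\<And>X. X \<in> carrier MA \<Longrightarrow> cmod (p X) \<le> C * vnorm MA X"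
    using MA_functional[OF p] by metis
  note t = TN.functional_pullback[OF C(2,3,1)]
  note c = CN.functional_pullback[OF t C(1)]
  have ad: "s \<in> carrier CA \<Longrightarrow> t \<in> carrier CA \<Longrightarrow> p (cls (s \<oplus>\<^bsub>CA\<^esub> t)) = p (cls s) + p (cls t)"
    and sc: "s \<in> carrier CA \<Longrightarrow> p (cls (d \<odot>\<^bsub>CA\<^esub> s)) = d * p (cls s)" for s t d
    using c(1) unfolding linear_functional_def cls_def by blast+
  {
    assume u: "u \<in> carrier H"
    show "p (emb (\<lambda>B. c * u B)) = c * p (emb u)"
      using sc[OF Hm.CS_const[OF u]] by (simp add: Hm.CS_simps(3) H_simps(3) emb_def)
    assume v: "v \<in> carrier H"
    show "p (emb (\<lambda>B. u B + v B)) = p (emb u) + p (emb v)"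
      using ad[OF Hm.CS_const[OF u] Hm.CS_const[OF v]] by (simp add: Hm.CS_simps(2) H_simps(2) emb_def)
  }
qed

lemma MA_functional_sum:
  assumes p: "p \<in> carrier (op_dual MA)" and u: "\<And>k. k < n \<Longrightarrow> u k \<in> carrier H"
  shows "p (emb (\<lambda>B. \<Sum>k<n::nat. u k B)) = (\<Sum>k<n. p (emb (u k))) \<and> (\<lambda>B. \<Sum>k<n. u k B) \<in> carrier H"
  using u
proof (induction n)
  case 0
  show ?case using MA_functional_emb(2)[OF p H_zero, of 0] H_zero by simp
next
  case (Suc n)
  then show ?case by (simp add: MA_functional_emb(1)[OF p] H_add)
qed

text \<open>Balancedness annihilates tensors of two distinct basis vectors, so the diagonal values
  carry all the information about \<open>p\<close>. The value 0 off \<open>I\<close> is what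
  membership in \<open>ell2\<close> demands.\<close>

definition coef where "coef p i = (if i \<in> I then p (emb (el (delta i) (delta i))) else 0)"

lemma delta_mult: "(\<lambda>j. delta i j * delta i j) = delta i" "(\<lambda>j. delta i j * y j) = (\<lambda>j. y i * delta i j)"
  by (auto simp: delta_def)

lemma functional_et_trunc:
  assumes p: "p \<in> carrier (op_dual MA)" and A: "finite A" "A \<subseteq> I" and y: "y \<in> ell2"
  shows "p (emb (el (trunc A x) y)) = (\<Sum>i\<in>A. x i * y i * coef p i)"
  using A
proof (induction A)
  case empty
  have "el (trunc {} x) y = (\<lambda>B. 0 * el (\<lambda>_. 0) y B)" by (auto simp: trunc_def el_zero[OF y])
  then show ?case using MA_functional_emb(2)[OF p el_closed[OF zero_in_OH y], of 0] by simp
next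
  case (insert j A)
  have d: "delta j \<in> ell2" "trunc A x \<in> ell2" using insert by (auto intro: delta_closed trunc_closed)
  have "trunc (insert j A) x = (\<lambda>i. x j * delta j i + trunc A x i)"
    using insert.hyps by (auto simp: trunc_def delta_def)
  then have "el (trunc (insert j A) x) y = (\<lambda>B. x j * el (delta j) y B + el (trunc A x) y B)"
    using d y OH_smult[OF d(1)] by (auto simp: el_add el_smult)
  then have "p (emb (el (trunc (insert j A) x) y)) = x j * p (emb (el (delta j) y)) + p (emb (el (trunc A x) y))"
    using d y by (simp add: MA_functional_emb[OF p] H_smult el_closed)
  \<comment> \<open>As \<open>delta j\<close> is idempotent, one copy of it can be moved across the
    tensor sign, where it cuts \<open>y\<close> down to its \<open>j\<close>-th coordinate.\<close>
  also have "p (emb (el (delta j) y)) = p (emb (el (delta j) (\<lambda>i. y j * delta j i)))"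
    using emb_balanced[OF d(1,1) y] by (simp add: delta_mult)
  also have "el (delta j) (\<lambda>i. y j * delta j i) = (\<lambda>B. y j * el (delta j) (delta j) B)"
    using d(1) by (auto simp: el_smult)
  also have "p (emb \<dots>) = y j * coef p j"
    using d(1) insert.prems by (simp add: MA_functional_emb[OF p] el_closed coef_def)
  finally show ?case using insert by (simp add: mult.assoc)
qed

text \<open>The functional is tested on a lift of \<open>trunc F x\<close> through multiplication,
  whose norm is barely larger. The finite support of the first factors reduces its value there to
  the diagonal coordinates.\<close>

lemma coef_finite_bound:
  assumes p: "p \<in> carrier (op_dual MA)"
    and C: "0 \<le> C" "\<And>X. X \<in> carrier MA \<Longrightarrow> cmod (p X) \<le> C * vnorm MA X"
    and F: "finite F" "F \<subseteq> I"
  shows "cmod (\<Sum>i\<in>F. x i * coef p i) \<le> C * nrm (trunc F x)"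
proof (rule field_le_epsilon)
  fix e :: real assume e: "0 < e"
  define v where "v = nrm (trunc F x)"
  define t where "t = v + e / (C + 1)"
  have t: "v < t" using e C(1) by (simp add: t_def)
  have X: "mat 1 1 (\<lambda>_. trunc F x) \<in> Mat 1 1" by (rule matrices_I) (simp_all add: trunc_closed[OF F])
  have tX: "mnorm (OH I) (mat 1 1 (\<lambda>_. trunc F x)) < t" using t by (simp add: v_def vnorm_def)
  have "\<exists>a b k. a \<in> Mat 1 k \<and> b \<in> Mat k 1 \<and>
    (\<forall>i<1. \<forall>l<k. \<forall>s. s \<notin> F \<longrightarrow> (a $$ (i, l)) s = 0) \<and>
    mnorm H (tp a b) \<le> t \<and> map_mat mul (tp a b) = mat 1 1 (\<lambda>_. trunc F x)"
    by (rule mul_lift[OF F X tX]) (auto simp: trunc_def)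
  then obtain a b k where a: "a \<in> Mat 1 k" "b \<in> Mat k 1"
    "\<And>l s. l < k \<Longrightarrow> s \<notin> F \<Longrightarrow> (a $$ (0, l)) s = 0"
    "mnorm H (tp a b) \<le> t" "map_mat mul (tp a b) = mat 1 1 (\<lambda>_. trunc F x)"
    by auto
  define u where "u = tp a b $$ (0, 0)"
  note da = matrices_D[OF a(1)] and db = matrices_D[OF a(2)]
  have ca: "a $$ (0, l) \<in> ell2" "b $$ (l, 0) \<in> ell2" if "l < k" for l
    using da(3)[of 0 l] db(3)[of l 0] that by auto
  have u: "u = (\<lambda>B. \<Sum>l<k. el (a $$ (0, l)) (b $$ (l, 0)) B)" using da db by (simp add: u_def tp_index)
  have uc: "u \<in> carrier H" using MA_functional_sum[OF p, of k "\<lambda>l. el (a $$ (0, l)) (b $$ (l, 0))"] ca by (simp add: u el_closed)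
  have "mat 1 1 (\<lambda>_. u) = tp a b"
    using da db by (intro eq_matI) (auto simp: u_def tp_index)
  then have un: "vnorm H u \<le> t" using a(4) by (simp add: vnorm_def)
  have mulu: "(\<Sum>l<k. (a $$ (0, l)) s * (b $$ (l, 0)) s) = trunc F x s" for s
    using arg_cong[OF a(5), of "\<lambda>m. (m $$ (0, 0)) s"] mul_tp[OF a(1,2), of 0 0] da db by (simp add: tp_index)
  have "p (emb u) = (\<Sum>l<k. p (emb (el (a $$ (0, l)) (b $$ (l, 0)))))"
    using MA_functional_sum[OF p, of k "\<lambda>l. el (a $$ (0, l)) (b $$ (l, 0))"] ca by (simp add: u el_closed)
  also have "\<dots> = (\<Sum>l<k. \<Sum>i\<in>F. (a $$ (0, l)) i * (b $$ (l, 0)) i * coef p i)"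
  proof (intro sum.cong refl)
    fix l assume l: "l \<in> {..<k}"
    have "trunc F (a $$ (0, l)) = a $$ (0, l)" using a(3)[of l] l by (auto simp: trunc_def)
    then show "p (emb (el (a $$ (0, l)) (b $$ (l, 0)))) = (\<Sum>i\<in>F. (a $$ (0, l)) i * (b $$ (l, 0)) i * coef p i)"
      using functional_et_trunc[OF p F ca(2)[of l], of "a $$ (0, l)"] l by simp
  qed
  also have "\<dots> = (\<Sum>i\<in>F. x i * coef p i)"
    by (subst sum.swap) (simp add: mulu trunc_def flip: sum_distrib_right)
  finally have "cmod (\<Sum>i\<in>F. x i * coef p i) = cmod (p (emb u))" by simp
  also have "\<dots> \<le> C * vnorm MA (emb u)" using C(2) emb_closed[OF uc] by blast
  also have "\<dots> \<le> C * t" using emb_vnorm[OF uc] un C(1) by (intro mult_left_mono) auto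
  also have "\<dots> \<le> C * v + e"
  proof -
    have "C * (e / (C + 1)) \<le> e" using e C(1) by (simp add: divide_le_eq)
    then show ?thesis by (simp add: t_def distrib_left)
  qed
  finally show "cmod (\<Sum>i\<in>F. x i * coef p i) \<le> C * nrm (trunc F x) + e" by (simp add: v_def)
qed

text \<open>The finite bound is tested with the conjugates of the coordinates themselves, as in the
  Riesz representation of functionals on a Hilbert space.\<close>

lemma coef_ell2:
  assumes p: "p \<in> carrier (op_dual MA)"
  shows "coef p \<in> ell2"
proof -
  obtain C where C: "0 \<le> C" "linear_functional MA p" "\<And>X. X \<in> carrier MA \<Longrightarrow> cmod (p X) \<le> C * vnorm MA X"
    using MA_functional[OF p] by metis
  have "(\<Sum>i\<in>F. (cmod (coef p i))\<^sup>2) \<le> C\<^sup>2" if F: "finite F" "F \<subseteq> I" for F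
  proof -
    define S where "S = (\<Sum>i\<in>F. (cmod (coef p i))\<^sup>2)"
    have S: "0 \<le> S" by (simp add: S_def sum_nonneg)
    have "(\<Sum>i\<in>F. cnj (coef p i) * coef p i) = of_real S"
      by (simp add: S_def mult_cnj_cmod)
    then have "S = cmod (\<Sum>i\<in>F. cnj (coef p i) * coef p i)" using S by simp
    also have "\<dots> \<le> C * nrm (trunc F (\<lambda>i. cnj (coef p i)))" by (rule coef_finite_bound[OF p C(1,3) F])
    also have "nrm (trunc F (\<lambda>i. cnj (coef p i))) = sqrt S"
      using OH_vnorm_finite[OF F, of "trunc F (\<lambda>i. cnj (coef p i))"] by (simp add: trunc_def S_def)
    finally have "sqrt S * sqrt S \<le> C * sqrt S" using S by simp
    then have "sqrt S \<le> C" 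
      using S C(1) by (cases "S = 0") (simp, metis less_le mult_right_le_imp_le real_sqrt_gt_zero)
    then show ?thesis using S C(1) unfolding S_def[symmetric] by (metis real_sqrt_le_iff real_sqrt_unique)
  qed
  then have "(\<lambda>i. (cmod (coef p i))\<^sup>2) summable_on I"
    by (intro nonneg_bdd_above_summable_on bdd_aboveI[of _ "C\<^sup>2"]) auto
  then show ?thesis by (simp add: OH_simps coef_def)
qed

text \<open>Formally this is \<open>p\<close> composed with the inverse of multiplication; the
  description by coordinates avoids constructing that inverse.\<close>

definition restrict_dual where
  "restrict_dual p x = (if x \<in> ell2 then \<Sum>\<^sub>\<infinity>i\<in>I. x i * coef p i else 0)"

lemma OH_mult_summable:
  "x \<in> ell2 \<Longrightarrow> y \<in> ell2 \<Longrightarrow> (\<lambda>i. x i * y i) summable_on I"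
  by (rule abs_summable_summable, rule ell2_mult_summable) (auto simp: OH_simps)

lemma restrict_dual_tendsto:
  assumes p: "p \<in> carrier (op_dual MA)" and x: "x \<in> ell2"
  shows "((\<lambda>A. \<Sum>i\<in>A. x i * coef p i) \<longlongrightarrow> restrict_dual p x) fins"
  using infsum_tendsto[OF OH_mult_summable[OF x coef_ell2[OF p]]] x by (simp add: restrict_dual_def)

lemma restrict_dual_closed:
  assumes p: "p \<in> carrier (op_dual MA)"
  shows "restrict_dual p \<in> carrier (op_dual (OH I))"
proof -
  obtain C where C: "0 \<le> C" "linear_functional MA p" "\<And>X. X \<in> carrier MA \<Longrightarrow> cmod (p X) \<le> C * vnorm MA X"
    using MA_functional[OF p] by metis
  note c = coef_ell2[OF p]
  have "linear_functional (OH I) (restrict_dual p)"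
    unfolding linear_functional_def
  proof (intro conjI ballI allI)
    fix x assume x: "x \<in> ell2"
    show "restrict_dual p (a \<odot>\<^bsub>OH I\<^esub> x) = a * restrict_dual p x" for a
      using x OH_smult[OF x] by (simp add: restrict_dual_def OH_simps(4) mult.assoc infsum_cmult_right')
    fix y assume y: "y \<in> ell2"
    show "restrict_dual p (x \<oplus>\<^bsub>OH I\<^esub> y) = restrict_dual p x + restrict_dual p y"
      using x y OH_add[OF x y] infsum_add[OF OH_mult_summable[OF x c] OH_mult_summable[OF y c]]
      by (simp add: restrict_dual_def OH_simps(3) distrib_right)
  qed
  moreover have "cmod (restrict_dual p x) \<le> C * nrm x" if x: "x \<in> ell2" for x
  proof (rule tendsto_upperbound[OF tendsto_norm[OF restrict_dual_tendsto[OF p x]]])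
    show "eventually (\<lambda>A. norm (\<Sum>i\<in>A. x i * coef p i) \<le> C * nrm x) fins"
    proof (intro eventually_finite_subsets_at_top_weakI)
      fix A assume A: "finite A" "A \<subseteq> I"
      have "norm (\<Sum>i\<in>A. x i * coef p i) \<le> C * nrm (trunc A x)" by (rule coef_finite_bound[OF p C(1,3) A])
      also have "\<dots> \<le> C * nrm x" by (intro mult_left_mono OH_vnorm_trunc_le x A C)
      finally show "norm (\<Sum>i\<in>A. x i * coef p i) \<le> C * nrm x" .
    qed
  qed simp
  ultimately show ?thesis by (auto simp: op_dual_def restrict_dual_def)
qed

text \<open>This gives continuity of elementary tensors in the first factor, which is approximated
  by its truncations.\<close>

lemma el_vnorm:
  assumes "x \<in> ell2" "y \<in> ell2"
  shows "vnorm H (el x y) \<le> nrm x * nrm y"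
proof -
  have m: "mat 1 1 (\<lambda>_. z) \<in> Mat 1 1" if "z \<in> ell2" for z by (rule matrices_I) (use that in auto)
  have o: "oh_bound_mat ((nrm z)\<^sup>2) (mat 1 1 (\<lambda>_. z))" if "z \<in> ell2" for z
    using OH_mnorm_le_iff[OF m[OF that] OH_mnorm_nonneg[of I "mat 1 1 (\<lambda>_. z)"]] by (auto simp: oh_bound_mat_def vnorm_def)
  have "mat 1 1 (\<lambda>_. el x y) = tp (mat 1 1 (\<lambda>_. x)) (mat 1 1 (\<lambda>_. y))"
    by (rule eq_matI) (auto simp: tp_index)
  then show ?thesis
    using H_mnorm_le[OF m[OF assms(1)] o[OF assms(1)] m[OF assms(2)] o[OF assms(2)]]
    by (simp add: vnorm_def OH_mnorm_nonneg)
qed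

text \<open>Truncating the first tensor factor reduces to finite sums, where balancedness makes
  the functional diagonal.\<close>

lemma functional_et:
  assumes p: "p \<in> carrier (op_dual MA)" and x: "x \<in> ell2" and y: "y \<in> ell2"
  shows "p (emb (el x y)) = restrict_dual p (\<lambda>i. x i * y i)"
proof (rule tendsto_unique[OF _ _ restrict_dual_tendsto[OF p OH_mult[OF x y]]])
  obtain C where C: "0 \<le> C" "linear_functional MA p" "\<And>X. X \<in> carrier MA \<Longrightarrow> cmod (p X) \<le> C * vnorm MA X"
    using MA_functional[OF p] by metis
  have "((\<lambda>A. p (emb (el x y)) - (\<Sum>i\<in>A. x i * y i * coef p i)) \<longlongrightarrow> 0) fins"
  proof (rule tendsto_0_le[OF OH_trunc_tendsto[OF x]])
    show "eventually (\<lambda>A. norm (p (emb (el x y)) - (\<Sum>i\<in>A. x i * y i * coef p i)) \<le>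
        norm (nrm (\<lambda>i. x i - trunc A x i)) * (C * nrm y)) fins"
    proof (intro eventually_finite_subsets_at_top_weakI)
      fix A assume A: "finite A" "A \<subseteq> I"
      note tc = trunc_closed[OF A, of x]
      note dc = OH_diff[OF x tc]
      have "el x y = (\<lambda>B. el (\<lambda>i. x i - trunc A x i) y B + el (trunc A x) y B)"
        using el_add(1)[OF dc tc y] by auto
      then have "p (emb (el x y)) = p (emb (el (\<lambda>i. x i - trunc A x i) y)) + p (emb (el (trunc A x) y))"
        by (metis MA_functional_emb(1)[OF p el_closed[OF dc y] el_closed[OF tc y]])
      then have "norm (p (emb (el x y)) - (\<Sum>i\<in>A. x i * y i * coef p i)) = cmod (p (emb (el (\<lambda>i. x i - trunc A x i) y)))"
        by (simp add: functional_et_trunc[OF p A y])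
      also have "\<dots> \<le> C * vnorm MA (emb (el (\<lambda>i. x i - trunc A x i) y))" using C(3) emb_closed[OF el_closed[OF dc y]] by blast
      also have "\<dots> \<le> C * (nrm (\<lambda>i. x i - trunc A x i) * nrm y)"
        by (intro mult_left_mono C order_trans[OF emb_vnorm el_vnorm] el_closed dc y)
      finally show "norm (p (emb (el x y)) - (\<Sum>i\<in>A. x i * y i * coef p i)) \<le>
        norm (nrm (\<lambda>i. x i - trunc A x i)) * (C * nrm y)"
        by (simp add: vnorm_def OH_mnorm_nonneg mult_ac)
    qed
  qed
  then show "((\<lambda>A. \<Sum>i\<in>A. x i * y i * coef p i) \<longlongrightarrow> p (emb (el x y))) fins"
    using tendsto_diff[OF tendsto_const[of "p (emb (el x y))"]] by fastforce
qed simp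

text \<open>On algebraic tensors every functional factors through multiplication, by linearity from
  the case of elementary tensors. Both isometry estimates and injectivity rest on this.\<close>

lemma functional_emb_mul:
  assumes p: "p \<in> carrier (op_dual MA)" and u: "u \<in> carrier H"
  shows "p (emb u) = restrict_dual p (mul u)"
proof -
  obtain n x y where u: "u = (\<lambda>B. \<Sum>k<n::nat. el (x k) (y k) B)" "\<And>k. k < n \<Longrightarrow> x k \<in> ell2 \<and> y k \<in> ell2"
    using u unfolding H_carrier by blast
  note r = OH_functional_linear[OF restrict_dual_closed[OF p]]
  have "restrict_dual p (\<lambda>i. \<Sum>k<n. mul (el (x k) (y k)) i) = (\<Sum>k<n. restrict_dual p (mul (el (x k) (y k))))"
    using u(2)
  proof (induction n)
    case 0
    show ?case using r(4)[OF zero_in_OH, of 0] by simp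
  next
    case (Suc n)
    then show ?case by (simp add: r(3) OH_sum mul_closed el_closed)
  qed
  then show ?thesis
    using u(2) MA_functional_sum[OF p, of n "\<lambda>k. el (x k) (y k)"]
    by (simp add: u(1) mul_linear el_closed functional_et[OF p] mul_el)
qed

section \<open>The map between the duals: bijectivity and complete isometry\<close>

lemma functional_cls:
  assumes p: "p \<in> carrier (op_dual MA)" and s: "s \<in> carrier CA"
  shows "(\<lambda>k. restrict_dual p (mul (s k))) \<longlonglongrightarrow> p (cls s)"
  using MA_functional_cls[OF p s] functional_emb_mul[OF p Hm.CS_D[OF s]] by simp

text \<open>The composition of \<open>f\<close> with multiplication extends to Cauchy sequences,
  descends to the completion and, as pointwise multiplication is associative, to the module
  quotient. The same constant bounds it at every stage.\<close>

lemma restrict_dual_surj: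
  assumes f: "f \<in> carrier (op_dual (OH I))"
  shows "\<exists>p\<in>carrier (op_dual MA). restrict_dual p = f"
proof -
  obtain C where C: "0 \<le> C" "\<And>x. x \<in> ell2 \<Longrightarrow> cmod (f x) \<le> C * nrm x"
    using OH_functional_bound[OF f] by blast
  note fl = OH_functional_linear[OF f]
  have lin: "linear_functional H (\<lambda>u. f (mul u))"
    unfolding linear_functional_def by (simp add: H_simps(2,3) mul_linear fl mul_closed)
  have bd: "cmod (f (mul u)) \<le> C * vnorm H u" if u: "u \<in> carrier H" for u
  proof -
    have "map_mat mul (mat 1 1 (\<lambda>_. u)) = mat 1 1 (\<lambda>_. mul u)" by (rule eq_matI) auto
    then have "nrm (mul u) \<le> vnorm H u"
      using mul_contractive(2)[OF Hm.one_mat[OF u]] by (simp add: vnorm_def)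
    then have "C * nrm (mul u) \<le> C * vnorm H u" using C(1) by (rule mult_left_mono)
    then show ?thesis using C(2)[OF mul_closed[OF u]] by simp
  qed
  obtain g where g: "linear_functional CA g" "\<And>s. s \<in> carrier CA \<Longrightarrow> (\<lambda>k. f (mul (s k))) \<longlonglongrightarrow> g s"
    "\<And>s. s \<in> carrier CA \<Longrightarrow> cmod (g s) \<le> C * vnorm CA s"
    using Hm.CS_functional_extend[OF lin bd C(1)] by blast
  have gconst: "g (\<lambda>_. u) = f (mul u)" if "u \<in> carrier H" for u
    using g(2)[OF Hm.CS_const[OF that]] by (simp add: LIMSEQ_const_iff)
  have gnull: "g s = 0" if "s \<in> NA" for s
    using g(3)[of s] that by (simp add: Hm.null_sequences_iff)
  obtain h where h: "linear_functional TA h" "\<And>s. s \<in> carrier CA \<Longrightarrow> h (CN.q s) = g s"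
    "\<And>X. X \<in> carrier TA \<Longrightarrow> cmod (h X) \<le> C * vnorm TA X"
    using CN.functional_descend[OF g(1) gnull g(3) C(1)] by blast
  have hel: "h (helem x y) = f (\<lambda>i. x i * y i)" if "x \<in> ell2" "y \<in> ell2" for x y
    using that by (simp add: elem_eq h(2) Hm.CS_const el_closed gconst mul_el)
  have "h w = 0" if "w \<in> gens" for w
  proof -
    obtain a b x where w: "w = helem (a \<otimes>\<^bsub>OH I\<^esub> b) x \<ominus>\<^bsub>TA\<^esub> helem a (act b x)"
      and c: "a \<in> ell2" "b \<in> ell2" "x \<in> ell2"
      using \<open>w \<in> gens\<close> unfolding gens_def by blast
    show ?thesis
      using TA.functional_minus[OF h(1) elem_closed elem_closed, of "\<lambda>i. a i * b i" x a "\<lambda>i. b i * x i"] c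
      by (simp add: w OH_simps(5) OH_mult hel mult.assoc)
  qed
  then have "h w = 0" if "w \<in> NB" for w
    using functional_zero_closure[OF TA.mspace_axioms gens_closed h(1) _ h(3) C(1)] that unfolding NB_eq by blast
  then obtain p0 where p0: "linear_functional MA p0" "\<And>X. X \<in> carrier TA \<Longrightarrow> p0 (TN.q X) = h X"
    "\<And>X. X \<in> carrier MA \<Longrightarrow> cmod (p0 X) \<le> C * vnorm MA X"
    using TN.functional_descend[OF h(1) _ h(3) C(1)] by blast
  \<comment> \<open>Functionals in \<open>op_dual\<close> have to vanish off the carrier.\<close>
  define p where "p X = (if X \<in> carrier MA then p0 X else 0)" for X
  have "linear_functional MA p"
    using p0(1) unfolding linear_functional_def by (simp add: p_def)
  then have p: "p \<in> carrier (op_dual MA)"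
    using p0(3) by (auto simp: op_dual_def p_def)
  have pemb: "p (emb u) = f (mul u)" if "u \<in> carrier H" for u
  proof -
    have c: "(\<lambda>_. u) \<in> carrier CA" by (rule Hm.CS_const[OF that])
    then have "CN.q (\<lambda>_. u) \<in> carrier TA" unfolding CN.Q_carrier by blast
    then show ?thesis using emb_closed[OF that] c
      by (simp add: p_def emb_def cls_def p0(2) h(2) gconst[OF that])
  qed
  have coef: "coef p i = f (delta i)" if "i \<in> I" for i
    using that delta_closed[OF that] by (simp add: coef_def pemb el_closed mul_el delta_mult)
  have "restrict_dual p x = f x" for x
  proof (cases "x \<in> ell2")
    case True
    have "eventually (\<lambda>A. f (trunc A x) = (\<Sum>i\<in>A. x i * coef p i)) fins"
      by (intro eventually_finite_subsets_at_top_weakI)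
        (auto simp: OH_functional_trunc[OF f] coef subset_iff intro!: sum.cong)
    then have "((\<lambda>A. \<Sum>i\<in>A. x i * coef p i) \<longlongrightarrow> f x) fins"
      by (rule Lim_transform_eventually[OF OH_functional_trunc_tendsto[OF f True]])
    then show ?thesis using tendsto_unique[OF _ restrict_dual_tendsto[OF p True]] by simp
  next
    case False
    then show ?thesis using fl(2) by (simp add: restrict_dual_def)
  qed
  then show ?thesis using p by blast
qed

lemma restrict_dual_inj:
  assumes "p \<in> carrier (op_dual MA)" "p' \<in> carrier (op_dual MA)" "restrict_dual p = restrict_dual p'"
  shows "p = p'"
proof
  fix X
  show "p X = p' X"
  proof (cases "X \<in> carrier MA")
    case True
    then obtain s where s: "s \<in> carrier CA" "X = cls s" by (auto simp: MA_carrier)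
    then show ?thesis using LIMSEQ_unique[OF functional_cls[OF assms(1) s(1)]] functional_cls[OF assms(2) s(1)] assms(3) by simp
  next
    case False
    then show ?thesis using MA_functional[OF assms(1)] MA_functional[OF assms(2)] by metis
  qed
qed

text \<open>Contractivity of multiplication gives this direction. A matrix in the unit ball lifts to
  Cauchy sequences of tensors whose products eventually have norm below \<open>1 + e\<close>, and
  entrywise limits preserve the bound. An arbitrary \<open>z\<close> is used because sets of upper
  bounds are compared.\<close>

lemma restrict_dual_isometry_le:
  assumes F: "F \<in> matrices (op_dual MA) n n"
    and z: "\<And>x k. x \<in> Mat k k \<Longrightarrow> mnorm (OH I) x \<le> 1 \<Longrightarrow>
      mat_opnorm (ap (map_mat restrict_dual F) x) \<le> z"
    and X: "X \<in> matrices MA k k" "mnorm MA X \<le> 1"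
  shows "mat_opnorm (ap F X) \<le> z"
proof -
  note dF = matrices_D[OF F] and dX = matrices_D[OF X(1)]
  have "mat_opnorm (ap F X) \<le> (1 + e) * z" if e: "0 < e" for e
  proof -
    define q where "q = 1 + e"
    have q: "q > 0" "1 < q" using e by (auto simp: q_def)
    \<comment> \<open>The hypothesis speaks of the unit ball, so the products of norm below
      \<open>q\<close> are scaled by \<open>1 / q\<close> and the result is scaled back.\<close>
    define c where "c = complex_of_real (1 / q)"
    have c: "cmod c = 1 / q" "of_real q * c = 1" "cmod (of_real q) = q"
      using q by (simp_all add: c_def norm_divide)
    obtain S where S: "S \<in> matrices CA k k" "X = map_mat cls S" "mnorm CA S < 1 + e"
      using MA_mnorm_lift[OF X(1), of "1 + e"] X(2) e by auto
    note dS = matrices_D[OF S(1)]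
    define x where "x j = map_mat mul (map_mat (\<lambda>s. s j) S)" for j
    have x: "x j \<in> Mat k k" "mnorm (OH I) (x j) \<le> mnorm H (map_mat (\<lambda>s. s j) S)" for j
      using mul_contractive[OF Hm.CS_mat[OF S(1)]] by (auto simp: x_def)
    have "eventually (\<lambda>j. mnorm H (map_mat (\<lambda>s. s j) S) < 1 + e) sequentially"
      by (rule order_tendstoD(2)[OF Hm.CS_mnorm_tendsto[OF S(1)] S(3)])
    then have bd: "eventually (\<lambda>j. mat_opnorm (ap (map_mat restrict_dual F) (x j)) \<le> (1 + e) * z) sequentially"
    proof eventually_elim
      case (elim j)
      note sc = OH_mnorm_scale[OF x(1)[of j], of c]
      have "cmod c * mnorm (OH I) (x j) \<le> 1"
        using x(2)[of j] elim q by (simp add: c divide_le_eq q_def)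
      then have n1: "mnorm (OH I) (mat_scale (OH I) c (x j)) \<le> 1" using sc(2) by linarith
      have "mat_opnorm (ap (map_mat restrict_dual F) (x j)) \<le>
        cmod (of_real q) * mat_opnorm (ap (map_mat restrict_dual F) (mat_scale (OH I) c (x j)))"
      proof (rule mat_opnorm_scaled)
        fix r s assume rs: "r < dim_row (ap (map_mat restrict_dual F) (mat_scale (OH I) c (x j)))"
          "s < dim_col (ap (map_mat restrict_dual F) (mat_scale (OH I) c (x j)))"
        have dx: "dim_row (x j) = k" "dim_col (x j) = k" using matrices_D(1,2)[OF x(1)] by auto
        have rs': "r < n * k" "s < n * k" using rs dx dF by (auto simp: mat_scale_def)
        note i = pairing_index[of r "map_mat restrict_dual F" "x j" s] pairing_index[of r "map_mat restrict_dual F" "mat_scale (OH I) c (x j)" s]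
        define f where "f = F $$ (r div k, s div k)"
        define y where "y = x j $$ (r mod k, s mod k)"
        have lt: "r div k < n" "r mod k < k" "s div k < n" "s mod k < k" using i(2-5) rs' dF dx by auto
        have f: "restrict_dual f \<in> carrier (op_dual (OH I))" unfolding f_def by (intro restrict_dual_closed dF(3) lt)
        have y: "y \<in> ell2" unfolding y_def by (intro matrices_D(3)[OF x(1)] lt)
        show "ap (map_mat restrict_dual F) (x j) $$ (r, s) =
          of_real q * ap (map_mat restrict_dual F) (mat_scale (OH I) c (x j)) $$ (r, s)"
          using pairing_apply[of r "map_mat restrict_dual F" "x j" s]
            pairing_apply[of r "map_mat restrict_dual F" "mat_scale (OH I) c (x j)" s]
            rs' dF(1,2) dx lt c(2) OH_functional_linear(4)[OF f y, of c]
          by (simp add: mat_scale_def OH_simps(4) f_def[symmetric] y_def[symmetric] flip: mult.assoc)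
      qed (simp_all add: mat_scale_def)
      also have "\<dots> \<le> cmod (of_real q) * z" by (intro mult_left_mono z[OF sc(1) n1]) simp
      finally show ?case unfolding c(3) unfolding q_def .
    qed
    show ?thesis
    proof (rule mat_opnorm_limit[OF _ _ _ _ bd])
      have dx: "dim_row (x j) = k" "dim_col (x j) = k" for j using matrices_D(1,2)[OF x(1)] by auto
      show "dim_row (ap (map_mat restrict_dual F) (x j)) = dim_row (ap F X)"
        "dim_col (ap (map_mat restrict_dual F) (x j)) = dim_col (ap F X)" for j
        using dx dX by auto
      fix r s assume "r < dim_row (ap F X)" "s < dim_col (ap F X)"
      then have rs: "r < n * k" "s < n * k" using dF dX by auto
      note i = pairing_index[of r F X s]
      have lt: "r div k < n" "r mod k < k" "s div k < n" "s mod k < k" using i(2-5) rs dF dX by auto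
      define f where "f = F $$ (r div k, s div k)"
      define y where "y = S $$ (r mod k, s mod k)"
      have "(\<lambda>j. restrict_dual f (mul (y j))) \<longlonglongrightarrow> f (cls y)"
        unfolding f_def y_def by (intro functional_cls dF(3) dS(3) lt)
      moreover have "ap (map_mat restrict_dual F) (x j) $$ (r, s) = restrict_dual f (mul (y j))" for j
        using pairing_apply[of r "map_mat restrict_dual F" "x j" s] rs dF dx lt dS by (simp add: f_def y_def x_def)
      moreover have "ap F X $$ (r, s) = f (cls y)"
        using pairing_apply[of r F X s] rs dF(1,2) dX(1,2) lt dS(1,2) by (simp add: f_def y_def S(2))
      ultimately show "(\<lambda>j. ap (map_mat restrict_dual F) (x j) $$ (r, s)) \<longlonglongrightarrow> ap F X $$ (r, s)"
        by simp
    qed simp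
  qed
  note * = this
  have "((\<lambda>e. (1 + e) * z) \<longlongrightarrow> (1 + 0) * z) (at_right 0)" by (intro tendsto_intros)
  then have "mat_opnorm (ap F X) \<le> (1 + 0) * z"
    by (rule tendsto_lowerbound) (auto intro!: eventually_at_rightI[of 0 1] *)
  then show ?thesis by simp
qed

text \<open>Lifting gives the reverse direction. A truncation of \<open>x\<close> has finite support
  and is the image under \<open>mul\<close> of a tensor matrix of norm at most \<open>1 + e\<close>,
  whose class tests \<open>F\<close>. First \<open>e\<close> tends to 0, then the truncation is
  removed by an entrywise limit.\<close>

lemma restrict_dual_isometry_ge:
  assumes F: "F \<in> matrices (op_dual MA) n n"
    and z: "\<And>X k. X \<in> matrices MA k k \<Longrightarrow> mnorm MA X \<le> 1 \<Longrightarrow> mat_opnorm (ap F X) \<le> z"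
    and x: "x \<in> Mat k k" "mnorm (OH I) x \<le> 1"
  shows "mat_opnorm (ap (map_mat restrict_dual F) x) \<le> z"
proof -
  note dF = matrices_D[OF F] and dx = matrices_D[OF x(1)]
  have fin: "mat_opnorm (ap (map_mat restrict_dual F) (map_mat (trunc A) x)) \<le> (1 + e) * z"
    if A: "finite A" "A \<subseteq> I" and e: "0 < e" for A e
  proof -
    define q where "q = 1 + e"
    have q: "q > 0" "1 < q" using e by (auto simp: q_def)
    define c where "c = complex_of_real (1 / q)"
    have c: "cmod c = 1 / q" "of_real q * c = 1" "cmod (of_real q) = q"
      using q by (simp_all add: c_def norm_divide)
    note tr = OH_mnorm_trunc[OF x(1) A]
    have "mnorm (OH I) (map_mat (trunc A) x) < 1 + e" using tr(2) x(2) e by linarith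
    then have "\<exists>a b j. a \<in> Mat k j \<and> b \<in> Mat j k \<and>
      (\<forall>i<k. \<forall>l<j. \<forall>s. s \<notin> A \<longrightarrow> (a $$ (i, l)) s = 0) \<and>
      mnorm H (tp a b) \<le> 1 + e \<and> map_mat mul (tp a b) = map_mat (trunc A) x"
      by (rule mul_lift[OF A tr(1)]) (use dx in \<open>auto simp: trunc_def\<close>)
    then obtain a b j where ab: "a \<in> Mat k j" "b \<in> Mat j k"
      "mnorm H (tp a b) \<le> 1 + e" "map_mat mul (tp a b) = map_mat (trunc A) x"
      by blast
    define u where "u = tp a b"
    have u: "u \<in> matrices H k k" "mnorm H u \<le> 1 + e" "map_mat mul u = map_mat (trunc A) x"
      using tp_closed[OF ab(1,2)] ab by (auto simp: u_def)
    note du = matrices_D[OF u(1)]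
    define X where "X = mat_scale MA c (map_mat emb u)"
    note em = emb_mnorm[OF u(1)]
    have X: "X \<in> matrices MA k k" unfolding X_def by (rule MA.mat_scale_closed[OF em(1)])
    have "mnorm MA X \<le> cmod c * mnorm MA (map_mat emb u)" unfolding X_def by (rule MA.mnorm_scale[OF em(1)])
    also have "\<dots> \<le> cmod c * (1 + e)" using em(2) u(2) by (intro mult_left_mono) auto
    also have "\<dots> = 1" using q by (simp add: c(1) q_def)
    finally have zX: "mat_opnorm (ap F X) \<le> z" by (rule z[OF X])
    have dX: "dim_row X = k" "dim_col X = k" using matrices_D[OF X] by auto
    have "mat_opnorm (ap (map_mat restrict_dual F) (map_mat (trunc A) x)) \<le>
      cmod (of_real q) * mat_opnorm (ap F X)"
    proof (rule mat_opnorm_scaled)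
      fix r s assume "r < dim_row (ap F X)" "s < dim_col (ap F X)"
      then have rs: "r < n * k" "s < n * k" using dF dX by auto
      note i = pairing_index[of r F X s]
      have lt: "r div k < n" "r mod k < k" "s div k < n" "s mod k < k" using i(2-5) rs dF dX by auto
      define f where "f = F $$ (r div k, s div k)"
      define w where "w = u $$ (r mod k, s mod k)"
      have f: "f \<in> carrier (op_dual MA)" unfolding f_def by (intro dF(3) lt)
      have w: "w \<in> carrier H" unfolding w_def by (intro du(3) lt)
      obtain C where "linear_functional MA f" using MA_functional[OF f] by metis
      then have "f (c \<odot>\<^bsub>MA\<^esub> emb w) = c * f (emb w)"
        using emb_closed[OF w] unfolding linear_functional_def by blast
      then have "ap F X $$ (r, s) = c * f (emb w)"
        using pairing_apply[of r F X s] rs dF(1,2) dX du(1,2) lt by (simp add: X_def mat_scale_def f_def w_def)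
      moreover have "mul w = trunc A (x $$ (r mod k, s mod k))"
        using arg_cong[OF u(3), of "\<lambda>m. m $$ (r mod k, s mod k)"] lt du dx by (simp add: w_def)
      then have "ap (map_mat restrict_dual F) (map_mat (trunc A) x) $$ (r, s) = restrict_dual f (mul w)"
        using pairing_apply[of r "map_mat restrict_dual F" "map_mat (trunc A) x" s] rs dF dx lt by (simp add: f_def)
      moreover have "complex_of_real q * c = 1" by (rule c(2))
      ultimately show "ap (map_mat restrict_dual F) (map_mat (trunc A) x) $$ (r, s) =
          of_real q * ap F X $$ (r, s)"
        using functional_emb_mul[OF f w] by (simp flip: mult.assoc)
    qed (use dX dx in auto)
    also have "\<dots> \<le> cmod (of_real q) * z" by (intro mult_left_mono zX) simp
    finally show ?thesis unfolding c(3) unfolding q_def .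
  qed
  have fin': "mat_opnorm (ap (map_mat restrict_dual F) (map_mat (trunc A) x)) \<le> z"
    if A: "finite A" "A \<subseteq> I" for A
  proof -
    have "((\<lambda>e. (1 + e) * z) \<longlongrightarrow> (1 + 0) * z) (at_right 0)" by (intro tendsto_intros)
    then have "mat_opnorm (ap (map_mat restrict_dual F) (map_mat (trunc A) x)) \<le> (1 + 0) * z"
      by (rule tendsto_lowerbound) (auto intro!: eventually_at_rightI[of 0 1] fin[OF A])
    then show ?thesis by simp
  qed
  show ?thesis
  proof (rule mat_opnorm_limit[where F = fins and B = "\<lambda>A. ap (map_mat restrict_dual F) (map_mat (trunc A) x)"])
    show "eventually (\<lambda>A. mat_opnorm (ap (map_mat restrict_dual F) (map_mat (trunc A) x)) \<le> z) fins"
      using fin' by (intro eventually_finite_subsets_at_top_weakI)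
    fix r s assume "r < dim_row (ap (map_mat restrict_dual F) x)"
      "s < dim_col (ap (map_mat restrict_dual F) x)"
    then have rs: "r < n * k" "s < n * k" using dF dx by auto
    note i = pairing_index[of r "map_mat restrict_dual F" x s]
    have lt: "r div k < n" "r mod k < k" "s div k < n" "s mod k < k" using i(2-5) rs dF dx by auto
    have "((\<lambda>A. restrict_dual (F $$ (r div k, s div k)) (trunc A (x $$ (r mod k, s mod k)))) \<longlongrightarrow>
      restrict_dual (F $$ (r div k, s div k)) (x $$ (r mod k, s mod k))) fins"
      by (intro OH_functional_trunc_tendsto restrict_dual_closed dF(3) dx(3) lt)
    moreover have "ap (map_mat restrict_dual F) (map_mat (trunc A) x) $$ (r, s) =
      restrict_dual (F $$ (r div k, s div k)) (trunc A (x $$ (r mod k, s mod k)))" for A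
      using pairing_apply[of r "map_mat restrict_dual F" "map_mat (trunc A) x" s] rs dF dx lt by simp
    moreover have "ap (map_mat restrict_dual F) x $$ (r, s) =
      restrict_dual (F $$ (r div k, s div k)) (x $$ (r mod k, s mod k))"
      using pairing_apply[of r "map_mat restrict_dual F" x s] rs dF(1,2) dx(1,2) lt by simp
    ultimately show "((\<lambda>A. ap (map_mat restrict_dual F) (map_mat (trunc A) x) $$ (r, s)) \<longlongrightarrow>
      ap (map_mat restrict_dual F) x $$ (r, s)) fins" by simp
  qed simp_all
qed

theorem restrict_dual_completely_isometric:
  "completely_isometric_iso (op_dual MA) (op_dual (OH I)) restrict_dual"
  unfolding completely_isometric_iso_def
proof (intro conjI allI ballI)
  show "linear_map_on (op_dual MA) (op_dual (OH I)) restrict_dual"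
    unfolding linear_map_on_def
  proof (intro conjI ballI allI)
    show "restrict_dual \<in> carrier (op_dual MA) \<rightarrow> carrier (op_dual (OH I))" using restrict_dual_closed by blast
    fix p assume p: "p \<in> carrier (op_dual MA)"
    have "coef (c \<odot>\<^bsub>op_dual MA\<^esub> p) = (\<lambda>i. c * coef p i)" for c by (auto simp: coef_def op_dual_def)
    then have "restrict_dual (c \<odot>\<^bsub>op_dual MA\<^esub> p) x = c * restrict_dual p x" for c x
      using infsum_cmult_right'[of c "\<lambda>i. x i * coef p i" I] by (simp add: restrict_dual_def mult.left_commute)
    then show "restrict_dual (c \<odot>\<^bsub>op_dual MA\<^esub> p) = c \<odot>\<^bsub>op_dual (OH I)\<^esub> restrict_dual p" for c
      by (auto simp: op_dual_def)
    fix p' assume p': "p' \<in> carrier (op_dual MA)"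
    have "coef (p \<oplus>\<^bsub>op_dual MA\<^esub> p') = (\<lambda>i. coef p i + coef p' i)" by (auto simp: coef_def op_dual_def)
    then have "restrict_dual (p \<oplus>\<^bsub>op_dual MA\<^esub> p') x = restrict_dual p x + restrict_dual p' x" for x
      using infsum_add[OF OH_mult_summable[OF _ coef_ell2[OF p]] OH_mult_summable[OF _ coef_ell2[OF p']], of x x]
      by (simp add: restrict_dual_def distrib_left)
    then show "restrict_dual (p \<oplus>\<^bsub>op_dual MA\<^esub> p') = restrict_dual p \<oplus>\<^bsub>op_dual (OH I)\<^esub> restrict_dual p'"
      by (auto simp: op_dual_def)
  qed
  show "bij_betw restrict_dual (carrier (op_dual MA)) (carrier (op_dual (OH I)))"
    unfolding bij_betw_def
  proof (intro conjI equalityI subsetI)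
    show "inj_on restrict_dual (carrier (op_dual MA))" using restrict_dual_inj by (auto simp: inj_on_def)
    show "f \<in> restrict_dual ` carrier (op_dual MA)" if "f \<in> carrier (op_dual (OH I))" for f
      using restrict_dual_surj[OF that] by blast
  qed (use restrict_dual_closed in blast)
  fix n F assume F: "F \<in> matrices (op_dual MA) n n"
  show "mnorm (op_dual (OH I)) (map_mat restrict_dual F) = mnorm (op_dual MA) F"
    unfolding op_dual_def opspace.simps
  proof (rule Sup_real_eqI)
    fix z
    show "(\<forall>y\<in>{mat_opnorm (ap (map_mat restrict_dual F) x) | x k. x \<in> Mat k k \<and> mnorm (OH I) x \<le> 1}. y \<le> z)
      \<longleftrightarrow> (\<forall>y\<in>{mat_opnorm (ap F x) | x k. x \<in> matrices MA k k \<and> mnorm MA x \<le> 1}. y \<le> z)"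
      using restrict_dual_isometry_le[OF F, of z] restrict_dual_isometry_ge[OF F, of z] by blast
  qed
qed

end

theorem proposition4p3:
  fixes I :: "'i set"
  shows "completely_isometrically_isomorphic
           (haagerup_dual (OH I) (OH I) (\<lambda>a x. a \<otimes>\<^bsub>OH I\<^esub> x))
           (op_dual (OH I))"
  unfolding completely_isometrically_isomorphic_def haagerup_dual_def module_tensor_eq
  using restrict_dual_completely_isometric by blast

end
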